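(* Fix any integers $n\geq 30$ and $p\geq 3n$, and any real $\sigma\geq 0$. Then there exists $\beta^*\in\mathbb{R}^p$ with $\frac12\leq\|\beta^*\|_2\leq\|\beta^*\|_1\leq 1$ such that the following holds. Let $(x^{(i)},y^{(i)})$, $i=1,\dots,n$, be i.i.d. samples from the distribution on $\mathbb{R}^p\times\mathbb{R}$ defined by drawing $x^{(i)}\sim N(0,\mathbf{I}_p)$ and $y^{(i)}\sim N\left(x^{(i)T}\beta^*,\sigma^2\right)$ (conditionally on $x^{(i)}$), and let $(x,y)$ be a new draw from the same distribution, independent of the training sample. (a) For any sample, for all $B\geq 0$, there is a choice of $$\hat\beta^B\in\arg\min_{\|\beta\|_1\leq B}\sum_{i=1}^n\left(y^{(i)}-x^{(i)T}\beta\right)^2$$ such that $$\mathbb{E}\left[\left(y-x^T\hat\beta^B\right)^2\right]\geq\sigma^2+\frac{1}{32\,n\log^2(3n)}.$$ (b) Additionally, if $100\leq\frac{\sqrt n}{\sigma}\leq p$, then with probability at least $\frac12$ over the sample, for all $B\geq 0$, there is a choice of $\hat\beta^B\in\arg\min_{\|\beta\|_1\leq B}\sum_{i=1}^n\left(y^{(i)}-x^{(i)T}\beta\right)^2$ such that $$\mathbb{E}\left[\left(y-x^T\hat\beta^B\right)^2\right]\geq\sigma^2+\frac{\sigma}{102400\,\sqrt n\,\log^2\left(\max\left\{3n,\left\lceil\frac{\sqrt n}{\sigma}\right\rceil\right\}\right)}.$$ In both parts the expectation is taken over the new sample $(x,y)$ only, with the training sample (and hence $\hat\beta^B$) held fi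xed.
   Context: $\mathbf{I}_p$ is the $p\times p$ identity matrix; $\|\cdot\|_1$ and $\|\cdot\|_2$ are the $\ell_1$ and Euclidean norms on $\mathbb{R}^p$; $\log$ is the natural logarithm and $\log^2(t)=(\log t)^2$. When $\sigma=0$, $N(m,0)$ is the point mass at $m$; the condition $100\leq\sqrt n/\sigma\leq p$ in part (b) is understood to include $\sigma>0$. The vector $\hat\beta^B$ is the $\ell_1$-regularized least-squares predictor with $\ell_1$-norm bound $B$. The minimizer need not be unique; when it is unique, the inequality is asserted for that minimizer, and when it is not unique, the inequality is asserted for some choice of minimizer (for each $B\ge 0$). The same vector $\beta^*$ serves for both parts. *)

theory Defs
  imports "HOL-Probability.Probability"
begin

definition l1_norm :: "real ^ 'p \<Rightarrow> real" where
  "l1_norm \<beta> = (\<Sum>j\<in>UNIV. \<bar>\<beta> $ j\<bar>)"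

(* As in normal_density, the second argument is the standard deviation. *)
definition normal_measure :: "real \<Rightarrow> real \<Rightarrow> real measure" where
  "normal_measure m \<sigma> =
     (if \<sigma> = 0 then return borel m else density lborel (\<lambda>x. ennreal (normal_density m \<sigma> x)))"

(* N(0, I_p): the law of a vector with independent standard normal coordinates. *)
definition std_normal_vec :: "(real ^ 'p::finite) measure" where
  "std_normal_vec = distr (Pi\<^sub>M UNIV (\<lambda>_::'p. normal_measure 0 1)) borel (\<lambda>f. \<chi> j. f j)"

definition data_distr :: "real ^ 'p::finite \<Rightarrow> real \<Rightarrow> ((real ^ 'p) \<times> real) measure" where
  "data_distr \<beta> \<sigma> =
     std_normal_vec \<bind> (\<lambda>x. normal_measure (x \<bullet> \<beta>) \<sigma> \<bind> (\<lambda>y. return borel (x, y)))"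

definition sample_distr ::
    "nat \<Rightarrow> real ^ 'p::finite \<Rightarrow> real \<Rightarrow> (nat \<Rightarrow> (real ^ 'p) \<times> real) measure" where
  "sample_distr n \<beta> \<sigma> = Pi\<^sub>M {1..n} (\<lambda>_. data_distr \<beta> \<sigma>)"

definition sq_loss :: "real ^ 'p::finite \<Rightarrow> (real ^ 'p) \<times> real \<Rightarrow> real" where
  "sq_loss b z = (snd z - fst z \<bullet> b)\<^sup>2"

definition train_loss :: "nat \<Rightarrow> (nat \<Rightarrow> (real ^ 'p::finite) \<times> real) \<Rightarrow> real ^ 'p \<Rightarrow> real" where
  "train_loss n S b = (\<Sum>i=1..n. sq_loss b (S i))"

definition test_error :: "real ^ 'p::finite \<Rightarrow> real \<Rightarrow> real ^ 'p \<Rightarrow> real" where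
  "test_error \<beta> \<sigma> b = (\<integral>z. sq_loss b z \<partial>data_distr \<beta> \<sigma>)"

(* Argmin set, since the minimizer need not be unique. *)
definition l1_predictors ::
    "nat \<Rightarrow> (nat \<Rightarrow> (real ^ 'p::finite) \<times> real) \<Rightarrow> real \<Rightarrow> (real ^ 'p) set" where
  "l1_predictors n S B = {b. is_arg_min (train_loss n S) (\<lambda>b. l1_norm b \<le> B) b}"

text \<open>
  The kernel in \<^term>\<open>data_distr\<close> is measurable, so the monadic bind there does denote the
  intended probability measure, also in the degenerate case of zero noise.
\<close>

lemma prob_space_normal_measure: "\<sigma> \<ge> 0 \<Longrightarrow> prob_space (normal_measure m \<sigma>)"
  by (auto simp: normal_measure_def intro!: prob_space_return prob_space_normal_density)

lemma sets_normal_measure [simp, measurable_cong]: "sets (normal_measure m \<sigma>) = sets borel"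
  by (simp add: normal_measure_def)

lemma normal_measure_affine:
  assumes "\<sigma> \<ge> 0"
  shows "normal_measure m \<sigma> = distr (normal_measure 0 1) borel (\<lambda>z. m + \<sigma> * z)"
proof -
  interpret prob_space "normal_measure 0 1" by (rule prob_space_normal_measure) simp
  show ?thesis
  proof (cases "\<sigma> = 0")
    case True
    have "distr (normal_measure 0 1) borel (\<lambda>z::real. m) = return borel m"
      using distr_const[of m borel] by simp
    then show ?thesis using True by (simp add: normal_measure_def)
  next
    case False
    have "distributed (normal_measure 0 1) lborel (\<lambda>x. x) (normal_density 0 1)"
      by (auto simp: distributed_def normal_measure_def intro!: distr_id2)
    then have "distributed (normal_measure 0 1) lborel (\<lambda>x. m + \<sigma> * x)
        (normal_density (m + \<sigma> * 0) (\<bar>\<sigma>\<bar> * 1))"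
      using False assms by (intro normal_density_affine) auto
    then have "distr (normal_measure 0 1) lborel (\<lambda>x. m + \<sigma> * x) =
        density lborel (\<lambda>x. ennreal (normal_density m \<sigma> x))"
      using assms by (simp add: distributed_def)
    moreover have "distr (normal_measure 0 1) borel (\<lambda>x. m + \<sigma> * x)
        = distr (normal_measure 0 1) lborel (\<lambda>x. m + \<sigma> * x)"
      by (intro distr_cong) auto
    ultimately show ?thesis using False by (simp add: normal_measure_def)
  qed
qed

lemma sets_std_normal_vec [simp, measurable_cong]: "sets std_normal_vec = sets borel"
  by (simp add: std_normal_vec_def)

lemma prob_space_std_normal_vec: "prob_space (std_normal_vec :: (real ^ 'p::finite) measure)"
proof -
  interpret N: prob_space "normal_measure 0 1" by (rule prob_space_normal_measure) simp
  interpret product_prob_space "\<lambda>_::'p. normal_measure 0 1" UNIV ..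
  have "(\<lambda>f. \<chi> j. f j) \<in> borel_measurable (Pi\<^sub>M UNIV (\<lambda>_::'p. normal_measure 0 1))"
  proof (subst borel_measurable_euclidean_space, rule ballI)
    fix i :: "real ^ 'p" assume "i \<in> Basis"
    then obtain k where "i = axis k 1" unfolding Basis_vec_def by auto
    then have "(\<lambda>f. (\<chi> j. f j) \<bullet> i) = (\<lambda>f. f k)"
      by (simp add: inner_axis)
    then show "(\<lambda>f. (\<chi> j. f j) \<bullet> i) \<in> borel_measurable (Pi\<^sub>M UNIV (\<lambda>_::'p. normal_measure 0 1))"
      using measurable_component_singleton[of k UNIV "\<lambda>_. normal_measure 0 1"]
      by (simp cong: measurable_cong_sets)
  qed
  then show ?thesis
    unfolding std_normal_vec_def by (rule prob_space_distr)
qed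

lemma normal_kernel_measurable:
  assumes "\<sigma> \<ge> 0"
  shows "(\<lambda>x::real ^ 'p::finite. normal_measure (x \<bullet> \<beta>) \<sigma>) \<in> borel \<rightarrow>\<^sub>M subprob_algebra borel"
proof -
  interpret prob_space "normal_measure 0 1" by (rule prob_space_normal_measure) simp
  have "(\<lambda>x. distr (normal_measure 0 1) borel (\<lambda>z. x \<bullet> \<beta> + \<sigma> * z))
      \<in> borel \<rightarrow>\<^sub>M subprob_algebra borel"
    by (rule measurable_distr2[where M = borel])
       (auto simp: space_subprob_algebra intro!: measurable_const subprob_space_axioms)
  then show ?thesis
    by (simp add: normal_measure_affine[OF assms, symmetric])
qed

lemma data_kernel_measurable:
  assumes "\<sigma> \<ge> 0"
  shows "(\<lambda>x::real ^ 'p::finite. normal_measure (x \<bullet> \<beta>) \<sigma> \<bind> (\<lambda>y. return borel (x, y)))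
    \<in> borel \<rightarrow>\<^sub>M subprob_algebra borel"
proof (rule measurable_bind[OF normal_kernel_measurable[OF assms]])
  have "(\<lambda>z::(real ^ 'p) \<times> real. (fst z, snd z)) \<in> borel \<Otimes>\<^sub>M borel \<rightarrow>\<^sub>M borel"
    by (simp add: borel_prod)
  then show "(\<lambda>z::(real ^ 'p) \<times> real. return borel (fst z, snd z))
      \<in> borel \<Otimes>\<^sub>M borel \<rightarrow>\<^sub>M subprob_algebra borel"
    by (rule measurable_compose[OF _ return_measurable])
qed

lemma sets_data_distr [simp, measurable_cong]:
  "sets (data_distr \<beta> \<sigma> :: ((real ^ 'p::finite) \<times> real) measure) = sets borel"
proof -
  interpret prob_space "std_normal_vec :: (real ^ 'p) measure" by (rule prob_space_std_normal_vec)
  have ne: "space (normal_measure m \<sigma>) \<noteq> {}" for m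
    by (simp add: normal_measure_def)
  show ?thesis
    unfolding data_distr_def
    by (intro sets_bind not_empty) (simp_all add: ne)
qed

lemma prob_space_data_distr:
  fixes \<beta> :: "real ^ 'p::finite"
  assumes "\<sigma> \<ge> 0"
  shows "prob_space (data_distr \<beta> \<sigma>)"
proof -
  interpret X: prob_space "std_normal_vec :: (real ^ 'p) measure" by (rule prob_space_std_normal_vec)
  have "prob_space (normal_measure (x \<bullet> \<beta>) \<sigma> \<bind> (\<lambda>y. return borel (x, y)))" for x :: "real ^ 'p"
  proof -
    interpret Y: prob_space "normal_measure (x \<bullet> \<beta>) \<sigma>"
      by (rule prob_space_normal_measure[OF assms])
    have "(\<lambda>y::real. (x, y)) \<in> borel \<rightarrow>\<^sub>M borel"
      by (intro borel_measurable_Pair) simp_all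
    then have "(\<lambda>y. return borel (x, y)) \<in> normal_measure (x \<bullet> \<beta>) \<sigma> \<rightarrow>\<^sub>M subprob_algebra borel"
      by (intro measurable_compose[OF _ return_measurable]) (simp cong: measurable_cong_sets)
    then show ?thesis
      by (rule Y.prob_space_bind[rotated]) (auto intro!: prob_space_return AE_I2)
  qed
  moreover have "(\<lambda>x. normal_measure (x \<bullet> \<beta>) \<sigma> \<bind> (\<lambda>y. return borel (x, y)))
      \<in> std_normal_vec \<rightarrow>\<^sub>M subprob_algebra borel"
    using data_kernel_measurable[OF assms, of \<beta>] by (simp cong: measurable_cong_sets)
  ultimately show ?thesis
    unfolding data_distr_def by (intro X.prob_space_bind) auto
qed

lemma prob_space_sample_distr:
  "\<sigma> \<ge> 0 \<Longrightarrow> prob_space (sample_distr n \<beta> \<sigma>)"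
  unfolding sample_distr_def by (intro prob_space_PiM prob_space_data_distr)

end

theory Submission
  imports Defs
begin

text \<open>The features are isotropic, so the test error of \<open>b\<close> is \<open>\<sigma>\<^sup>2 + (norm (b - \<beta>))\<^sup>2\<close> (lemma \<open>test_error_eq\<close>), and the
claim is that for every budget \<open>B\<close> some lasso solution stays far from \<open>\<beta>\<close>. Write \<open>l = ln (3 * n)\<close> and
\<open>K = sqrt n / \<sigma>\<close>. The target \<open>\<beta>\<close> is \<open>1 / 2\<close> at one coordinate, \<open>1 / (20 * n)\<close> on a set \<open>A\<close> of \<open>2 * n\<close> coordinates and,
when the noise is not too small, \<open>2 / (5 * m)\<close> on a further block \<open>J\<close> of \<open>m\<close> coordinates.

Part (a). Moving a minimizer along a kernel vector of its active columns removes an active coordinate without raising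
the loss or the norm, so some minimizer has at most \<open>n\<close> nonzero coordinates (\<open>sparse_lasso_min_exists\<close>). It vanishes
on at least \<open>n\<close> coordinates of \<open>A\<close>, which costs a squared distance of at least \<open>1 / (400 * n)\<close>. The excess in (b) is at most
\<open>1 / (102400 * K * l\<^sup>2)\<close>; if \<open>256 * K * l\<^sup>2 \<ge> n\<close> this is no larger, and (b) holds for every sample.

Part (b), if \<open>256 * K * l\<^sup>2 < n\<close>. The block has \<open>m = \<lfloor>9 * l\<^sup>2 * K\<rfloor>\<close> coordinates; together they carry norm \<open>2 / 5\<close>, but
each of them is buried in noise. Let \<open>b0\<close> be the lasso solution that must vanish on \<open>J\<close>, let \<open>\<zeta>\<close> be its normalized
residual, \<open>a j\<close> the columns of the design, and \<open>\<kappa>\<close> the maximum of \<open>\<bar>\<zeta> \<bullet> a j\<bar>\<close> over \<open>j \<notin> J\<close>. Optimality of \<open>b0\<close> and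
of an unrestricted minimizer \<open>b\<close> together give

  \<open>\<kappa> * (\<Sum>j\<in>J. \<bar>b $ j\<bar>) \<le> (\<Sum>j\<in>J. b $ j * (\<zeta> \<bullet> a j))\<close>

(\<open>lasso_restricted_vs_full\<close>): budget spent on \<open>J\<close> must earn at least the rate \<open>\<kappa>\<close> that it earns elsewhere. If \<open>b\<close> were
close to \<open>\<beta>\<close>, the left side would be about \<open>2 / 5 * \<kappa>\<close>, and the right side is smaller than that
(\<open>lasso_error_from_correlations\<close>, \<open>correlation_budget\<close>). This rests on three facts.

\<^item> \<open>\<kappa> \<ge> 1 / 16\<close> for all \<open>B\<close> at once, because the Gaussian matrix of the columns outside \<open>J\<close> has a large least singular
value (\<open>least_singular_value_of_net\<close>, \<open>least_singular_value_prob\<close>).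

\<^item> \<open>\<zeta>\<close> is almost independent of the block. A Householder reflection of the space spanned by features and noise gathers
the planted signal and the noise in one coordinate (\<open>planted_block_reflection\<close>). It preserves the Gaussian law, and
afterwards the response and the outer columns, hence \<open>\<zeta>\<close>, do not involve the Gaussian coordinates of the block; the block
columns differ from these coordinates by an explicit small correction.

\<^item> All \<open>B\<close> can be handled by a union bound over at most \<open>n ^ 3\<close> directions, because residual directions with nearby values
of \<open>\<kappa>\<close> are themselves close (\<open>residual_directions_close\<close>, \<open>residual_dirs_net\<close>). For directions with
\<open>\<kappa> \<ge> n / 32\<close> the total norm of the block columns is a sufficient bound.

Conditioning on the outer coordinates (\<open>gauss_array_product_lower_bound\<close>) gives probability at least
\<open>7 / 10 * (9 / 10)\<close>. If \<open>b0\<close> has residual zero, it is itself an unrestricted minimizer, and it misses all of \<open>J\<close>.\<close>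

section \<open>Gaussian families and chi-square tails\<close>

text \<open>Weighting by \<open>exp (\<theta> * x\<^sup>2)\<close> turns the standard normal density into a multiple of the centred normal
density with variance \<open>1 / (1 - 2 * \<theta>)\<close>.\<close>

lemma nn_integral_exp_sq_std_normal:
  assumes "\<theta> < 1 / 2"
  shows "(\<integral>\<^sup>+x. ennreal (exp (\<theta> * x\<^sup>2)) \<partial>normal_measure 0 1) = ennreal (1 / sqrt (1 - 2 * \<theta>))"
proof -
  define \<tau> where "\<tau> = 1 / sqrt (1 - 2 * \<theta>)"
  have pos: "1 - 2 * \<theta> > 0" using assms by simp
  have \<tau>: "\<tau> > 0" "\<tau>\<^sup>2 = 1 / (1 - 2 * \<theta>)"
    using pos by (simp_all add: \<tau>_def power_divide)
  interpret N: prob_space "density lborel (normal_density 0 \<tau>)"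
    by (rule prob_space_normal_density) (use \<tau> in simp)
  have eq: "normal_density 0 1 x * exp (\<theta> * x\<^sup>2) = \<tau> * normal_density 0 \<tau> x" for x
  proof -
    have "sqrt (2 * pi * \<tau>\<^sup>2) = sqrt (2 * pi) * \<tau>"
      using \<tau>(1) by (simp add: real_sqrt_mult)
    moreover have "- (x\<^sup>2 / (2 * \<tau>\<^sup>2)) = - (x\<^sup>2 / 2) + \<theta> * x\<^sup>2"
    proof -
      have "x\<^sup>2 / (2 * \<tau>\<^sup>2) = x\<^sup>2 / 2 * (1 / \<tau>\<^sup>2)" by simp
      also have "1 / \<tau>\<^sup>2 = 1 - 2 * \<theta>" using \<tau>(2) by simp
      finally show ?thesis by (simp add: algebra_simps)
    qed
    ultimately show ?thesis
      using \<tau>(1) by (simp add: normal_density_def exp_add[symmetric] add_ac)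
  qed
  have "(\<integral>\<^sup>+x. ennreal (exp (\<theta> * x\<^sup>2)) \<partial>normal_measure 0 1)
      = (\<integral>\<^sup>+x. ennreal \<tau> * ennreal (normal_density 0 \<tau> x) \<partial>lborel)"
    unfolding normal_measure_def
    by (simp add: nn_integral_density ennreal_mult'[symmetric] eq \<tau>(1) less_imp_le)
  also have "\<dots> = ennreal \<tau> * (\<integral>\<^sup>+x. ennreal (normal_density 0 \<tau> x) \<partial>lborel)"
    by (rule nn_integral_cmult) simp
  also have "(\<integral>\<^sup>+x. ennreal (normal_density 0 \<tau> x) \<partial>lborel) = 1"
    using N.emeasure_space_1 by (simp add: emeasure_density)
  finally show ?thesis by (simp add: \<tau>_def)
qed

context prob_space
begin

text \<open>Tail bounds are stated for such families, not for the coordinates of a product measure, because they are mostly applied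
to normalized linear combinations of the coordinates.\<close>

definition std_normal_family :: "('i \<Rightarrow> 'a \<Rightarrow> real) \<Rightarrow> 'i set \<Rightarrow> bool" where
  "std_normal_family X I \<longleftrightarrow> finite I \<and> indep_vars (\<lambda>_. borel) X I \<and>
     (\<forall>i\<in>I. distr M borel (X i) = normal_measure 0 1)"

lemma std_normal_family_measurable:
  "std_normal_family X I \<Longrightarrow> i \<in> I \<Longrightarrow> X i \<in> borel_measurable M"
  by (auto simp: std_normal_family_def indep_vars_def)

lemma std_normal_family_subset:
  "std_normal_family X I \<Longrightarrow> J \<subseteq> I \<Longrightarrow> std_normal_family X J"
  unfolding std_normal_family_def
  by (auto intro: finite_subset indep_vars_subset)

lemma nn_integral_exp_sum_sq:
  assumes X: "std_normal_family X I" and "\<theta> < 1 / 2"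
  shows "(\<integral>\<^sup>+\<omega>. ennreal (exp (\<theta> * (\<Sum>i\<in>I. (X i \<omega>)\<^sup>2))) \<partial>M)
    = ennreal ((1 / sqrt (1 - 2 * \<theta>)) ^ card I)"
proof -
  have fin: "finite I" using X by (simp add: std_normal_family_def)
  have "(\<integral>\<^sup>+\<omega>. ennreal (exp (\<theta> * (\<Sum>i\<in>I. (X i \<omega>)\<^sup>2))) \<partial>M)
      = (\<integral>\<^sup>+\<omega>. (\<Prod>i\<in>I. ennreal (exp (\<theta> * (X i \<omega>)\<^sup>2))) \<partial>M)"
    by (simp add: sum_distrib_left exp_sum fin prod_ennreal)
  also have "\<dots> = (\<Prod>i\<in>I. \<integral>\<^sup>+\<omega>. ennreal (exp (\<theta> * (X i \<omega>)\<^sup>2)) \<partial>M)"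
    using X by (intro indep_vars_nn_integral fin)
      (auto simp: std_normal_family_def intro: indep_vars_compose2)
  also have "\<dots> = (\<Prod>i\<in>I. \<integral>\<^sup>+x. ennreal (exp (\<theta> * x\<^sup>2)) \<partial>normal_measure 0 1)"
  proof (rule prod.cong)
    fix i assume i: "i \<in> I"
    have "(\<integral>\<^sup>+x. ennreal (exp (\<theta> * x\<^sup>2)) \<partial>normal_measure 0 1)
        = (\<integral>\<^sup>+x. ennreal (exp (\<theta> * x\<^sup>2)) \<partial>distr M borel (X i))"
      using X i by (simp add: std_normal_family_def)
    also have "\<dots> = (\<integral>\<^sup>+\<omega>. ennreal (exp (\<theta> * (X i \<omega>)\<^sup>2)) \<partial>M)"
      using std_normal_family_measurable[OF X i] by (intro nn_integral_distr) auto
    finally show "(\<integral>\<^sup>+\<omega>. ennreal (exp (\<theta> * (X i \<omega>)\<^sup>2)) \<partial>M)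
        = (\<integral>\<^sup>+x. ennreal (exp (\<theta> * x\<^sup>2)) \<partial>normal_measure 0 1)" ..
  qed simp
  also have "\<dots> = ennreal ((1 / sqrt (1 - 2 * \<theta>)) ^ card I)"
    using assms(2) by (simp add: nn_integral_exp_sq_std_normal ennreal_power)
  finally show ?thesis .
qed

text \<open>One statement for both tails: the sign of \<open>\<theta>\<close> selects the upper or the lower one.\<close>

lemma sum_sq_chernoff:
  assumes X: "std_normal_family X I" and "\<theta> < 1 / 2"
  shows "prob {\<omega> \<in> space M. \<theta> * a \<le> \<theta> * (\<Sum>i\<in>I. (X i \<omega>)\<^sup>2)}
    \<le> exp (- \<theta> * a) * (1 / sqrt (1 - 2 * \<theta>)) ^ card I"
proof -
  have [measurable]: "(\<lambda>\<omega>. \<Sum>i\<in>I. (X i \<omega>)\<^sup>2) \<in> borel_measurable M"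
    using std_normal_family_measurable[OF X] by measurable
  have "emeasure M {\<omega> \<in> space M. \<theta> * a \<le> \<theta> * (\<Sum>i\<in>I. (X i \<omega>)\<^sup>2)}
      \<le> emeasure M ({\<omega> \<in> space M. 1 \<le> ennreal (exp (- \<theta> * a)) *
            ennreal (exp (\<theta> * (\<Sum>i\<in>I. (X i \<omega>)\<^sup>2)))})"
    by (intro emeasure_mono)
       (auto simp: ennreal_mult'[symmetric] exp_add[symmetric] simp flip: ennreal_1
             intro!: ennreal_leI)
  also have "\<dots> \<le> ennreal (exp (- \<theta> * a)) *
      (\<integral>\<^sup>+\<omega>. ennreal (exp (\<theta> * (\<Sum>i\<in>I. (X i \<omega>)\<^sup>2))) * indicator (space M) \<omega> \<partial>M)"
    by (rule order_trans[OF _ nn_integral_Markov_inequality]) (auto intro!: emeasure_mono)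
  also have "\<dots> = ennreal (exp (- \<theta> * a)) * (\<integral>\<^sup>+\<omega>. ennreal (exp (\<theta> * (\<Sum>i\<in>I. (X i \<omega>)\<^sup>2))) \<partial>M)"
    by (intro arg_cong[where f = "(*) _"] nn_integral_cong) auto
  also have "\<dots> = ennreal (exp (- \<theta> * a) * (1 / sqrt (1 - 2 * \<theta>)) ^ card I)"
    by (simp only: nn_integral_exp_sum_sq[OF assms]) (simp add: ennreal_mult'[symmetric])
  finally show ?thesis
    using assms(2) by (simp add: emeasure_eq_measure)
qed

text \<open>The bound comes from \<open>\<theta> = 1 / 12\<close>, close to the optimal \<open>(1 - 1 / 1.21) / 2\<close>. The level \<open>1.21\<close> has the rational
square root \<open>1.1\<close>, which bounds the norms.\<close>

lemma prob_sum_sq_ge: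
  assumes X: "std_normal_family X I"
  shows "prob {\<omega> \<in> space M. 121 / 100 * card I \<le> (\<Sum>i\<in>I. (X i \<omega>)\<^sup>2)} \<le> exp (- 9 / 1000 * card I)"
proof -
  have *: "exp (- 121 / 1200 :: real) * (1 / sqrt (5 / 6)) \<le> exp (- 9 / 1000)"
  proof -
    have "(6::real) / 5 \<le> (exp (2 * (121 / 1200 - 9 / 1000)))"
      by (rule order_trans[OF _ exp_lower_Taylor_quadratic]) (auto simp: power2_eq_square)
    then have "6 / 5 \<le> (exp (121 / 1200 - 9 / 1000) :: real)\<^sup>2"
      by (simp only: exp_double)
    then have "sqrt (6 / 5) \<le> exp (121 / 1200 - 9 / 1000)"
      by (rule real_le_lsqrt[rotated -1]) auto
    moreover have "1 / sqrt (5 / 6) = sqrt (6 / 5)" by (simp add: real_sqrt_divide)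
    ultimately have "exp (- 121 / 1200 :: real) * (1 / sqrt (5 / 6))
        \<le> exp (- 121 / 1200) * exp (121 / 1200 - 9 / 1000)"
      by (intro mult_left_mono) auto
    then show ?thesis by (simp add: exp_add[symmetric])
  qed
  have "prob {\<omega> \<in> space M. 121 / 100 * card I \<le> (\<Sum>i\<in>I. (X i \<omega>)\<^sup>2)}
     = prob {\<omega> \<in> space M. 1 / 12 * (121 / 100 * card I) \<le> 1 / 12 * (\<Sum>i\<in>I. (X i \<omega>)\<^sup>2)}"
    by (intro arg_cong[where f = prob]) auto
  also have "\<dots> \<le> exp (- (1 / 12) * (121 / 100 * card I)) * (1 / sqrt (1 - 2 * (1 / 12))) ^ card I"
    by (rule sum_sq_chernoff[OF X]) simp
  also have "\<dots> = (exp (- 121 / 1200) * (1 / sqrt (5 / 6))) ^ card I"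
    by (simp add: power_mult_distrib power_divide exp_of_nat_mult[symmetric] mult_ac)
  also have "\<dots> \<le> exp (- 9 / 1000) ^ card I"
    by (rule power_mono[OF *]) simp
  finally show ?thesis by (simp add: exp_of_nat_mult[symmetric] mult_ac)
qed

text \<open>The bound comes from \<open>\<theta> = -50\<close>, close to the optimal \<open>-99 / 2\<close>. Its base is small enough to beat the cardinality
of a net that grows exponentially.\<close>

lemma prob_sum_sq_le:
  assumes X: "std_normal_family X I"
  shows "prob {\<omega> \<in> space M. (\<Sum>i\<in>I. (X i \<omega>)\<^sup>2) \<le> card I / 100} \<le> sqrt (exp 1 / 101) ^ card I"
proof -
  have "prob {\<omega> \<in> space M. (\<Sum>i\<in>I. (X i \<omega>)\<^sup>2) \<le> card I / 100}
     = prob {\<omega> \<in> space M. (- 50) * (card I / 100) \<le> (- 50) * (\<Sum>i\<in>I. (X i \<omega>)\<^sup>2)}"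
    by (intro arg_cong[where f = prob]) auto
  also have "\<dots> \<le> exp (- (- 50) * (card I / 100)) * (1 / sqrt (1 - 2 * (- 50))) ^ card I"
    by (rule sum_sq_chernoff[OF X]) simp
  also have "\<dots> = (exp (1 / 2) * (1 / sqrt 101)) ^ card I"
    by (simp add: power_mult_distrib exp_of_nat_mult[symmetric] mult_ac power_divide)
  also have "exp (1 / 2) * (1 / sqrt 101) = sqrt (exp 1 / 101 :: real)"
  proof -
    have "sqrt (exp 1) = exp (1 / 2 :: real)"
      by (rule real_sqrt_unique) (simp_all add: exp_double[symmetric])
    then show ?thesis by (simp add: real_sqrt_divide)
  qed
  finally show ?thesis .
qed

text \<open>A single variable is a family with one member, and \<open>\<theta> = 3 / 8\<close> makes the normalizing factor exactly \<open>2\<close>.\<close>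

lemma prob_abs_std_normal_ge:
  assumes X: "X \<in> borel_measurable M" "distr M borel X = normal_measure 0 1" and "t \<ge> 0"
  shows "prob {\<omega> \<in> space M. t \<le> \<bar>X \<omega>\<bar>} \<le> 2 * exp (- 3 / 8 * t\<^sup>2)"
proof -
  have "indep_vars (\<lambda>_. borel) (\<lambda>_::unit. X) {()}"
    unfolding indep_vars_def indep_sets_def
  proof (intro conjI ballI allI impI)
    fix J :: "unit set" and A assume J: "J \<subseteq> {()}" "J \<noteq> {}"
    then have "J = {()}" by auto
    then show "prob (\<Inter>j\<in>J. A j) = (\<Prod>j\<in>J. prob (A j))" by simp
  qed (use X in \<open>auto dest!: sets.sigma_sets_subset[THEN subsetD, rotated]\<close>)
  then have F: "std_normal_family (\<lambda>_::unit. X) {()}"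
    using X by (simp add: std_normal_family_def)
  have "prob {\<omega> \<in> space M. t \<le> \<bar>X \<omega>\<bar>}
     = prob {\<omega> \<in> space M. 3 / 8 * t\<^sup>2 \<le> 3 / 8 * (\<Sum>i\<in>{()}. (X \<omega>)\<^sup>2)}"
    using assms(3) by (intro arg_cong[where f = prob]) (auto simp: abs_le_square_iff[symmetric])
  also have "\<dots> \<le> exp (- (3 / 8) * t\<^sup>2) * (1 / sqrt (1 - 2 * (3 / 8))) ^ card {()}"
    by (rule sum_sq_chernoff[OF F]) simp
  also have "\<dots> = 2 * exp (- 3 / 8 * t\<^sup>2)"
  proof -
    have "sqrt (1 - 2 * (3 / 8)) = (1 / 2 :: real)"
      by (rule real_sqrt_unique) (auto simp: power2_eq_square)
    then show ?thesis by (simp only:) simp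
  qed
  finally show ?thesis .
qed

lemma distr_std_normal_lincomb:
  assumes X: "std_normal_family X I" and a: "(\<Sum>i\<in>I. (a i)\<^sup>2) = 1"
  shows "distr M borel (\<lambda>\<omega>. \<Sum>i\<in>I. a i * X i \<omega>) = normal_measure 0 1"
proof -
  define J where "J = {i \<in> I. a i \<noteq> 0}"
  have fin: "finite I" using X by (simp add: std_normal_family_def)
  have XJ: "std_normal_family X J"
    by (rule std_normal_family_subset[OF X]) (auto simp: J_def)
  have finJ: "finite J" using fin by (simp add: J_def)
  have aJ: "(\<Sum>i\<in>J. (a i)\<^sup>2) = 1"
    unfolding a[symmetric] J_def by (intro sum.mono_neutral_left fin) auto
  have neJ: "J \<noteq> {}" using aJ by auto
  have sJ: "(\<Sum>i\<in>I. a i * X i \<omega>) = (\<Sum>i\<in>J. a i * X i \<omega>)" for \<omega>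
    unfolding J_def by (intro sum.mono_neutral_right fin) auto
  have "distributed M lborel (\<lambda>\<omega>. \<Sum>i\<in>J. a i * X i \<omega>)
      (normal_density (\<Sum>i\<in>J. 0) (sqrt (\<Sum>i\<in>J. (\<bar>a i\<bar>)\<^sup>2)))"
  proof (rule sum_indep_normal[OF finJ neJ])
    show "indep_vars (\<lambda>_. borel) (\<lambda>i \<omega>. a i * X i \<omega>) J"
      using XJ by (intro indep_vars_compose2[where X = X and Y = "\<lambda>i x. a i * x"])
        (auto simp: std_normal_family_def)
  next
    fix i assume i: "i \<in> J"
    show "0 < \<bar>a i\<bar>" using i by (simp add: J_def)
    have "distr M borel (X i) = normal_measure 0 1"
      using XJ i by (auto simp: std_normal_family_def)
    moreover have "distr M lborel (X i) = distr M borel (X i)"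
      by (rule distr_cong) auto
    ultimately have "distributed M lborel (X i) (normal_density 0 1)"
      using std_normal_family_measurable[OF XJ i]
      by (simp add: distributed_def normal_measure_def)
    from normal_density_affine[OF this, of "a i" 0] i
    show "distributed M lborel (\<lambda>\<omega>. a i * X i \<omega>) (normal_density 0 \<bar>a i\<bar>)"
      by (simp add: J_def)
  qed
  then have "distr M lborel (\<lambda>\<omega>. \<Sum>i\<in>J. a i * X i \<omega>) = density lborel (normal_density 0 1)"
    by (simp add: aJ distributed_def)
  moreover have "distr M lborel (\<lambda>\<omega>. \<Sum>i\<in>J. a i * X i \<omega>) = distr M borel (\<lambda>\<omega>. \<Sum>i\<in>J. a i * X i \<omega>)"
    by (rule distr_cong) auto
  ultimately show ?thesis
    by (simp add: sJ normal_measure_def)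
qed

end

definition gauss_array :: "'i set \<Rightarrow> ('i \<Rightarrow> real) measure" where
  "gauss_array I = Pi\<^sub>M I (\<lambda>_. normal_measure 0 1)"

lemma prob_space_gauss_array: "prob_space (gauss_array I)"
  unfolding gauss_array_def by (intro prob_space_PiM prob_space_normal_measure) simp

lemma sets_gauss_array [measurable_cong]: "sets (gauss_array I) = sets (Pi\<^sub>M I (\<lambda>_. borel))"
  unfolding gauss_array_def by (intro sets_PiM_cong) auto

lemma measurable_gauss_array_component [measurable]:
  "i \<in> I \<Longrightarrow> (\<lambda>\<omega>. \<omega> i) \<in> borel_measurable (gauss_array I)"
  by measurable

lemma distr_gauss_array_component:
  "finite I \<Longrightarrow> i \<in> I \<Longrightarrow> distr (gauss_array I) borel (\<lambda>\<omega>. \<omega> i) = normal_measure 0 1"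
proof -
  assume i: "finite I" "i \<in> I"
  interpret product_prob_space "\<lambda>_::'a. normal_measure 0 1" I
    by (simp add: product_prob_space_def product_prob_space_axioms_def product_sigma_finite_def
       prob_space_normal_measure prob_space_imp_sigma_finite)
  have "distr (gauss_array I) borel (\<lambda>\<omega>. \<omega> i) = distr (gauss_array I) (normal_measure 0 1) (\<lambda>\<omega>. \<omega> i)"
    by (rule distr_cong) auto
  then show ?thesis using PiM_component[OF i(2)] by (simp add: gauss_array_def)
qed

lemma std_normal_family_gauss_array:
  assumes "finite I"
  shows "prob_space.std_normal_family (gauss_array I) (\<lambda>i \<omega>. \<omega> i) I"
proof -
  interpret prob_space "gauss_array I" by (rule prob_space_gauss_array)
  have "indep_vars (\<lambda>_. borel) (\<lambda>i \<omega>. \<omega> i) I"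
  proof (cases "I = {}")
    case True then show ?thesis unfolding indep_vars_def indep_sets_def by simp
  next
    case False
    have "distr (gauss_array I) (Pi\<^sub>M I (\<lambda>_. borel)) (\<lambda>x. \<lambda>i\<in>I. x i) = gauss_array I"
    proof -
      have "distr (gauss_array I) (Pi\<^sub>M I (\<lambda>_. borel)) (\<lambda>x. \<lambda>i\<in>I. x i)
          = distr (gauss_array I) (gauss_array I) (\<lambda>x. x)"
        by (rule distr_cong)
          (simp_all add: sets_gauss_array, simp add: gauss_array_def space_PiM PiE_def extensional_restrict)
      then show ?thesis by simp
    qed
    moreover have "Pi\<^sub>M I (\<lambda>i. distr (gauss_array I) borel (\<lambda>\<omega>. \<omega> i)) = gauss_array I"
      unfolding gauss_array_def[of I]
      by (intro PiM_cong) (use distr_gauss_array_component[OF assms] in \<open>auto simp: gauss_array_def\<close>)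
    ultimately show ?thesis
      by (subst indep_vars_iff_distr_eq_PiM'[OF False]) auto
  qed
  then show ?thesis
    unfolding std_normal_family_def using distr_gauss_array_component[OF assms] assms by auto
qed

section \<open>Orthogonal invariance of the standard normal law\<close>

lemma measurable_vec_lambda_PiM:
  "(\<lambda>f. \<chi> j. f j) \<in> borel_measurable (Pi\<^sub>M UNIV (\<lambda>_::'k::finite. (borel :: real measure)))"
proof (subst borel_measurable_euclidean_space, rule ballI)
  fix i :: "real ^ 'k" assume "i \<in> Basis"
  then obtain k where "i = axis k 1" unfolding Basis_vec_def by auto
  then have "(\<lambda>f. (\<chi> j. f j) \<bullet> i) = (\<lambda>f. f k)"
    by (simp add: inner_axis)
  then show "(\<lambda>f. (\<chi> j. f j) \<bullet> i) \<in> borel_measurable (Pi\<^sub>M UNIV (\<lambda>_::'k. borel))"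
    using measurable_component_singleton[of k UNIV "\<lambda>_. borel"] by simp
qed

lemma prod_over_Basis_vec:
  "(\<Prod>b\<in>(Basis :: (real ^ 'k::finite) set). f b) = (\<Prod>k\<in>UNIV. f (axis k 1))"
proof -
  have "(Basis :: (real ^ 'k) set) = range (\<lambda>k. axis k 1)"
    by (auto simp: Basis_vec_def)
  then show ?thesis
    by (subst prod.reindex[unfolded comp_def, symmetric]) (auto simp: inj_on_def axis_eq_axis)
qed

lemma lborel_vec_eq_distr_PiM:
  "(lborel :: (real ^ 'k::finite) measure) = distr (Pi\<^sub>M UNIV (\<lambda>_. lborel)) borel (\<lambda>f. \<chi> j. f j)"
proof (rule lborel_eqI)
  interpret product_sigma_finite "\<lambda>_::'k. lborel :: real measure" ..
  fix l u :: "real ^ 'k" assume le: "\<And>b. b \<in> Basis \<Longrightarrow> l \<bullet> b \<le> u \<bullet> b"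
  have le': "l $ k \<le> u $ k" for k
    using le[of "axis k 1"] by (auto simp: inner_axis Basis_vec_def)
  have meas: "(\<lambda>f. \<chi> j. f j) \<in> borel_measurable (Pi\<^sub>M UNIV (\<lambda>_::'k. (lborel :: real measure)))"
    using measurable_vec_lambda_PiM by (simp cong: measurable_cong_sets sets_PiM_cong)
  have "(\<lambda>f. \<chi> j. f j) -` box l u \<inter> space (Pi\<^sub>M UNIV (\<lambda>_::'k. lborel))
      = Pi\<^sub>E UNIV (\<lambda>k. {l $ k <..< u $ k})"
    by (auto simp: space_PiM mem_box_cart PiE_def Pi_def)
  then have "emeasure (distr (Pi\<^sub>M UNIV (\<lambda>_. lborel)) borel (\<lambda>f. \<chi> j. f j)) (box l u)
      = emeasure (Pi\<^sub>M UNIV (\<lambda>_::'k. lborel)) (Pi\<^sub>E UNIV (\<lambda>k. {l $ k <..< u $ k}))"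
    by (subst emeasure_distr[OF meas]) auto
  also have "\<dots> = (\<Prod>k\<in>UNIV. emeasure lborel {l $ k <..< u $ k})"
    by (rule emeasure_PiM) auto
  also have "\<dots> = ennreal (\<Prod>k\<in>UNIV. u $ k - l $ k)"
    using le' by (simp add: prod_ennreal)
  also have "(\<Prod>k\<in>UNIV. u $ k - l $ k) = (\<Prod>b\<in>Basis. (u - l) \<bullet> b)"
    by (subst prod_over_Basis_vec) (simp add: inner_axis)
  finally show "emeasure (distr (Pi\<^sub>M UNIV (\<lambda>_. lborel)) borel (\<lambda>f. \<chi> j. f j)) (box l u)
      = (\<Prod>b\<in>Basis. (u - l) \<bullet> b)" .
qed simp

text \<open>For the standard normal vector this produces a density that depends on the norm alone.\<close>

lemma PiM_density:
  fixes f :: "'i \<Rightarrow> 'a \<Rightarrow> ennreal"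
  assumes fin: "finite I" and sf: "\<And>i. sigma_finite_measure (M i)"
    and f: "\<And>i. f i \<in> borel_measurable (M i)"
    and sfd: "\<And>i. sigma_finite_measure (density (M i) (f i))"
  shows "Pi\<^sub>M I (\<lambda>i. density (M i) (f i)) = density (Pi\<^sub>M I M) (\<lambda>x. \<Prod>i\<in>I. f i (x i))"
proof -
  interpret D: product_sigma_finite "\<lambda>i. density (M i) (f i)" using sfd by (simp add: product_sigma_finite_def)
  interpret P: product_sigma_finite M using sf by (simp add: product_sigma_finite_def)
  note [measurable] = f
  have "density (Pi\<^sub>M I M) (\<lambda>x. \<Prod>i\<in>I. f i (x i)) = Pi\<^sub>M I (\<lambda>i. density (M i) (f i))"
  proof (rule D.PiM_eqI[OF fin])
    fix A assume A: "\<And>i. i \<in> I \<Longrightarrow> A i \<in> sets (density (M i) (f i))"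
    then have [measurable]: "\<And>i. i \<in> I \<Longrightarrow> A i \<in> sets (M i)" by simp
    have "emeasure (density (Pi\<^sub>M I M) (\<lambda>x. \<Prod>i\<in>I. f i (x i))) (Pi\<^sub>E I A)
      = (\<integral>\<^sup>+x. (\<Prod>i\<in>I. f i (x i)) * indicator (Pi\<^sub>E I A) x \<partial>Pi\<^sub>M I M)"
      using fin by (subst emeasure_density) (auto intro!: sets_PiM_I_finite)
    also have "\<dots> = (\<integral>\<^sup>+x. (\<Prod>i\<in>I. f i (x i) * indicator (A i) (x i)) \<partial>Pi\<^sub>M I M)"
    proof (rule nn_integral_cong)
      fix x assume "x \<in> space (Pi\<^sub>M I M)"
      then have "x \<in> extensional I" by (auto simp: space_PiM PiE_def)
      then have "indicator (Pi\<^sub>E I A) x = (\<Prod>i\<in>I. indicator (A i) (x i) :: ennreal)"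
        using fin by (auto simp: indicator_def PiE_def Pi_def)
      then show "(\<Prod>i\<in>I. f i (x i)) * indicator (Pi\<^sub>E I A) x
          = (\<Prod>i\<in>I. f i (x i) * indicator (A i) (x i))"
        by (simp add: prod.distrib)
    qed
    also have "\<dots> = (\<Prod>i\<in>I. \<integral>\<^sup>+x. f i x * indicator (A i) x \<partial>M i)"
      by (rule P.product_nn_integral_prod[OF fin]) measurable
    also have "\<dots> = (\<Prod>i\<in>I. emeasure (density (M i) (f i)) (A i))"
      by (intro prod.cong refl) (subst emeasure_density, auto)
    finally show "emeasure (density (Pi\<^sub>M I M) (\<lambda>x. \<Prod>i\<in>I. f i (x i))) (Pi\<^sub>E I A)
      = (\<Prod>i\<in>I. emeasure (density (M i) (f i)) (A i))" .
  qed (auto intro!: sets_PiM_cong)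
  then show ?thesis ..
qed

lemma std_normal_vec_eq_density:
  "(std_normal_vec :: (real ^ 'k::finite) measure)
    = density lborel (\<lambda>x. ennreal ((1 / sqrt (2 * pi)) ^ CARD('k) * exp (- (norm x)\<^sup>2 / 2)))"
proof -
  let ?d = "\<lambda>x::real. ennreal (normal_density 0 1 x)"
  have meas: "(\<lambda>f. \<chi> j. f j) \<in> borel_measurable (Pi\<^sub>M UNIV (\<lambda>_::'k. (lborel :: real measure)))"
    using measurable_vec_lambda_PiM by (simp cong: measurable_cong_sets sets_PiM_cong)
  have sq: "(norm (x :: real ^ 'k))\<^sup>2 = (\<Sum>k\<in>UNIV. (x $ k)\<^sup>2)" for x
    by (simp add: norm_vec_def L2_set_def sum_nonneg)
  have prod: "(\<Prod>k\<in>UNIV. ?d ((x :: real ^ 'k) $ k))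
      = ennreal ((1 / sqrt (2 * pi)) ^ CARD('k) * exp (- (norm x)\<^sup>2 / 2))" for x
    by (simp add: prod_ennreal normal_density_def prod.distrib prod_dividef exp_sum[symmetric] sq
      sum_negf[symmetric] sum_divide_distrib power_divide)
  have "Pi\<^sub>M UNIV (\<lambda>_::'k. normal_measure 0 1)
      = density (Pi\<^sub>M UNIV (\<lambda>_. lborel)) (\<lambda>x. \<Prod>k\<in>UNIV. ?d (x k))"
  proof -
    have N: "normal_measure 0 1 = density lborel ?d" by (simp add: normal_measure_def)
    have "sigma_finite_measure (density lborel ?d)"
      unfolding N[symmetric] by (intro prob_space_imp_sigma_finite prob_space_normal_measure) simp
    then show ?thesis
      unfolding N by (intro PiM_density) (auto intro: lborel.sigma_finite_measure_axioms)
  qed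
  then have "(std_normal_vec :: (real ^ 'k) measure)
      = distr (density (Pi\<^sub>M UNIV (\<lambda>_. lborel)) (\<lambda>x. \<Prod>k\<in>UNIV. ?d ((\<chi> j. x j) $ k))) borel (\<lambda>f. \<chi> j. f j)"
    by (simp add: std_normal_vec_def)
  also have "\<dots> = density (distr (Pi\<^sub>M UNIV (\<lambda>_. lborel)) borel (\<lambda>f. \<chi> j. f j))
       (\<lambda>x::real ^ 'k. \<Prod>k\<in>UNIV. ?d (x $ k))"
    by (rule density_distr[symmetric, OF _ meas]) simp
  also have "\<dots> = density lborel (\<lambda>x::real ^ 'k. \<Prod>k\<in>UNIV. ?d (x $ k))"
    by (simp only: lborel_vec_eq_distr_PiM[symmetric])
  finally show ?thesis by (simp add: prod)
qed

text \<open>A well-ordered copy of a finite index type. The change of variables formula for linear images presupposes ordered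
coordinates; \<open>lborel_vec_reindex\<close> carries its consequence for orthogonal maps back to an arbitrary finite index type.\<close>

typedef ('k::finite) idx = "{..<CARD('k)}"
  by (rule exI[of _ 0]) simp

instance idx :: (finite) finite
proof
  show "finite (UNIV :: 'a idx set)"
    using type_definition.univ[OF type_definition_idx] by (metis finite_imageI finite_lessThan)
qed

instantiation idx :: (finite) wellorder
begin

definition less_eq_idx where "a \<le> b \<longleftrightarrow> Rep_idx a \<le> Rep_idx b"

definition less_idx where "a < b \<longleftrightarrow> Rep_idx a < Rep_idx b"

instance
proof
  fix P :: "'a idx \<Rightarrow> bool" and a
  assume *: "\<And>x. (\<And>y. y < x \<Longrightarrow> P y) \<Longrightarrow> P x"
  show "P a"
    by (induction "Rep_idx a" arbitrary: a rule: less_induct) (auto intro: * simp: less_idx_def)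
qed (auto simp: less_eq_idx_def less_idx_def Rep_idx_inject)

end

lemma card_idx: "CARD(('k::finite) idx) = CARD('k)"
  using type_definition.card[OF type_definition_idx] by auto

lemma lborel_vec_reindex:
  fixes \<phi> :: "'i::finite \<Rightarrow> 'k::finite"
  assumes "bij \<phi>"
  shows "distr lborel borel (\<lambda>x :: real ^ 'k. \<chi> i. x $ \<phi> i) = lborel"
proof (rule lborel_eqI[symmetric])
  fix l u :: "real ^ 'i" assume le: "\<And>b. b \<in> Basis \<Longrightarrow> l \<bullet> b \<le> u \<bullet> b"
  define l' u' where "l' = (\<chi> k. l $ inv \<phi> k)" "u' = (\<chi> k. u $ inv \<phi> k)"
  have le': "l $ k \<le> u $ k" for k
    using le[of "axis k 1"] by (auto simp: inner_axis Basis_vec_def)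
  have inv: "inv \<phi> (\<phi> i) = i" "\<phi> (inv \<phi> k) = k" for i k
    using assms by (auto simp: bij_is_inj bij_is_surj surj_f_inv_f)
  have [measurable]: "(\<lambda>x :: real ^ 'k. \<chi> i. x $ \<phi> i) \<in> borel_measurable borel"
    by (intro borel_measurable_continuous_onI continuous_intros)
  have "(\<lambda>x :: real ^ 'k. \<chi> i. x $ \<phi> i) -` box l u \<inter> space lborel = box l' u'"
    unfolding l'_u'_def by (auto simp: mem_box_cart inv) (metis inv)+
  then have "emeasure (distr lborel borel (\<lambda>x :: real ^ 'k. \<chi> i. x $ \<phi> i)) (box l u)
      = emeasure lborel (box l' u')"
    by (subst emeasure_distr) auto
  also have "\<dots> = ennreal (\<Prod>b\<in>Basis. (u' - l') \<bullet> b)"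
    by (rule emeasure_lborel_box) (auto simp: Basis_vec_def inner_axis l'_u'_def le')
  also have "(\<Prod>b\<in>Basis. (u' - l') \<bullet> b) = (\<Prod>k\<in>UNIV. u $ inv \<phi> k - l $ inv \<phi> k)"
    by (subst prod_over_Basis_vec) (simp add: inner_axis l'_u'_def)
  also have "\<dots> = (\<Prod>i\<in>UNIV. u $ i - l $ i)"
    by (rule prod.reindex_bij_betw) (simp add: assms bij_imp_bij_inv)
  also have "\<dots> = (\<Prod>b\<in>Basis. (u - l) \<bullet> b)"
    by (subst prod_over_Basis_vec) (simp add: inner_axis)
  finally show "emeasure (distr lborel borel (\<lambda>x :: real ^ 'k. \<chi> i. x $ \<phi> i)) (box l u)
      = (\<Prod>b\<in>Basis. (u - l) \<bullet> b)" .
qed simp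

text \<open>Boxes determine Lebesgue measure, and the inverse map preserves the volume of a box.\<close>

lemma distr_lborel_orthogonal_wellorder:
  fixes U :: "real ^ 'k::{finite, wellorder} \<Rightarrow> real ^ 'k::_"
  assumes U: "orthogonal_transformation U"
  shows "distr lborel borel U = lborel"
proof (rule lborel_eqI[symmetric])
  fix l u :: "real ^ 'k::_" assume le: "\<And>b. b \<in> Basis \<Longrightarrow> l \<bullet> b \<le> u \<bullet> b"
  have [measurable]: "U \<in> borel_measurable borel"
    using U by (intro borel_measurable_continuous_onI linear_continuous_on linear_conv_bounded_linear[THEN iffD1]
      orthogonal_transformation_linear)
  have bij: "bij U" using U by (rule orthogonal_transformation_bij)
  have inv: "orthogonal_transformation (inv U)" using U by (rule orthogonal_transformation_inv)
  have "U -` box l u = inv U ` box l u"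
    using bij by (simp add: bij_vimage_eq_inv_image)
  then have "measure (distr lborel borel U) (box l u) = measure lborel (inv U ` box l u)"
    by (subst measure_distr) auto
  also have "\<dots> = measure lebesgue (inv U ` box l u)"
  proof -
    have "U -` box l u \<inter> space borel \<in> sets borel" by measurable
    then have "inv U ` box l u \<in> sets borel" using \<open>U -` box l u = inv U ` box l u\<close> by simp
    then show ?thesis by (simp add: measure_completion)
  qed
  also have "\<dots> = measure lebesgue (box l u)"
    by (rule measure_orthogonal_image[OF inv]) simp
  finally have m: "measure (distr lborel borel U) (box l u) = measure lborel (box l u)"
    by simp
  have "emeasure (distr lborel borel U) (box l u) \<noteq> \<infinity>"
  proof -
    have "inv U ` box l u \<in> lmeasurable"
      by (rule measurable_orthogonal_image[OF inv]) simp
    moreover have "U -` box l u \<inter> space borel \<in> sets borel" by measurable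
    ultimately have "emeasure lborel (U -` box l u) < \<infinity>"
      using \<open>U -` box l u = inv U ` box l u\<close>
      by (simp add: fmeasurable_def)
    then show ?thesis by (subst emeasure_distr) auto
  qed
  then have "emeasure (distr lborel borel U) (box l u) = ennreal (measure lborel (box l u))"
    using m by (simp add: emeasure_eq_ennreal_measure)
  then show "emeasure (distr lborel borel U) (box l u) = (\<Prod>b\<in>Basis. (u - l) \<bullet> b)"
    using le by (simp add: measure_lborel_box_eq)
qed simp

text \<open>Conjugation with a relabelling of the coordinates, which preserves both the norm and Lebesgue measure, reduces this to
ordered coordinates.\<close>

lemma distr_lborel_orthogonal_transformation:
  fixes U :: "real ^ 'k::finite \<Rightarrow> real ^ 'k"
  assumes U: "orthogonal_transformation U"
  shows "distr lborel borel U = lborel"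
proof -
  obtain \<phi> :: "'k idx \<Rightarrow> 'k" where \<phi>: "bij \<phi>"
    using finite_same_card_bij[of "UNIV :: 'k idx set" "UNIV :: 'k set"] card_idx by auto
  define T where "T = (\<lambda>x :: real ^ 'k. \<chi> i. x $ \<phi> i)"
  define T' where "T' = (\<lambda>x :: real ^ 'k idx. \<chi> k. x $ inv \<phi> k)"
  have inv: "inv \<phi> (\<phi> i) = i" "\<phi> (inv \<phi> k) = k" for i k
    using \<phi> by (auto simp: bij_is_inj bij_is_surj surj_f_inv_f)
  have TT': "T' (T x) = x" "T (T' z) = z" for x z
    by (simp_all add: T_def T'_def inv vec_eq_iff)
  have norm: "norm (T x) = norm x" for x
  proof -
    have "(\<Sum>i\<in>UNIV. (x $ \<phi> i)\<^sup>2) = (\<Sum>k\<in>UNIV. (x $ k)\<^sup>2)"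
      by (rule sum.reindex_bij_betw[OF \<phi>])
    then show ?thesis by (simp add: T_def norm_vec_def L2_set_def)
  qed
  then have norm': "norm (T' z) = norm z" for z by (metis TT'(2))
  have lin: "linear T" "linear T'"
    by (auto simp: T_def T'_def vec_eq_iff intro!: linearI)
  have "orthogonal_transformation (\<lambda>z. T (U (T' z)))"
    unfolding orthogonal_transformation
  proof (intro conjI allI)
    show "linear (\<lambda>z. T (U (T' z)))"
      using linear_compose[OF linear_compose[OF lin(2) orthogonal_transformation_linear[OF U]] lin(1)]
      by (simp add: comp_def)
    show "norm (T (U (T' z))) = norm z" for z
      using U by (simp add: norm norm' orthogonal_transformation)
  qed
  then have V: "distr lborel borel (\<lambda>z. T (U (T' z))) = lborel"
    by (rule distr_lborel_orthogonal_wellorder)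
  have [measurable]: "T \<in> borel_measurable borel" "T' \<in> borel_measurable borel" "U \<in> borel_measurable borel"
    using lin orthogonal_transformation_linear[OF U]
    by (auto intro!: borel_measurable_continuous_onI linear_continuous_on simp: linear_conv_bounded_linear)
  have T: "distr lborel borel T = lborel"
    unfolding T_def by (rule lborel_vec_reindex[OF \<phi>])
  have T': "distr lborel borel T' = lborel"
    unfolding T'_def by (rule lborel_vec_reindex) (simp add: \<phi> bij_imp_bij_inv)
  have "distr lborel borel U = distr (distr (distr lborel borel T) borel (\<lambda>z. T (U (T' z)))) borel T'"
    by (simp add: distr_distr comp_def TT')
  then show ?thesis by (simp only: T V T')
qed

text \<open>The density depends on the norm alone, and Lebesgue measure is invariant.\<close>

lemma distr_std_normal_vec_orthogonal:
  fixes U :: "real ^ 'k::finite \<Rightarrow> real ^ 'k"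
  assumes U: "orthogonal_transformation U"
  shows "distr std_normal_vec borel U = std_normal_vec"
proof -
  have [measurable]: "U \<in> borel_measurable borel"
    using orthogonal_transformation_linear[OF U]
    by (auto intro!: borel_measurable_continuous_onI linear_continuous_on simp: linear_conv_bounded_linear)
  have "norm (U x) = norm x" for x using U by (simp add: orthogonal_transformation)
  then have "distr std_normal_vec borel U = density (distr lborel borel U)
      (\<lambda>x. ennreal ((1 / sqrt (2 * pi)) ^ CARD('k) * exp (- (norm x)\<^sup>2 / 2)))"
    unfolding std_normal_vec_eq_density by (subst density_distr) auto
  then show ?thesis
    by (simp only: distr_lborel_orthogonal_transformation[OF U] std_normal_vec_eq_density)
qed

section \<open>The data law and the excess risk\<close>

lemma space_normal_measure [simp]: "space (normal_measure m \<sigma>) = UNIV"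
  by (simp add: sets_eq_imp_space_eq[OF sets_normal_measure])

lemma space_std_normal_vec [simp]: "space std_normal_vec = UNIV"
  by (simp add: sets_eq_imp_space_eq[OF sets_std_normal_vec])

text \<open>The noise is \<open>\<sigma>\<close> times one more standard normal coordinate, with index \<^term>\<open>None\<close>. The response thus becomes a linear
form of a single Gaussian vector, to which orthogonal maps that mix features and noise can be applied.\<close>

definition aug_coeff :: "real ^ 'p::finite \<Rightarrow> real \<Rightarrow> real ^ 'p option" where
  "aug_coeff \<beta> \<sigma> = (\<chi> k. case k of Some j \<Rightarrow> \<beta> $ j | None \<Rightarrow> \<sigma>)"

definition features :: "real ^ 'p::finite option \<Rightarrow> real ^ 'p" where
  "features v = (\<chi> j. v $ Some j)"

lemma aug_coeff_nth [simp]: "aug_coeff \<beta> \<sigma> $ Some j = \<beta> $ j" "aug_coeff \<beta> \<sigma> $ None = \<sigma>"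
  by (simp_all add: aug_coeff_def)

lemma features_nth [simp]: "features v $ j = v $ Some j"
  by (simp add: features_def)

lemma sum_option_UNIV: "(\<Sum>k\<in>(UNIV :: 'p::finite option set). f k) = f None + (\<Sum>j\<in>UNIV. f (Some j))"
  by (simp add: UNIV_option_conv sum.reindex)

lemma inner_aug_coeff: "v \<bullet> aug_coeff \<beta> \<sigma> = features v \<bullet> \<beta> + \<sigma> * v $ None"
  by (simp add: inner_vec_def sum_option_UNIV)

lemma norm_aug_coeff: "(norm (aug_coeff \<beta> \<sigma>))\<^sup>2 = (norm \<beta>)\<^sup>2 + \<sigma>\<^sup>2"
  unfolding power2_norm_eq_inner by (simp add: inner_vec_def sum_option_UNIV power2_eq_square)

lemma features_measurable [measurable]: "features \<in> borel_measurable borel"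
  unfolding features_def by (intro borel_measurable_continuous_onI continuous_intros)

lemma aug_coeff_measurable:
  "(\<lambda>(x :: real ^ 'p::finite, z). aug_coeff x z) \<in> borel_measurable (borel \<Otimes>\<^sub>M borel)"
proof -
  have "(\<lambda>(x :: real ^ 'p, z). aug_coeff x z) = (\<lambda>y. \<chi> k. case k of Some j \<Rightarrow> fst y $ j | None \<Rightarrow> snd y)"
    by (auto simp: aug_coeff_def)
  moreover have "continuous_on UNIV (\<lambda>y :: (real ^ 'p) \<times> real. \<chi> k. case k of Some j \<Rightarrow> fst y $ j | None \<Rightarrow> snd y)"
  proof (intro continuous_intros)
    fix k :: "'p option"
    show "continuous_on UNIV (\<lambda>y :: (real ^ 'p) \<times> real. case k of Some j \<Rightarrow> fst y $ j | None \<Rightarrow> snd y)"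
      by (cases k) (auto intro!: continuous_intros)
  qed
  ultimately show ?thesis
    by (simp only: borel_prod borel_measurable_continuous_onI)
qed

lemma std_normal_vec_eq_distr_prod:
  "(std_normal_vec :: (real ^ 'p::finite option) measure)
    = distr (std_normal_vec \<Otimes>\<^sub>M normal_measure 0 1) borel (\<lambda>(x, z). aug_coeff x z)"
proof -
  let ?N = "\<lambda>_. normal_measure 0 1"
  interpret N: prob_space "normal_measure 0 1" by (rule prob_space_normal_measure) simp
  interpret P: product_sigma_finite ?N
    by (simp add: product_sigma_finite_def N.sigma_finite_measure_axioms)
  interpret X: prob_space "std_normal_vec :: (real ^ 'p) measure" by (rule prob_space_std_normal_vec)
  note [measurable] = aug_coeff_measurable
  have vec: "(\<lambda>f. \<chi> j. f j) \<in> borel_measurable (Pi\<^sub>M UNIV (\<lambda>_::'p. normal_measure 0 1))"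
       "(\<lambda>f. \<chi> j. f j) \<in> borel_measurable (Pi\<^sub>M UNIV (\<lambda>_::'p option. normal_measure 0 1))"
    using measurable_vec_lambda_PiM by (simp_all cong: measurable_cong_sets sets_PiM_cong)
  let ?j = "\<lambda>(f, z) k. case k of Some (j::'p) \<Rightarrow> f j | None \<Rightarrow> (z::real)"
  have j [measurable]: "?j \<in> Pi\<^sub>M UNIV ?N \<Otimes>\<^sub>M normal_measure 0 1 \<rightarrow>\<^sub>M Pi\<^sub>M UNIV ?N"
  proof (rule measurable_PiM_single')
    fix k :: "'p option"
    show "(\<lambda>y. ?j y k) \<in> Pi\<^sub>M UNIV ?N \<Otimes>\<^sub>M normal_measure 0 1 \<rightarrow>\<^sub>M normal_measure 0 1"
      by (cases k) (simp_all add: case_prod_beta)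
  qed (auto simp: space_PiM)
  have "distr (Pi\<^sub>M UNIV ?N \<Otimes>\<^sub>M normal_measure 0 1) (Pi\<^sub>M UNIV ?N) ?j = Pi\<^sub>M UNIV ?N"
  proof (rule P.PiM_eqI)
    fix A :: "'p option \<Rightarrow> real set" assume A: "\<And>i. i \<in> UNIV \<Longrightarrow> A i \<in> sets (normal_measure 0 1)"
    interpret PP: prob_space "Pi\<^sub>M UNIV ?N :: ('p \<Rightarrow> real) measure"
      by (intro prob_space_PiM N.prob_space_axioms)
    have "?j -` Pi\<^sub>E UNIV A \<inter> space (Pi\<^sub>M UNIV ?N \<Otimes>\<^sub>M normal_measure 0 1)
        = Pi\<^sub>E UNIV (\<lambda>j. A (Some j)) \<times> A None"
      by (auto simp: space_pair_measure space_PiM PiE_def Pi_def split_option_all)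
    then have "emeasure (distr (Pi\<^sub>M UNIV ?N \<Otimes>\<^sub>M normal_measure 0 1) (Pi\<^sub>M UNIV ?N) ?j) (Pi\<^sub>E UNIV A)
      = emeasure (Pi\<^sub>M UNIV ?N \<Otimes>\<^sub>M normal_measure 0 1) (Pi\<^sub>E UNIV (\<lambda>j. A (Some j)) \<times> A None)"
      using A by (subst emeasure_distr[OF j]) (auto intro!: sets_PiM_I_finite)
    also have "\<dots> = emeasure (Pi\<^sub>M UNIV ?N) (Pi\<^sub>E UNIV (\<lambda>j. A (Some j))) * emeasure (normal_measure 0 1) (A None)"
      using A by (intro N.emeasure_pair_measure_Times sets_PiM_I_finite) auto
    also have "emeasure (Pi\<^sub>M UNIV ?N) (Pi\<^sub>E UNIV (\<lambda>j. A (Some j))) = (\<Prod>j\<in>UNIV. emeasure (normal_measure 0 1) (A (Some j)))"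
      using A by (intro P.emeasure_PiM) auto
    finally show "emeasure (distr (Pi\<^sub>M UNIV ?N \<Otimes>\<^sub>M normal_measure 0 1) (Pi\<^sub>M UNIV ?N) ?j) (Pi\<^sub>E UNIV A)
      = (\<Prod>k\<in>UNIV. emeasure (normal_measure 0 1) (A k))"
      by (simp add: UNIV_option_conv prod.reindex mult.commute)
  qed auto
  then have "(std_normal_vec :: (real ^ 'p option) measure)
      = distr (distr (Pi\<^sub>M UNIV ?N \<Otimes>\<^sub>M normal_measure 0 1) (Pi\<^sub>M UNIV ?N) ?j) borel (\<lambda>f. \<chi> k. f k)"
    by (simp add: std_normal_vec_def)
  also have "\<dots> = distr (Pi\<^sub>M UNIV ?N \<Otimes>\<^sub>M normal_measure 0 1) borel
      (\<lambda>y. case (case y of (f, z) \<Rightarrow> (\<chi> j. f j, z)) of (x, z) \<Rightarrow> aug_coeff x z)"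
    by (subst distr_distr[OF vec(2) j], rule distr_cong)
       (auto simp: aug_coeff_def vec_eq_iff split: option.split)
  also have "\<dots> = distr (distr (Pi\<^sub>M UNIV ?N \<Otimes>\<^sub>M normal_measure 0 1) (borel \<Otimes>\<^sub>M normal_measure 0 1)
        (\<lambda>(f, z). (\<chi> j. f j, z))) borel (\<lambda>(x, z). aug_coeff x z)"
    using vec(1) by (subst distr_distr) (auto simp: comp_def)
  also have "distr (Pi\<^sub>M UNIV ?N \<Otimes>\<^sub>M normal_measure 0 1) (borel \<Otimes>\<^sub>M normal_measure 0 1)
        (\<lambda>(f, z). (\<chi> j. f j, z)) = (std_normal_vec :: (real ^ 'p) measure) \<Otimes>\<^sub>M normal_measure 0 1"
  proof -
    have "(std_normal_vec :: (real ^ 'p) measure) \<Otimes>\<^sub>M normal_measure 0 1 = distr (Pi\<^sub>M (UNIV :: 'p set) ?N) borel (\<lambda>f. \<chi> j. f j)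
        \<Otimes>\<^sub>M distr (normal_measure 0 1) (normal_measure 0 1) (\<lambda>z. z)"
      by (simp add: std_normal_vec_def)
    also have "\<dots> = distr (Pi\<^sub>M UNIV ?N \<Otimes>\<^sub>M normal_measure 0 1) (borel \<Otimes>\<^sub>M normal_measure 0 1)
        (\<lambda>(f, z). (\<chi> j. f j, z))"
      by (rule pair_measure_distr) (use vec(1) N.sigma_finite_measure_axioms in simp_all)
    finally show ?thesis ..
  qed
  finally show ?thesis .
qed

lemma data_distr_eq_distr:
  fixes \<beta> :: "real ^ 'p::finite"
  assumes "\<sigma> \<ge> 0"
  shows "data_distr \<beta> \<sigma> = distr std_normal_vec borel (\<lambda>v. (features v, v \<bullet> aug_coeff \<beta> \<sigma>))"
proof -
  let ?N = "normal_measure 0 1"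
  interpret N: prob_space ?N by (rule prob_space_normal_measure) simp
  interpret X: prob_space "std_normal_vec :: (real ^ 'p) measure" by (rule prob_space_std_normal_vec)
  interpret PP: pair_prob_space "std_normal_vec :: (real ^ 'p) measure" ?N ..
  let ?g = "\<lambda>(x :: real ^ 'p, z). (x, x \<bullet> \<beta> + \<sigma> * z)"
  have g: "?g \<in> borel_measurable (std_normal_vec \<Otimes>\<^sub>M ?N)" 
    unfolding case_prod_beta by (intro borel_measurable_Pair) measurable
  have kernel: "normal_measure (x \<bullet> \<beta>) \<sigma> \<bind> (\<lambda>y. return borel (x, y)) = ?N \<bind> (\<lambda>z. return borel (?g (x, z)))"
    for x :: "real ^ 'p"
  proof -
    have K: "(\<lambda>y. return borel (x, y)) \<in> borel \<rightarrow>\<^sub>M subprob_algebra (borel :: ((real ^ 'p) \<times> real) measure)"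
      by (intro measurable_compose[OF _ return_measurable] borel_measurable_Pair) auto
    have f: "(\<lambda>z. x \<bullet> \<beta> + \<sigma> * z) \<in> ?N \<rightarrow>\<^sub>M borel"
      unfolding measurable_cong_sets[OF sets_normal_measure refl]
      by (intro borel_measurable_continuous_onI continuous_intros)
    show ?thesis
      unfolding normal_measure_affine[OF assms, of "x \<bullet> \<beta>"]
      by (subst bind_distr[OF f K]) simp_all
  qed
  have "data_distr \<beta> \<sigma> = std_normal_vec \<bind> (\<lambda>x. ?N \<bind> (\<lambda>z. return borel (?g (x, z))))"
    by (simp add: data_distr_def kernel)
  also have "\<dots> = (std_normal_vec \<bind> (\<lambda>x. ?N \<bind> (\<lambda>z. return (std_normal_vec \<Otimes>\<^sub>M ?N) (x, z))))
      \<bind> (\<lambda>y. return borel (?g y))"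
  proof -
    let ?P = "std_normal_vec \<Otimes>\<^sub>M ?N :: ((real ^ 'p) \<times> real) measure"
    have C: "(\<lambda>y. return borel (?g y)) \<in> ?P \<rightarrow>\<^sub>M subprob_algebra borel"
      using g by (rule measurable_compose[OF _ return_measurable])
    have R: "(\<lambda>z. return ?P (x, z)) \<in> ?N \<rightarrow>\<^sub>M subprob_algebra ?P" for x
      by (rule measurable_compose[OF _ return_measurable]) simp
    have inner: "?N \<bind> (\<lambda>z. return ?P (x, z)) \<bind> (\<lambda>y. return borel (?g y))
        = ?N \<bind> (\<lambda>z. return borel (?g (x, z)))" for x
      by (subst bind_assoc[OF R C], rule bind_cong[OF refl], subst bind_return[OF C])
         (auto simp: space_pair_measure)
    have R2: "(\<lambda>x. ?N \<bind> (\<lambda>z. return ?P (x, z))) \<in> std_normal_vec \<rightarrow>\<^sub>M subprob_algebra ?P"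
    proof (rule measurable_bind[where N = ?N])
      show "(\<lambda>x. ?N) \<in> std_normal_vec \<rightarrow>\<^sub>M subprob_algebra ?N"
        by (intro measurable_const) (simp add: space_subprob_algebra N.subprob_space_axioms)
      show "(\<lambda>y. return ?P (fst y, snd y)) \<in> ?P \<rightarrow>\<^sub>M subprob_algebra ?P"
        by simp
    qed
    show ?thesis by (simp only: bind_assoc[OF R2 C] inner)
  qed
  also have "\<dots> = (std_normal_vec \<Otimes>\<^sub>M ?N) \<bind> (\<lambda>y. return borel (?g y))"
    by (simp only: PP.pair_measure_eq_bind[symmetric])
  also have "\<dots> = distr (std_normal_vec \<Otimes>\<^sub>M ?N) borel ?g"
    by (rule bind_return_distr'[OF _ g]) (simp add: space_pair_measure)
  also have "\<dots> = distr (distr (std_normal_vec \<Otimes>\<^sub>M ?N) borel (\<lambda>(x, z). aug_coeff x z)) borel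
      (\<lambda>v. (features v, v \<bullet> aug_coeff \<beta> \<sigma>))"
  proof -
    have F: "features (aug_coeff x z) = x" for x :: "real ^ 'p" and z
      by (simp add: vec_eq_iff)
    have m: "(\<lambda>v :: real ^ 'p option. (features v, v \<bullet> aug_coeff \<beta> \<sigma>)) \<in> borel_measurable borel"
      by (intro borel_measurable_Pair) measurable
    have aug: "(\<lambda>(x, z). aug_coeff x z) \<in> borel_measurable (std_normal_vec \<Otimes>\<^sub>M ?N)"
      using aug_coeff_measurable by (simp cong: measurable_cong_sets sets_pair_measure_cong)
    show ?thesis
      by (subst distr_distr[OF m aug], rule distr_cong) (auto simp: inner_aug_coeff F)
  qed
  also have "\<dots> = distr (std_normal_vec :: (real ^ 'p option) measure) borel (\<lambda>v. (features v, v \<bullet> aug_coeff \<beta> \<sigma>))"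
    by (simp only: std_normal_vec_eq_distr_prod)
  finally show ?thesis .
qed

lemma borel_measurable_data_map [measurable]:
  "(\<lambda>v :: real ^ 'p::finite option. (features v, v \<bullet> aug_coeff \<beta> \<sigma>)) \<in> borel_measurable borel"
  by (intro borel_measurable_Pair) measurable

lemma nn_integral_sq_inner_std_normal_vec:
  fixes a :: "real ^ 'k::finite"
  shows "(\<integral>\<^sup>+v. ennreal ((v \<bullet> a)\<^sup>2) \<partial>std_normal_vec) = ennreal ((norm a)\<^sup>2)"
proof (cases "a = 0")
  case False
  interpret G: prob_space "gauss_array (UNIV :: 'k set)" by (rule prob_space_gauss_array)
  have sq: "(\<Sum>k\<in>UNIV. (a $ k / norm a)\<^sup>2) = 1"
  proof -
    have "(norm a)\<^sup>2 = (\<Sum>k\<in>UNIV. (a $ k)\<^sup>2)" by (simp add: norm_vec_def L2_set_def sum_nonneg)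
    moreover have "(norm a)\<^sup>2 \<noteq> 0" using False by simp
    ultimately show ?thesis by (simp add: power_divide sum_divide_distrib[symmetric])
  qed
  have [measurable]: "(\<lambda>f. \<chi> k. f k) \<in> borel_measurable (gauss_array (UNIV :: 'k set))"
    using measurable_vec_lambda_PiM by (simp cong: measurable_cong_sets add: sets_gauss_array)
  have "(\<integral>\<^sup>+v. ennreal ((v \<bullet> a)\<^sup>2) \<partial>std_normal_vec)
      = (\<integral>\<^sup>+\<omega>. ennreal (((\<chi> k. \<omega> k) \<bullet> a)\<^sup>2) \<partial>gauss_array UNIV)"
    unfolding std_normal_vec_def gauss_array_def[symmetric] by (subst nn_integral_distr) auto
  also have "\<dots> = (\<integral>\<^sup>+\<omega>. ennreal ((norm a)\<^sup>2) * ennreal ((\<Sum>k\<in>UNIV. a $ k / norm a * \<omega> k)\<^sup>2) \<partial>gauss_array UNIV)"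
  proof (rule nn_integral_cong)
    fix \<omega> :: "'k \<Rightarrow> real"
    have "(\<chi> k. \<omega> k) \<bullet> a = norm a * (\<Sum>k\<in>UNIV. a $ k / norm a * \<omega> k)"
      using False by (simp add: inner_vec_def sum_distrib_left mult.commute)
    then show "ennreal (((\<chi> k. \<omega> k) \<bullet> a)\<^sup>2)
        = ennreal ((norm a)\<^sup>2) * ennreal ((\<Sum>k\<in>UNIV. a $ k / norm a * \<omega> k)\<^sup>2)"
      by (simp only: power_mult_distrib ennreal_mult'[OF zero_le_power2])
  qed
  also have "\<dots> = ennreal ((norm a)\<^sup>2) * (\<integral>\<^sup>+\<omega>. ennreal ((\<Sum>k\<in>UNIV. a $ k / norm a * \<omega> k)\<^sup>2) \<partial>gauss_array UNIV)"
    by (rule nn_integral_cmult) simp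
  also have "(\<integral>\<^sup>+\<omega>. ennreal ((\<Sum>k\<in>UNIV. a $ k / norm a * \<omega> k)\<^sup>2) \<partial>gauss_array UNIV)
      = (\<integral>\<^sup>+z. ennreal (z\<^sup>2) \<partial>distr (gauss_array UNIV) borel (\<lambda>\<omega>. \<Sum>k\<in>UNIV. a $ k / norm a * \<omega> k))"
    by (subst nn_integral_distr) auto
  also have "\<dots> = (\<integral>\<^sup>+z. ennreal (z\<^sup>2) \<partial>normal_measure 0 1)"
    by (subst G.distr_std_normal_lincomb[OF std_normal_family_gauss_array sq]) auto
  also have "\<dots> = (\<integral>\<^sup>+z. ennreal (normal_density 0 1 z * z ^ (2 * 1)) \<partial>lborel)"
    by (simp add: normal_measure_def nn_integral_density ennreal_mult')
  also have "\<dots> = 1"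
    using std_normal_moment_even[of 1]
    by (subst nn_integral_eq_integral)
       (auto simp: has_bochner_integral_iff numeral_2_eq_2[symmetric])
  finally show ?thesis by simp
qed simp

text \<open>The prediction error is a linear form of the augmented Gaussian vector, so its second moment is the squared norm of the
coefficients.\<close>

lemma test_error_eq:
  assumes "\<sigma> \<ge> 0"
  shows "test_error \<beta> \<sigma> b = \<sigma>\<^sup>2 + (norm (b - \<beta>))\<^sup>2"
proof -
  have eq: "sq_loss b (features v, v \<bullet> aug_coeff \<beta> \<sigma>) = (v \<bullet> aug_coeff (\<beta> - b) \<sigma>)\<^sup>2" for v
    by (simp add: sq_loss_def inner_aug_coeff inner_diff_right algebra_simps)
  have [measurable]: "sq_loss b \<in> borel_measurable borel"
    unfolding sq_loss_def borel_prod[symmetric] by measurable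
  have "test_error \<beta> \<sigma> b = (\<integral>v. (v \<bullet> aug_coeff (\<beta> - b) \<sigma>)\<^sup>2 \<partial>std_normal_vec)"
  proof -
    have m: "(\<lambda>v. (features v, v \<bullet> aug_coeff \<beta> \<sigma>)) \<in> borel_measurable std_normal_vec"
      using borel_measurable_data_map by (simp only: measurable_cong_sets[OF sets_std_normal_vec refl])
    show ?thesis
      unfolding test_error_def data_distr_eq_distr[OF assms]
      by (simp only: integral_distr[OF m \<open>sq_loss b \<in> borel_measurable borel\<close>] eq)
  qed
  also have "\<dots> = (norm (aug_coeff (\<beta> - b) \<sigma>))\<^sup>2"
  proof (subst integral_eq_nn_integral)
    show "(\<lambda>v. (v \<bullet> aug_coeff (\<beta> - b) \<sigma>)\<^sup>2) \<in> borel_measurable std_normal_vec"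
      by (simp only: measurable_cong_sets[OF sets_std_normal_vec refl]) measurable
    show "AE v in std_normal_vec. 0 \<le> (v \<bullet> aug_coeff (\<beta> - b) \<sigma>)\<^sup>2" by simp
  qed (simp only: nn_integral_sq_inner_std_normal_vec zero_le_power2 enn2real_ennreal)
  finally show ?thesis by (simp add: norm_aug_coeff norm_minus_commute)
qed

section \<open>Moving the planted block out of the response\<close>

definition reflect :: "'v::real_inner \<Rightarrow> 'v \<Rightarrow> 'v" where
  "reflect u v = v - (2 * (u \<bullet> v) / (u \<bullet> u)) *\<^sub>R u"

lemma orthogonal_transformation_reflect: "orthogonal_transformation (reflect u)"
proof (cases "u = 0")
  case False
  then have uu: "u \<bullet> u \<noteq> 0" by simp
  have "linear (reflect u)"
    by (rule linearI) (simp_all add: reflect_def inner_add_right algebra_simps add_divide_distrib)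
  moreover have "reflect u v \<bullet> reflect u w = v \<bullet> w" for v w
    using uu by (simp add: reflect_def inner_diff_left inner_diff_right inner_commute)
  ultimately show ?thesis by (simp add: orthogonal_transformation_def)
qed (simp add: reflect_def[abs_def])

lemma reflect_swap:
  assumes "norm a = norm b"
  shows "reflect (a - b) a = b"
proof (cases "a = b")
  case False
  then have ne: "(a - b) \<bullet> (a - b) \<noteq> 0" by simp
  have "a \<bullet> a = b \<bullet> b" using assms by (simp add: norm_eq)
  then have "2 * ((a - b) \<bullet> a) = (a - b) \<bullet> (a - b)"
    by (simp add: inner_diff_left inner_diff_right inner_commute)
  then show ?thesis using ne by (simp add: reflect_def)
qed (simp add: reflect_def)

text \<open>The part of the response that is carried by the block and the noise is \<open>\<rho>\<close> times the inner product with a unit vector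
\<open>a\<close>; the reflection exchanges \<open>a\<close> with the noise axis. Afterwards that part is \<open>\<rho>\<close> times the noise coordinate, and the
response no longer involves the block. The price is a correction of the block features along \<open>a\<close>, which involves only
their sum and the noise coordinate.\<close>

lemma planted_block_reflection:
  fixes \<beta> :: "real ^ 'p::finite" and c \<sigma> :: real
  assumes J: "J \<noteq> {}" and pos: "0 < c" "0 < \<sigma>"
    and \<beta>: "\<And>j. j \<in> J \<Longrightarrow> \<beta> $ j = c / card J"
  defines "s \<equiv> c / sqrt (card J)"
  defines "\<rho> \<equiv> sqrt (s\<^sup>2 + \<sigma>\<^sup>2)"
  obtains U where "orthogonal_transformation U"
    "\<And>v j. j \<notin> J \<Longrightarrow> U v $ Some j = v $ Some j"
    "\<And>v j. j \<in> J \<Longrightarrow> U v $ Some j = v $ Some j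
       - ((\<rho> + \<sigma>) / \<rho> * ((\<Sum>i\<in>J. v $ Some i) / sqrt (card J)) - s / \<rho> * v $ None) / sqrt (card J)"
    "\<And>v. U v \<bullet> aug_coeff \<beta> \<sigma> = \<rho> * v $ None + (\<Sum>j\<in>-J. \<beta> $ j * v $ Some j)"
proof -
  define m where "m = real (card J)"
  have m: "0 < m" using J by (simp add: m_def card_gt_0_iff)
  have s: "0 < s" using pos m by (simp add: s_def m_def)
  have \<rho>2: "\<rho>\<^sup>2 = s\<^sup>2 + \<sigma>\<^sup>2" by (simp add: \<rho>_def)
  have \<rho>: "\<sigma> < \<rho>" "0 < \<rho>"
    using s pos by (auto simp: \<rho>_def intro!: real_less_rsqrt add_pos_pos)
  define \<beta>J where "\<beta>J = (\<chi> j. if j \<in> J then c / m else 0)"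
  define \<beta>F where "\<beta>F = (\<chi> j. if j \<in> J then 0 else \<beta> $ j)"
  define a where "a = (1 / \<rho>) *\<^sub>R aug_coeff \<beta>J \<sigma>"
  define e :: "real ^ 'p option" where "e = axis None 1"
  define u where "u = a - e"
  have onJ: "(\<Sum>j\<in>UNIV. if j \<in> J then f j else 0) = (\<Sum>j\<in>J. f j)" for f :: "'p \<Rightarrow> real"
    by (simp add: sum.If_cases)
  have nJ: "(norm \<beta>J)\<^sup>2 = s\<^sup>2"
  proof -
    have "(norm \<beta>J)\<^sup>2 = (\<Sum>j\<in>UNIV. if j \<in> J then (c / m)\<^sup>2 else 0)"
      by (simp add: norm_vec_def L2_set_def sum_nonneg \<beta>J_def if_distrib[of "\<lambda>x. x\<^sup>2"] cong: if_cong)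
    also have "\<dots> = m * (c / m)\<^sup>2" by (simp add: onJ m_def)
    also have "\<dots> = s\<^sup>2" using m by (simp add: s_def m_def[symmetric] power_divide power2_eq_square)
    finally show ?thesis .
  qed
  have na: "norm a = 1"
  proof -
    have "(norm (aug_coeff \<beta>J \<sigma>))\<^sup>2 = \<rho>\<^sup>2" by (simp add: norm_aug_coeff nJ \<rho>2)
    then have "norm (aug_coeff \<beta>J \<sigma>) = \<rho>" using \<rho> by (simp add: power2_eq_iff_nonneg)
    then show ?thesis using \<rho> by (simp add: a_def)
  qed
  have ne: "norm e = 1" by (simp add: e_def)
  have ev: "v \<bullet> e = v $ None" for v by (simp add: e_def inner_axis)
  have av: "v \<bullet> a = (c / m * (\<Sum>j\<in>J. v $ Some j) + \<sigma> * v $ None) / \<rho>" for v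
  proof -
    have "features v \<bullet> \<beta>J = (\<Sum>j\<in>UNIV. if j \<in> J then c / m * v $ Some j else 0)"
      unfolding inner_vec_def by (intro sum.cong) (auto simp: \<beta>J_def)
    then have "features v \<bullet> \<beta>J = c / m * (\<Sum>j\<in>J. v $ Some j)" by (simp only: onJ sum_distrib_left)
    then show ?thesis by (simp add: a_def inner_aug_coeff)
  qed
  have Ue: "reflect u e = a"
  proof -
    have "reflect (e - a) e = reflect (- u) e" by (simp add: u_def)
    then have "reflect u e = reflect (e - a) e" by (simp add: reflect_def)
    also have "\<dots> = a" by (rule reflect_swap) (simp add: na ne)
    finally show ?thesis .
  qed
  have Ua: "reflect u v \<bullet> a = v $ None" for v
    using orthogonal_transformation_reflect[of u]
    by (simp add: Ue[symmetric] orthogonal_transformation_def ev)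
  have uu: "u \<bullet> u = 2 * (\<rho> - \<sigma>) / \<rho>"
  proof -
    have "u \<bullet> u = a \<bullet> a + e \<bullet> e - 2 * (a \<bullet> e)"
      by (simp add: u_def inner_diff_left inner_diff_right inner_commute)
    also have "\<dots> = 2 - 2 * (\<sigma> / \<rho>)"
      using na ne by (simp add: ev power2_norm_eq_inner[symmetric]) (simp add: a_def)
    finally show ?thesis using \<rho> by (simp add: field_simps)
  qed
  have comp: "reflect u v $ k = v $ k - 2 * (u \<bullet> v) / (u \<bullet> u) * u $ k" for v k
    by (simp add: reflect_def)
  have uS: "u $ Some j = (if j \<in> J then c / m / \<rho> else 0)" for j
    by (simp add: u_def a_def e_def \<beta>J_def axis_def)
  show thesis
  proof (rule that[of "reflect u"])
    show "orthogonal_transformation (reflect u)" by (rule orthogonal_transformation_reflect)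
    show out: "reflect u v $ Some j = v $ Some j" if "j \<notin> J" for v j
      using that by (simp add: comp uS)
    show "reflect u v $ Some j = v $ Some j
       - ((\<rho> + \<sigma>) / \<rho> * ((\<Sum>i\<in>J. v $ Some i) / sqrt (card J)) - s / \<rho> * v $ None) / sqrt (card J)"
      if "j \<in> J" for v j
    proof -
      define Q where "Q = (\<Sum>i\<in>J. v $ Some i) / sqrt m"
      define z where "z = v $ None"
      have sm: "s = c / sqrt m" by (simp add: s_def m_def)
      have sq: "sqrt m * sqrt m = m" "0 < sqrt m" using m by auto
      have Qs: "c / m * (\<Sum>i\<in>J. v $ Some i) = s * Q"
        using sq by (simp add: Q_def sm)
      have "u \<bullet> v = v \<bullet> a - v \<bullet> e" by (simp add: u_def inner_diff_right inner_commute[of _ v])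
      also have "\<dots> = (s * Q - (\<rho> - \<sigma>) * z) / \<rho>"
        unfolding av ev Qs using \<rho> by (simp add: z_def field_simps)
      finally have uv: "u \<bullet> v = (s * Q - (\<rho> - \<sigma>) * z) / \<rho>" .
      have "2 * (A / \<rho>) / (2 * E / \<rho>) = A / E" if "0 < E" for A E
        using \<rho> that by (simp add: field_simps)
      then have "2 * (u \<bullet> v) / (u \<bullet> u) = (s * Q - (\<rho> - \<sigma>) * z) / (\<rho> - \<sigma>)"
        using \<rho> by (simp only: uv uu)
      moreover have "u $ Some j = s / (\<rho> * sqrt m)"
        using that sq \<rho> by (simp add: uS sm)
      ultimately have "reflect u v $ Some j = v $ Some j - (s * Q - (\<rho> - \<sigma>) * z) / (\<rho> - \<sigma>) * (s / (\<rho> * sqrt m))"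
        by (simp add: comp)
      also have "(s * Q - (\<rho> - \<sigma>) * z) / (\<rho> - \<sigma>) * (s / (\<rho> * sqrt m))
          = (s\<^sup>2 * Q / (\<rho> - \<sigma>) - s * z) / \<rho> / sqrt m"
      proof -
        have "(s * Q - E * z) / E * (s / (\<rho> * w)) = (s\<^sup>2 * Q / E - s * z) / \<rho> / w"
          if "0 < E" "0 < w" for E w
          using that \<rho> by (simp add: field_simps power2_eq_square)
        then show ?thesis using \<rho> sq by simp
      qed
      also have "s\<^sup>2 = (\<rho> - \<sigma>) * (\<rho> + \<sigma>)"
        using \<rho>2 by (simp add: algebra_simps power2_eq_square)
      also have "(\<rho> - \<sigma>) * (\<rho> + \<sigma>) * Q / (\<rho> - \<sigma>) = (\<rho> + \<sigma>) * Q" using \<rho> by simp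
      finally show ?thesis
        by (simp add: Q_def z_def m_def diff_divide_distrib)
    qed
    show "reflect u v \<bullet> aug_coeff \<beta> \<sigma> = \<rho> * v $ None + (\<Sum>j\<in>-J. \<beta> $ j * v $ Some j)" for v
    proof -
      have "aug_coeff \<beta> \<sigma> = \<rho> *\<^sub>R a + aug_coeff \<beta>F 0"
        using \<rho> \<beta> by (auto simp: a_def vec_eq_iff aug_coeff_def \<beta>J_def \<beta>F_def m_def split: option.split)
      then have "reflect u v \<bullet> aug_coeff \<beta> \<sigma> = \<rho> * v $ None + features (reflect u v) \<bullet> \<beta>F"
        by (simp add: inner_add_right Ua inner_aug_coeff)
      also have "features (reflect u v) \<bullet> \<beta>F = (\<Sum>j\<in>UNIV. if j \<in> -J then \<beta> $ j * v $ Some j else 0)"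
        unfolding inner_vec_def by (intro sum.cong) (auto simp: \<beta>F_def out)
      also have "\<dots> = (\<Sum>j\<in>-J. \<beta> $ j * v $ Some j)" by (simp add: sum.If_cases Compl_eq)
      finally show ?thesis .
    qed
  qed
qed

text \<open>The rows of a Gaussian array are independent, so a representation \<open>D\<close> of one observation by a standard normal vector
extends to the whole sample.\<close>

lemma sample_distr_eq_distr_gauss_array:
  fixes \<beta> :: "real ^ 'p::finite" and D :: "real ^ 'k::finite \<Rightarrow> (real ^ 'p) \<times> real"
  assumes n: "1 \<le> n" and D: "D \<in> borel_measurable borel" "data_distr \<beta> \<sigma> = distr std_normal_vec borel D"
  shows "sample_distr n \<beta> \<sigma> = distr (gauss_array ({1..n} \<times> UNIV)) (Pi\<^sub>M {1..n} (\<lambda>_. borel))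
    (\<lambda>\<omega>. \<lambda>i\<in>{1..n}. D (\<chi> k. \<omega> (i, k)))"
proof -
  let ?I = "{1..n} \<times> (UNIV :: 'k set)"
  interpret P: prob_space "gauss_array ?I" by (rule prob_space_gauss_array)
  have meas_vec: "(\<lambda>f. \<chi> k :: 'k. f (i, k)) \<in> borel_measurable (Pi\<^sub>M ({i} \<times> UNIV) (\<lambda>_. borel :: real measure))" for i :: nat
  proof -
    have "(\<lambda>f. \<lambda>k :: 'k. f (i, k)) \<in> Pi\<^sub>M ({i} \<times> UNIV) (\<lambda>_. borel) \<rightarrow>\<^sub>M Pi\<^sub>M (UNIV :: 'k set) (\<lambda>_. borel :: real measure)"
      by (rule measurable_PiM_single') (auto simp: space_PiM)
    from measurable_compose[OF this measurable_vec_lambda_PiM] show ?thesis by simp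
  qed
  have "P.indep_vars (\<lambda>i. Pi\<^sub>M ({i} \<times> UNIV) (\<lambda>_. borel)) (\<lambda>i \<omega>. restrict (\<lambda>k. \<omega> k) ({i} \<times> UNIV)) {1..n}"
  proof (rule P.indep_vars_restrict[where I = ?I])
    have "P.std_normal_family (\<lambda>i \<omega>. \<omega> i) ?I" by (rule std_normal_family_gauss_array) simp
    then show "P.indep_vars (\<lambda>_. borel) (\<lambda>i \<omega>. \<omega> i) ?I" unfolding P.std_normal_family_def by blast
  qed (auto simp: disjoint_family_on_def)
  then have "P.indep_vars (\<lambda>_. borel) (\<lambda>i \<omega>. D (\<chi> k. restrict (\<lambda>k. \<omega> k) ({i} \<times> UNIV) (i, k))) {1..n}"
    by (rule P.indep_vars_compose2[where Y = "\<lambda>i f. D (\<chi> k. f (i, k))"])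
       (rule measurable_compose[OF meas_vec D(1)])
  then have indep: "P.indep_vars (\<lambda>_. borel) (\<lambda>i \<omega>. D (\<chi> k. \<omega> (i, k))) {1..n}" by simp
  have rv: "(\<lambda>\<omega>. D (\<chi> k. \<omega> (i, k))) \<in> borel_measurable (gauss_array ?I)" if "i \<in> {1..n}" for i
    using indep that unfolding P.indep_vars_def by blast
  have law: "distr (gauss_array ?I) borel (\<lambda>\<omega>. D (\<chi> k. \<omega> (i, k))) = data_distr \<beta> \<sigma>" if i: "i \<in> {1..n}" for i
  proof -
    interpret PP: product_prob_space "\<lambda>_ :: nat \<times> 'k. normal_measure 0 1" ?I
      by (simp add: product_prob_space_def product_prob_space_axioms_def product_sigma_finite_def
         prob_space_normal_measure prob_space_imp_sigma_finite)
    have R: "distr (gauss_array ?I) (gauss_array UNIV) (\<lambda>\<omega>. \<lambda>k\<in>UNIV. \<omega> (i, k)) = gauss_array (UNIV :: 'k set)"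
      unfolding gauss_array_def
      using i by (intro distr_PiM_reindex) (auto simp: inj_on_def prob_space_normal_measure)
    have m1: "(\<lambda>\<omega>. \<lambda>k\<in>UNIV. \<omega> (i, k)) \<in> gauss_array ?I \<rightarrow>\<^sub>M gauss_array (UNIV :: 'k set)"
      using i unfolding gauss_array_def by (intro measurable_restrict measurable_component_singleton) auto
    have m2: "(\<lambda>f. \<chi> k. f k) \<in> borel_measurable (gauss_array (UNIV :: 'k set))"
      using measurable_vec_lambda_PiM by (simp cong: measurable_cong_sets add: sets_gauss_array)
    have V: "std_normal_vec = distr (gauss_array ?I) borel (\<lambda>\<omega>. \<chi> k. \<omega> (i, k))"
      unfolding std_normal_vec_def gauss_array_def[symmetric]
      by (subst R[symmetric], subst distr_distr[OF m2 m1]) (simp add: comp_def restrict_def)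
    have m3: "(\<lambda>\<omega>. \<chi> k. \<omega> (i, k)) \<in> borel_measurable (gauss_array ?I)"
      using measurable_comp[OF m1 m2] by (simp add: comp_def restrict_def)
    show ?thesis
      unfolding D(2) V by (subst distr_distr[OF D(1) m3]) (simp add: comp_def)
  qed
  have "distr (gauss_array ?I) (Pi\<^sub>M {1..n} (\<lambda>_. borel)) (\<lambda>\<omega>. \<lambda>i\<in>{1..n}. D (\<chi> k. \<omega> (i, k)))
      = Pi\<^sub>M {1..n} (\<lambda>i. distr (gauss_array ?I) borel (\<lambda>\<omega>. D (\<chi> k. \<omega> (i, k))))"
    using n indep by (subst P.indep_vars_iff_distr_eq_PiM'[symmetric]) (use rv in auto)
  also have "\<dots> = sample_distr n \<beta> \<sigma>"
    unfolding sample_distr_def by (intro PiM_cong refl law)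
  finally show ?thesis ..
qed

section \<open>The lasso over an abstract inner product space\<close>

definition lin_pred :: "('p::finite \<Rightarrow> 'v::real_inner) \<Rightarrow> real ^ 'p \<Rightarrow> 'v" where
  "lin_pred a b = (\<Sum>j\<in>UNIV. b $ j *\<^sub>R a j)"

lemma lin_pred_linear: "linear (lin_pred a)"
  by (rule linearI) (simp_all add: lin_pred_def scaleR_left_distrib sum.distrib scaleR_sum_right)

lemma lin_pred_diff: "lin_pred a (b - b') = lin_pred a b - lin_pred a b'"
  using lin_pred_linear by (rule linear_diff)

lemma lin_pred_axis: "lin_pred a (axis j c) = c *\<^sub>R a j"
  unfolding lin_pred_def axis_def by (simp add: if_distrib[of "\<lambda>c. c *\<^sub>R _"] cong: if_cong)

lemma inner_lin_pred: "z \<bullet> lin_pred a b = (\<Sum>j\<in>UNIV. b $ j * (z \<bullet> a j))"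
  by (simp add: lin_pred_def inner_sum_right)

lemma continuous_on_lin_pred [continuous_intros]:
  "continuous_on S f \<Longrightarrow> continuous_on S (\<lambda>x. lin_pred a (f x))"
  unfolding lin_pred_def by (intro continuous_intros)

lemma l1_norm_nonneg: "0 \<le> l1_norm b"
  by (simp add: l1_norm_def sum_nonneg)

lemma l1_norm_axis: "l1_norm (axis j c) = \<bar>c\<bar>"
  unfolding l1_norm_def axis_def by (simp add: if_distrib[of abs] cong: if_cong)

lemma l1_norm_convex_comb:
  assumes "0 \<le> t" "t \<le> 1"
  shows "l1_norm (b + t *\<^sub>R (b' - b)) \<le> (1 - t) * l1_norm b + t * l1_norm b'"
proof -
  have "\<bar>(b + t *\<^sub>R (b' - b)) $ j\<bar> \<le> (1 - t) * \<bar>b $ j\<bar> + t * \<bar>b' $ j\<bar>" for j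
  proof -
    have "(b + t *\<^sub>R (b' - b)) $ j = (1 - t) * b $ j + t * b' $ j" by (simp add: algebra_simps)
    then show ?thesis
      using abs_triangle_ineq[of "(1 - t) * b $ j" "t * b' $ j"] assms by (simp add: abs_mult)
  qed
  then show ?thesis
    unfolding l1_norm_def sum_distrib_left sum.distrib[symmetric] by (rule sum_mono)
qed

lemma compact_l1_ball: "compact {b :: real ^ 'p::finite. l1_norm b \<le> B}"
proof (rule compact_eq_bounded_closed[THEN iffD2], intro conjI)
  show "bounded {b :: real ^ 'p. l1_norm b \<le> B}"
    unfolding bounded_iff l1_norm_def by (intro exI[of _ B]) (auto intro: order_trans[OF norm_le_l1_cart])
  show "closed {b :: real ^ 'p. l1_norm b \<le> B}"
    unfolding l1_norm_def by (intro closed_Collect_le continuous_intros)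
qed

text \<open>The set \<open>F\<close> restricts the support of the solution, not the design, so that restricted and full solutions live in the same
space and can be compared.\<close>

definition lasso_min :: "('p::finite \<Rightarrow> 'v::real_inner) \<Rightarrow> 'v \<Rightarrow> 'p set \<Rightarrow> real \<Rightarrow> real ^ 'p \<Rightarrow> bool" where
  "lasso_min a y F B b \<longleftrightarrow> l1_norm b \<le> B \<and> (\<forall>j. j \<notin> F \<longrightarrow> b $ j = 0) \<and>
     (\<forall>b'. l1_norm b' \<le> B \<longrightarrow> (\<forall>j. j \<notin> F \<longrightarrow> b' $ j = 0) \<longrightarrow>
        norm (y - lin_pred a b) \<le> norm (y - lin_pred a b'))"

lemma lasso_min_exists:
  assumes "0 \<le> B"
  obtains b where "lasso_min a y F B b"
proof -
  let ?C = "{b :: real ^ 'a. l1_norm b \<le> B} \<inter> (\<Inter>j\<in>-F. {b. b $ j = 0})"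
  have "compact ?C"
    by (intro compact_Int_closed compact_l1_ball closed_INT ballI closed_Collect_eq continuous_intros)
  moreover have "0 \<in> ?C" using assms by (simp add: l1_norm_def)
  moreover have "continuous_on ?C (\<lambda>b. norm (y - lin_pred a b))" by (intro continuous_intros)
  ultimately obtain b where "b \<in> ?C" "\<forall>b'\<in>?C. norm (y - lin_pred a b) \<le> norm (y - lin_pred a b')"
    using continuous_attains_inf[of ?C "\<lambda>b. norm (y - lin_pred a b)"] by blast
  then have "lasso_min a y F B b" by (auto simp: lasso_min_def)
  then show thesis by (rule that)
qed

text \<open>If moving from \<open>b\<close> towards \<open>b'\<close> had a positive inner product with the residual, a short step inside the convex
constraint set would shorten the residual.\<close>

lemma lasso_min_first_order:
  assumes b: "lasso_min a y F B b" and b': "l1_norm b' \<le> B" "\<And>j. j \<notin> F \<Longrightarrow> b' $ j = 0"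
  shows "(y - lin_pred a b) \<bullet> lin_pred a b' \<le> (y - lin_pred a b) \<bullet> lin_pred a b"
proof (rule ccontr)
  define r h where "r = y - lin_pred a b" "h = lin_pred a (b' - b)"
  assume "\<not> ?thesis"
  then have pos: "0 < r \<bullet> h" by (simp add: r_h_def lin_pred_diff inner_diff_right)
  \<comment> \<open>the step to the minimum on the ray, or to the end of the segment\<close>
  define t where "t = min 1 (r \<bullet> h / (h \<bullet> h))"
  have hh: "0 < h \<bullet> h" using pos by auto
  have t: "0 < t" "t \<le> 1" "t * (h \<bullet> h) \<le> r \<bullet> h"
    using pos hh by (auto simp: t_def min_def field_simps)
  let ?c = "b + t *\<^sub>R (b' - b)"
  have lb: "l1_norm b \<le> B" "\<And>j. j \<notin> F \<Longrightarrow> b $ j = 0" using b by (auto simp: lasso_min_def)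
  have "l1_norm ?c \<le> (1 - t) * B + t * B"
    by (rule order_trans[OF l1_norm_convex_comb])
       (use t lb(1) b'(1) in \<open>auto intro!: add_mono mult_left_mono\<close>)
  then have "l1_norm ?c \<le> B" by (simp add: algebra_simps)
  moreover have "\<forall>j. j \<notin> F \<longrightarrow> ?c $ j = 0" using lb(2) b'(2) by simp
  ultimately have "norm r \<le> norm (y - lin_pred a ?c)" using b by (simp add: lasso_min_def r_h_def)
  also have "y - lin_pred a ?c = r - t *\<^sub>R h"
    using lin_pred_linear[of a] by (simp add: r_h_def linear_add linear_scale)
  finally have "(norm r)\<^sup>2 \<le> (norm (r - t *\<^sub>R h))\<^sup>2" by (rule power_mono) simp
  also have "\<dots> = (norm r)\<^sup>2 - 2 * t * (r \<bullet> h) + t * (t * (h \<bullet> h))"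
    unfolding power2_norm_eq_inner by (simp add: inner_diff_left inner_diff_right inner_commute)
  also have "\<dots> \<le> (norm r)\<^sup>2 - 2 * t * (r \<bullet> h) + t * (r \<bullet> h)"
    using t by (simp add: mult_left_mono)
  finally have "t * (r \<bullet> h) \<le> 0" by simp
  then show False using t pos by (simp add: mult_le_0_iff)
qed

text \<open>The norm dual to the \<open>l1\<close>-norm on \<open>F\<close>, applied to the correlations with \<open>z\<close>. At the residual of a lasso solution it is the rate at which further budget pays.\<close>

definition max_corr :: "('p::finite \<Rightarrow> 'v::real_inner) \<Rightarrow> 'p set \<Rightarrow> 'v \<Rightarrow> real" where
  "max_corr a F z = Max ((\<lambda>j. \<bar>z \<bullet> a j\<bar>) ` F)"

lemma max_corr_ge: "j \<in> F \<Longrightarrow> \<bar>z \<bullet> a j\<bar> \<le> max_corr (a :: 'p::finite \<Rightarrow> 'v::real_inner) F z"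
  unfolding max_corr_def by (rule Max_ge) auto

lemma max_corr_nonneg: "F \<noteq> {} \<Longrightarrow> 0 \<le> max_corr a F z"
  using max_corr_ge[of _ F z a] by (metis abs_ge_zero all_not_in_conv order_trans)

lemma max_corr_scaleR:
  assumes "F \<noteq> {}" "0 \<le> c"
  shows "max_corr a F (c *\<^sub>R z) = c * max_corr a F z"
proof -
  have "mono (\<lambda>x. c * x :: real)" using assms by (auto intro: monoI mult_left_mono)
  then have "c * Max ((\<lambda>j. \<bar>z \<bullet> a j\<bar>) ` F) = Max ((\<lambda>x. c * x) ` (\<lambda>j. \<bar>z \<bullet> a j\<bar>) ` F)"
    by (rule mono_Max_commute) (use assms in auto)
  then show ?thesis using assms(2) by (simp add: max_corr_def image_image abs_mult)
qed

lemma inner_lin_pred_le_max_corr: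
  assumes "F \<noteq> {}" "\<And>j. j \<notin> F \<Longrightarrow> b $ j = 0"
  shows "\<bar>z \<bullet> lin_pred a b\<bar> \<le> max_corr a F z * l1_norm b"
proof -
  have "\<bar>z \<bullet> lin_pred a b\<bar> \<le> (\<Sum>j\<in>UNIV. \<bar>b $ j * (z \<bullet> a j)\<bar>)"
    unfolding inner_lin_pred by (rule sum_abs)
  also have "\<dots> \<le> (\<Sum>j\<in>UNIV. max_corr a F z * \<bar>b $ j\<bar>)"
  proof (rule sum_mono)
    fix j show "\<bar>b $ j * (z \<bullet> a j)\<bar> \<le> max_corr a F z * \<bar>b $ j\<bar>"
      using assms(2)[of j] max_corr_ge[of j F z a]
      by (cases "j \<in> F") (auto simp: abs_mult mult.commute intro: mult_left_mono)
  qed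
  finally show ?thesis by (simp add: l1_norm_def sum_distrib_left)
qed

text \<open>Compare with the vector that spends the whole budget on the column of largest correlation.\<close>

lemma lasso_min_kkt:
  assumes b: "lasso_min a y F B b" and "F \<noteq> {}"
  shows "max_corr a F (y - lin_pred a b) * B \<le> (y - lin_pred a b) \<bullet> lin_pred a b"
proof -
  let ?r = "y - lin_pred a b"
  have "max_corr a F ?r \<in> (\<lambda>j. \<bar>?r \<bullet> a j\<bar>) ` F"
    unfolding max_corr_def by (rule Max_in) (use assms in auto)
  then obtain j where j: "j \<in> F" "max_corr a F ?r = \<bar>?r \<bullet> a j\<bar>" by auto
  have B: "0 \<le> B" using b l1_norm_nonneg[of b] by (auto simp: lasso_min_def)
  have "?r \<bullet> lin_pred a (axis j (B * sgn (?r \<bullet> a j))) \<le> ?r \<bullet> lin_pred a b"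
  proof (rule lasso_min_first_order[OF b])
    show "l1_norm (axis j (B * sgn (?r \<bullet> a j))) \<le> B"
      using B by (simp add: l1_norm_axis abs_mult abs_sgn_eq)
    show "axis j (B * sgn (?r \<bullet> a j)) $ i = 0" if "i \<notin> F" for i
      using j(1) that by (auto simp: axis_def)
  qed
  moreover have "?r \<bullet> lin_pred a (axis j (B * sgn (?r \<bullet> a j))) = \<bar>?r \<bullet> a j\<bar> * B"
    by (simp add: lin_pred_axis abs_sgn algebra_simps)
  ultimately show ?thesis by (simp add: j(2))
qed

text \<open>Let \<open>\<kappa>\<close> be the maximal correlation of \<open>r\<close> on \<open>F\<close>. As \<open>b\<close> fits at least as well as \<open>b0\<close>, its fit has inner product with
\<open>r\<close> at least that of the fit of \<open>b0\<close>, hence at least \<open>\<kappa> * B\<close>. The coordinates in \<open>F\<close> contribute at most \<open>\<kappa>\<close> times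
their \<open>l1\<close>-norm, and the rest of the budget is at least the \<open>l1\<close>-norm of the others.\<close>

lemma lasso_restricted_vs_full:
  assumes b0: "lasso_min a y F B b0" and "F \<noteq> {}" and b: "lasso_min a y UNIV B b"
  defines "r \<equiv> y - lin_pred a b0"
  shows "max_corr a F r * (\<Sum>j\<in>-F. \<bar>b $ j\<bar>) \<le> (\<Sum>j\<in>-F. b $ j * (r \<bullet> a j))"
proof -
  define bF where "bF = (\<chi> j. if j \<in> F then b $ j else 0)"
  have split: "(\<Sum>j\<in>UNIV. f j) = (\<Sum>j\<in>F. f j) + (\<Sum>j\<in>-F. f j)" for f :: "'a \<Rightarrow> real"
    using sum.subset_diff[of F UNIV f] by (simp add: Compl_eq_Diff_UNIV add.commute)
  have onF: "(\<Sum>j\<in>UNIV. if j \<in> F then f j else 0) = (\<Sum>j\<in>F. f j)" for f :: "'a \<Rightarrow> real"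
    by (simp add: sum.If_cases)
  have n: "l1_norm bF = (\<Sum>j\<in>F. \<bar>b $ j\<bar>)"
    using onF[of "\<lambda>j. \<bar>b $ j\<bar>"] by (simp add: l1_norm_def bF_def if_distrib[of abs] cong: if_cong)
  have ip: "r \<bullet> lin_pred a bF = (\<Sum>j\<in>F. b $ j * (r \<bullet> a j))"
    using onF[of "\<lambda>j. b $ j * (r \<bullet> a j)"]
    by (simp add: inner_lin_pred bF_def if_distrib[of "\<lambda>c. c * _"] cong: if_cong)
  have lb: "l1_norm b \<le> B" using b by (simp add: lasso_min_def)
  have "norm (r - lin_pred a (b - b0)) \<le> norm r"
    using b b0 by (simp add: lasso_min_def r_def lin_pred_diff)
  then have "(norm (r - lin_pred a (b - b0)))\<^sup>2 \<le> (norm r)\<^sup>2" by (rule power_mono) simp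
  then have "(norm (lin_pred a (b - b0)))\<^sup>2 \<le> 2 * (r \<bullet> lin_pred a (b - b0))"
    unfolding power2_norm_eq_inner by (simp add: inner_diff_left inner_diff_right inner_commute)
  then have "0 \<le> r \<bullet> lin_pred a (b - b0)"
    using zero_le_power2[of "norm (lin_pred a (b - b0))"] by linarith
  then have "r \<bullet> lin_pred a b0 \<le> r \<bullet> lin_pred a b" by (simp add: lin_pred_diff inner_diff_right)
  also have "\<dots> = r \<bullet> lin_pred a bF + (\<Sum>j\<in>-F. b $ j * (r \<bullet> a j))"
    unfolding ip by (simp only: inner_lin_pred split)
  also have "r \<bullet> lin_pred a bF \<le> max_corr a F r * (\<Sum>j\<in>F. \<bar>b $ j\<bar>)"
    using inner_lin_pred_le_max_corr[OF assms(2), of bF r a] n by (auto simp: bF_def)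
  finally have "max_corr a F r * B \<le> max_corr a F r * (\<Sum>j\<in>F. \<bar>b $ j\<bar>) + (\<Sum>j\<in>-F. b $ j * (r \<bullet> a j))"
    using lasso_min_kkt[OF b0 assms(2)] unfolding r_def by linarith
  moreover have "max_corr a F r * ((\<Sum>j\<in>F. \<bar>b $ j\<bar>) + (\<Sum>j\<in>-F. \<bar>b $ j\<bar>)) \<le> max_corr a F r * B"
    using lb max_corr_nonneg[OF assms(2), of a r] by (intro mult_left_mono) (simp_all add: l1_norm_def split)
  ultimately show ?thesis by (simp add: algebra_simps)
qed

text \<open>Evaluating \<open>sgn r1 \<bullet> y\<close> with either solution gives
\<open>norm r1 + k1 * B1 \<le> norm r2 * (sgn r1 \<bullet> sgn r2) + k1 * B2\<close>, and the same holds with the indices exchanged. The sum of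
\<open>k2\<close> times the first and \<open>k1\<close> times the second inequality no longer contains the budgets.\<close>

lemma residual_directions_close:
  assumes b1: "lasso_min a y F B1 b1" and b2: "lasso_min a y F B2 b2" and F: "F \<noteq> {}"
  defines "r1 \<equiv> y - lin_pred a b1" and "r2 \<equiv> y - lin_pred a b2"
  assumes nz: "r1 \<noteq> 0" "r2 \<noteq> 0"
  defines "k1 \<equiv> max_corr a F (sgn r1)" and "k2 \<equiv> max_corr a F (sgn r2)"
  assumes k: "0 < k1" "0 < k2"
  shows "min (k1 / k2) (k2 / k1) \<le> sgn r1 \<bullet> sgn r2"
proof -
  define \<rho> where "\<rho> = sgn r1 \<bullet> sgn r2"
  have n: "0 < norm r1" "0 < norm r2" using nz by auto
  have key: "norm r + max_corr a F (sgn r) * B \<le> norm r' * (sgn r \<bullet> sgn r') + max_corr a F (sgn r) * B'"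
    if m: "lasso_min a y F B b" "lasso_min a y F B' b'" and r: "r = y - lin_pred a b" "r' = y - lin_pred a b'"
      "r \<noteq> 0" "r' \<noteq> 0" for r r' B B' b b'
  proof -
    have sg: "sgn r = (1 / norm r) *\<^sub>R r" "r' = norm r' *\<^sub>R sgn r'"
      using r by (simp_all add: sgn_div_norm inverse_eq_divide)
    have "max_corr a F (sgn r) * B = (1 / norm r) * (max_corr a F r * B)"
      unfolding sg(1) by (subst max_corr_scaleR[OF F]) auto
    also have "\<dots> \<le> (1 / norm r) * (r \<bullet> lin_pred a b)"
      using lasso_min_kkt[OF m(1) F] by (intro mult_left_mono) (auto simp: r)
    also have "\<dots> = sgn r \<bullet> lin_pred a b" by (simp add: sg(1))
    finally have "norm r + max_corr a F (sgn r) * B \<le> sgn r \<bullet> r + sgn r \<bullet> lin_pred a b"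
      using r(3) by (simp add: sg(1) power2_norm_eq_inner[symmetric] power2_eq_square)
    also have "\<dots> = sgn r \<bullet> y" by (simp add: r(1) inner_diff_right)
    also have "\<dots> = sgn r \<bullet> r' + sgn r \<bullet> lin_pred a b'" by (simp add: r(2) inner_diff_right)
    also have "sgn r \<bullet> r' = norm r' * (sgn r \<bullet> sgn r')"
      by (subst sg(2)) simp
    also have "sgn r \<bullet> lin_pred a b' \<le> max_corr a F (sgn r) * l1_norm b'"
      using inner_lin_pred_le_max_corr[OF F, of b' "sgn r" a] m(2) by (auto simp: lasso_min_def)
    also have "\<dots> \<le> max_corr a F (sgn r) * B'"
      using m(2) by (intro mult_left_mono max_corr_nonneg[OF F]) (auto simp: lasso_min_def)
    finally show ?thesis by simp
  qed
  have 1: "norm r1 + k1 * B1 \<le> norm r2 * \<rho> + k1 * B2"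
    using key[OF b1 b2 _ _ nz] by (simp add: r1_def r2_def k1_def \<rho>_def)
  have 2: "norm r2 + k2 * B2 \<le> norm r1 * \<rho> + k2 * B1"
    using key[OF b2 b1 _ _ nz(2,1)] by (simp add: r1_def r2_def k2_def \<rho>_def inner_commute)
  have "k2 * (norm r1 + k1 * B1) + k1 * (norm r2 + k2 * B2)
      \<le> k2 * (norm r2 * \<rho> + k1 * B2) + k1 * (norm r1 * \<rho> + k2 * B1)"
    using k by (intro add_mono mult_left_mono[OF 1] mult_left_mono[OF 2]) auto
  then have 3: "k2 * norm r1 + k1 * norm r2 \<le> \<rho> * (k2 * norm r2 + k1 * norm r1)"
    by (simp add: algebra_simps)
  define m where "m = min (k1 / k2) (k2 / k1)"
  have m: "m * k1 \<le> k2" "m * k2 \<le> k1"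
    using k by (auto simp: m_def min_def field_simps)
  have "m * (k2 * norm r2 + k1 * norm r1) \<le> k1 * norm r2 + k2 * norm r1"
    using mult_right_mono[OF m(1), of "norm r1"] mult_right_mono[OF m(2), of "norm r2"]
    by (simp add: algebra_simps)
  also have "\<dots> \<le> \<rho> * (k2 * norm r2 + k1 * norm r1)" using 3 by simp
  finally have "m \<le> \<rho>"
  proof (rule mult_right_le_imp_le)
    show "0 < k2 * norm r2 + k1 * norm r1" using k n by (simp add: add_pos_pos)
  qed
  then show ?thesis by (simp add: m_def \<rho>_def)
qed

lemma exists_kernel_vector:
  fixes a :: "'p::finite \<Rightarrow> 'v::euclidean_space"
  assumes "dim (range a) < card T"
  obtains d where "d \<noteq> 0" "lin_pred a d = 0" "\<And>j. j \<notin> T \<Longrightarrow> d $ j = 0"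
proof -
  let ?W = "{d :: real ^ 'p. \<forall>j. j \<notin> T \<longrightarrow> d $ j = 0}"
  have W: "subspace ?W" by (auto simp: subspace_def)
  have dimW: "dim ?W = card T"
    using dim_substandard_cart[where 'a = real and 'n = 'p, of T] by (simp add: dim_vec_eq)
  have "\<not> inj_on (lin_pred a) ?W"
  proof
    assume inj: "inj_on (lin_pred a) ?W"
    have "inj_on (lin_pred a) (span ?W)" using inj W by (simp add: span_eq_iff[THEN iffD2])
    then have "card T = dim (lin_pred a ` ?W)"
      using dim_image_eq[OF lin_pred_linear, of a ?W] dimW by simp
    also have "\<dots> \<le> dim (span (range a))"
      by (rule dim_subset) (auto simp: lin_pred_def span_base intro!: span_sum span_scale)
    finally show False using assms by simp
  qed
  then obtain u v where uv: "u \<in> ?W" "v \<in> ?W" "lin_pred a u = lin_pred a v" "u \<noteq> v"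
    by (auto simp: inj_on_def)
  show thesis
    by (rule that[of "u - v"]) (use uv in \<open>auto simp: lin_pred_diff\<close>)
qed

text \<open>On the closed orthant of \<open>b\<close> the \<open>l1\<close>-norm is linear, so it does not increase along one of \<open>d\<close> and \<open>- d\<close>. In
that direction some coordinate must approach zero; stopping when the first one arrives stays in the orthant.\<close>

lemma l1_norm_shrink_support:
  fixes b d :: "real ^ 'p::finite"
  assumes d: "d \<noteq> 0" "\<And>j. b $ j = 0 \<Longrightarrow> d $ j = 0"
  obtains t where "l1_norm (b + t *\<^sub>R d) \<le> l1_norm b"
    "{j. (b + t *\<^sub>R d) $ j \<noteq> 0} \<subset> {j. b $ j \<noteq> 0}"
proof -
  note found = that
  have main: thesis if s: "(\<Sum>j\<in>UNIV. sgn (b $ j) * e $ j) \<le> 0" and e: "e = c *\<^sub>R d" "c \<noteq> 0" for e c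
  proof -
    have supp: "b $ j = 0 \<Longrightarrow> e $ j = 0" for j using d(2) e by simp
    \<comment> \<open>the coordinates that move towards zero; the first one to arrive fixes the step length\<close>
    define N where "N = {j. sgn (b $ j) * e $ j < 0}"
    have "N \<noteq> {}"
    proof
      assume "N = {}"
      then have nn: "0 \<le> sgn (b $ j) * e $ j" for j unfolding N_def using not_le by blast
      then have "(\<Sum>j\<in>UNIV. sgn (b $ j) * e $ j) = 0" using s by (simp add: sum_nonneg order_antisym)
      then have "\<forall>j\<in>UNIV. sgn (b $ j) * e $ j = 0" by (subst (asm) sum_nonneg_eq_0_iff) (auto simp: nn)
      then have "e $ j = 0" for j using supp[of j] by (auto simp: sgn_eq_0_iff)
      then show False using e d(1) by (auto simp: vec_eq_iff)
    qed
    define \<tau> where "\<tau> j = \<bar>b $ j\<bar> / \<bar>e $ j\<bar>" for j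
    obtain i where i: "i \<in> N" "\<And>j. j \<in> N \<Longrightarrow> \<tau> i \<le> \<tau> j"
      using \<open>N \<noteq> {}\<close> by (meson arg_min_if_finite(1) arg_min_least finite)
    define t where "t = \<tau> i"
    have t0: "0 \<le> t" by (simp add: t_def \<tau>_def)
    have abs_eq: "\<bar>b $ j + t * e $ j\<bar> = \<bar>b $ j\<bar> + t * (sgn (b $ j) * e $ j)" for j
    proof (cases "j \<in> N")
      case True
      then have "t \<le> \<bar>b $ j\<bar> / \<bar>e $ j\<bar>" "e $ j \<noteq> 0" using i(2) by (auto simp: t_def \<tau>_def N_def)
      then have "t * \<bar>e $ j\<bar> \<le> \<bar>b $ j\<bar>" by (simp add: field_simps)
      moreover have "(0 < b $ j \<and> e $ j < 0) \<or> (b $ j < 0 \<and> 0 < e $ j)"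
        using True by (auto simp: N_def sgn_if split: if_splits)
      ultimately show ?thesis by (auto simp: sgn_if)
    next
      case False
      then have "0 \<le> sgn (b $ j) * e $ j" by (simp add: N_def)
      then show ?thesis using t0 supp[of j]
      proof (cases "b $ j" "0 :: real" rule: linorder_cases)
        case less
        then have "t * e $ j \<le> 0" using \<open>0 \<le> sgn (b $ j) * e $ j\<close> t0 by (simp add: mult_nonneg_nonpos)
        then show ?thesis using less by simp
      qed auto
    qed
    have "l1_norm (b + t *\<^sub>R e) = (\<Sum>j\<in>UNIV. \<bar>b $ j\<bar> + t * (sgn (b $ j) * e $ j))"
      unfolding l1_norm_def by (intro sum.cong refl) (simp add: abs_eq)
    also have "\<dots> = l1_norm b + t * (\<Sum>j\<in>UNIV. sgn (b $ j) * e $ j)"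
      by (simp only: l1_norm_def sum.distrib sum_distrib_left)
    finally have "l1_norm (b + t *\<^sub>R e) = l1_norm b + t * (\<Sum>j\<in>UNIV. sgn (b $ j) * e $ j)" .
    then have l1: "l1_norm (b + t *\<^sub>R e) \<le> l1_norm b"
      using s t0 by (simp add: mult_nonneg_nonpos)
    have iz: "(b + t *\<^sub>R e) $ i = 0" "b $ i \<noteq> 0"
    proof -
      show "b $ i \<noteq> 0" using i(1) by (auto simp: N_def)
      have "e $ i \<noteq> 0" using i(1) by (auto simp: N_def)
      then have "t * \<bar>e $ i\<bar> = \<bar>b $ i\<bar>" by (simp add: t_def \<tau>_def)
      moreover have "sgn (b $ i) * e $ i = - \<bar>e $ i\<bar>"
        using i(1) by (auto simp: N_def sgn_if split: if_splits)
      ultimately show "(b + t *\<^sub>R e) $ i = 0" using abs_eq[of i] by simp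
    qed
    have "{j. (b + t *\<^sub>R e) $ j \<noteq> 0} \<subset> {j. b $ j \<noteq> 0}"
      using iz supp by auto
    then show thesis using found[of "t * c"] l1 by (simp add: e)
  qed
  show thesis
  proof (cases "(\<Sum>j\<in>UNIV. sgn (b $ j) * d $ j) \<le> 0")
    case True then show ?thesis using main[of d 1] by simp
  next
    case False
    show ?thesis
    proof (rule main[of "- d" "-1"])
      show "(\<Sum>j\<in>UNIV. sgn (b $ j) * (- d) $ j) \<le> 0"
        using False by (simp only: vector_uminus_component mult_minus_right sum_negf)
    qed simp_all
  qed
qed

text \<open>Take a minimizer of smallest support. A kernel vector of its active columns would let the support shrink without
changing the fit.\<close>

lemma sparse_lasso_min_exists:
  fixes a :: "'p::finite \<Rightarrow> 'v::euclidean_space"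
  assumes "0 \<le> B"
  obtains b where "lasso_min a y UNIV B b" "card {j. b $ j \<noteq> 0} \<le> dim (range a)"
proof -
  let ?card = "\<lambda>b :: real ^ 'p. card {j. b $ j \<noteq> 0}"
  obtain b0 where "lasso_min a y UNIV B b0" using lasso_min_exists[OF assms] .
  then obtain b where b: "lasso_min a y UNIV B b" "\<And>b'. lasso_min a y UNIV B b' \<Longrightarrow> ?card b \<le> ?card b'"
    using ex_has_least_nat[of "lasso_min a y UNIV B" b0 ?card] by blast
  have "?card b \<le> dim (range a)"
  proof (rule ccontr)
    assume "\<not> ?thesis"
    then obtain d where d: "d \<noteq> 0" "lin_pred a d = 0" "\<And>j. j \<notin> {j. b $ j \<noteq> 0} \<Longrightarrow> d $ j = 0"
      using exists_kernel_vector[of a "{j. b $ j \<noteq> 0}"] by (metis not_le)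
    obtain t where t: "l1_norm (b + t *\<^sub>R d) \<le> l1_norm b"
      "{j. (b + t *\<^sub>R d) $ j \<noteq> 0} \<subset> {j. b $ j \<noteq> 0}"
      using l1_norm_shrink_support[of d b] d(1,3) by auto
    have "lin_pred a (b + t *\<^sub>R d) = lin_pred a b"
      using d(2) lin_pred_linear[of a] by (simp add: linear_add linear_scale)
    then have "lasso_min a y UNIV B (b + t *\<^sub>R d)"
      using b(1) t(1) by (simp add: lasso_min_def)
    then have "?card b \<le> ?card (b + t *\<^sub>R d)" by (rule b(2))
    moreover have "?card (b + t *\<^sub>R d) < ?card b" by (rule psubset_card_mono[OF finite t(2)])
    ultimately show False by linarith
  qed
  then show thesis using b(1) that by blast
qed

section \<open>Measurability of events about predictors\<close>

lemma l1_predictors_iff: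
  "b \<in> l1_predictors n S B \<longleftrightarrow> l1_norm b \<le> B \<and>
     (\<forall>b'. l1_norm b' \<le> B \<longrightarrow> train_loss n S b \<le> train_loss n S b')"
  by (auto simp: l1_predictors_def is_arg_min_def not_less)

lemma continuous_on_train_loss [continuous_intros]:
  fixes f :: "'a::topological_space \<Rightarrow> nat \<Rightarrow> (real ^ 'p::finite) \<times> real"
  assumes "continuous_on A f" "continuous_on A g"
  shows "continuous_on A (\<lambda>x. train_loss n (f x) (g x))"
proof -
  have [continuous_intros]: "continuous_on A (\<lambda>x. f x i)" for i
    by (rule continuous_on_product_then_coordinatewise[OF assms(1)])
  show ?thesis
    unfolding train_loss_def sq_loss_def using assms(2) by (intro continuous_intros)
qed

text \<open>The pairs of a minimizer and a sample form a closed set, and minimizers range over a compact ball, along which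
projection is a closed map. Unlike measurability, closedness survives the intersection over uncountably many budgets.\<close>

lemma closed_exists_l1_predictor:
  fixes K :: "(real ^ 'p::finite) set"
  assumes K: "closed K"
  shows "closed {S. \<exists>b\<in>l1_predictors n S B. b \<in> K}"
proof -
  let ?C = "{b :: real ^ 'p. l1_norm b \<le> B}"
  have cmp: "compact (?C \<inter> K)" using compact_l1_ball K by (rule compact_Int_closed)
  let ?G = "{x :: (real ^ 'p) \<times> (nat \<Rightarrow> (real ^ 'p) \<times> real). fst x \<in> ?C \<inter> K \<and>
      (\<forall>b'\<in>?C. train_loss n (snd x) (fst x) \<le> train_loss n (snd x) b')}"
  have G: "closed ?G"
  proof -
    have eq: "?G = ((?C \<inter> K) \<times> UNIV) \<inter> (\<Inter>b'\<in>?C. {x. train_loss n (snd x) (fst x) \<le> train_loss n (snd x) b'})"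
      by auto
    have cl1: "closed ((?C \<inter> K) \<times> (UNIV :: (nat \<Rightarrow> (real ^ 'p) \<times> real) set))"
      by (intro closed_Times compact_imp_closed[OF cmp] closed_UNIV)
    have cl2: "closed {x :: (real ^ 'p) \<times> (nat \<Rightarrow> (real ^ 'p) \<times> real).
        train_loss n (snd x) (fst x) \<le> train_loss n (snd x) b'}" for b'
      by (intro closed_Collect_le continuous_intros)
    show ?thesis unfolding eq by (intro closed_Int cl1 closed_INT ballI cl2)
  qed
  have "closed_map (prod_topology (top_of_set (?C \<inter> K)) euclidean) euclidean snd"
  proof (rule closed_map_snd)
    have "compactin euclidean (?C \<inter> K)" using cmp by (simp only: compactin_euclidean_iff)
    then show "compact_space (top_of_set (?C \<inter> K))" by (rule compact_space_subtopology)
  qed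
  moreover have "closedin (prod_topology (top_of_set (?C \<inter> K)) euclidean) ?G"
  proof -
    have "prod_topology (top_of_set (?C \<inter> K)) euclidean
       = top_of_set ((?C \<inter> K) \<times> (UNIV :: (nat \<Rightarrow> (real ^ 'p) \<times> real) set))"
      using prod_topology_subtopology_eu[of "?C \<inter> K" "UNIV :: (nat \<Rightarrow> (real ^ 'p) \<times> real) set"] by simp
    moreover have "?G \<subseteq> (?C \<inter> K) \<times> UNIV" by auto
    ultimately show ?thesis using G by (simp add: closed_subset)
  qed
  ultimately have "closed (snd ` ?G)" by (auto simp: closed_map_def)
  moreover have "snd ` ?G = {S. \<exists>b\<in>l1_predictors n S B. b \<in> K}"
    by (auto simp: l1_predictors_iff image_iff)
  ultimately show ?thesis by simp
qed

lemma sets_sample_distr: "sets (sample_distr n \<beta> \<sigma>) = sets (Pi\<^sub>M {1..n} (\<lambda>_. borel))"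
  unfolding sample_distr_def by (intro sets_PiM_cong) auto

text \<open>Samples are sequences with a fixed value outside \<open>{1..n}\<close>, so their inclusion into the space of all sequences is
measurable coordinate by coordinate.\<close>

lemma closed_in_sets_sample_distr:
  fixes C :: "(nat \<Rightarrow> (real ^ 'p::finite) \<times> real) set"
  assumes "closed C"
  shows "{S \<in> space (sample_distr n \<beta> \<sigma>). S \<in> C} \<in> sets (sample_distr n \<beta> \<sigma>)"
proof -
  have "(\<lambda>S. S) \<in> Pi\<^sub>M {1..n} (\<lambda>_. borel) \<rightarrow>\<^sub>M Pi\<^sub>M UNIV (\<lambda>_. borel :: ((real ^ 'p) \<times> real) measure)"
  proof (rule measurable_PiM_single')
    fix i :: nat
    show "(\<lambda>S. S i) \<in> Pi\<^sub>M {1..n} (\<lambda>_. borel) \<rightarrow>\<^sub>M (borel :: ((real ^ 'p) \<times> real) measure)"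
    proof (cases "i \<in> {1..n}")
      case False
      have "(\<lambda>S. undefined) \<in> Pi\<^sub>M {1..n} (\<lambda>_. borel) \<rightarrow>\<^sub>M (borel :: ((real ^ 'p) \<times> real) measure)"
        by simp
      then show ?thesis
        by (rule measurable_cong[THEN iffD1, rotated]) (use False in \<open>auto simp: space_PiM PiE_def extensional_def\<close>)
    qed simp
  qed auto
  then have "(\<lambda>S. S) \<in> Pi\<^sub>M {1..n} (\<lambda>_. borel) \<rightarrow>\<^sub>M (borel :: (nat \<Rightarrow> (real ^ 'p) \<times> real) measure)"
    by (simp cong: measurable_cong_sets add: sets_PiM_equal_borel)
  then have "(\<lambda>S. S) \<in> sample_distr n \<beta> \<sigma> \<rightarrow>\<^sub>M (borel :: (nat \<Rightarrow> (real ^ 'p) \<times> real) measure)"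
    by (simp cong: measurable_cong_sets add: sets_sample_distr)
  from measurable_sets[OF this, of C] assms show ?thesis
    by (simp add: vimage_def Int_def conj_commute)
qed

section \<open>Samples as regression problems\<close>

text \<open>Vectors of \<open>n\<close> observations live on the coordinates \<open>enc 1, ..., enc n\<close> of \<^typ>\<open>real ^ 'p\<close>, where there is room because
there are more features than observations. This keeps \<open>n\<close> a variable while all columns belong to one euclidean space.\<close>

definition embed_vec :: "(nat \<Rightarrow> 'p::finite) \<Rightarrow> nat \<Rightarrow> (nat \<Rightarrow> real) \<Rightarrow> real ^ 'p" where
  "embed_vec enc n f = (\<Sum>i=1..n. f i *\<^sub>R axis (enc i) 1)"

lemma embed_nth:
  assumes "inj_on enc {1..n}" "i \<in> {1..n}"
  shows "embed_vec enc n f $ enc i = f i"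
proof -
  have ax: "axis (enc k) (1 :: real) $ enc i = (if k = i then 1 else 0)" if "k \<in> {1..n}" for k
    using inj_on_eq_iff[OF assms(1) that assms(2)] by (auto simp: axis_def)
  have "embed_vec enc n f $ enc i = (\<Sum>k=1..n. f k * axis (enc k) 1 $ enc i)"
    by (simp add: embed_vec_def)
  also have "\<dots> = (\<Sum>k=1..n. if k = i then f k else 0)"
    by (rule sum.cong) (simp_all add: ax)
  finally have "embed_vec enc n f $ enc i = (\<Sum>k=1..n. if k = i then f k else 0)" .
  then show ?thesis using assms(2) by simp
qed

lemma inner_embed: "z \<bullet> embed_vec enc n f = (\<Sum>i=1..n. z $ enc i * f i)"
  by (simp add: embed_vec_def inner_sum_right inner_axis mult.commute)

lemma inner_embed_embed:
  assumes "inj_on enc {1..n}"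
  shows "embed_vec enc n f \<bullet> embed_vec enc n g = (\<Sum>i=1..n. f i * g i)"
  unfolding inner_embed by (rule sum.cong) (auto simp: embed_nth[OF assms])

lemma embed_combination:
  "embed_vec enc n (\<lambda>i. f i - (\<Sum>j\<in>UNIV. b $ j * g j i)) = embed_vec enc n f - lin_pred (\<lambda>j. embed_vec enc n (g j)) b"
proof -
  have "lin_pred (\<lambda>j. embed_vec enc n (g j)) b = (\<Sum>j\<in>UNIV. \<Sum>i=1..n. (b $ j * g j i) *\<^sub>R axis (enc i) 1)"
    by (simp add: lin_pred_def embed_vec_def scaleR_sum_right)
  also have "\<dots> = (\<Sum>i=1..n. (\<Sum>j\<in>UNIV. b $ j * g j i) *\<^sub>R axis (enc i) 1)"
    by (subst sum.swap) (simp add: scaleR_sum_left)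
  finally show ?thesis
    by (simp add: embed_vec_def scaleR_diff_left sum_subtractf)
qed

lemma embed_of_range:
  assumes "inj_on enc {1..n}" "z \<in> range (embed_vec enc n)"
  shows "z = embed_vec enc n (\<lambda>i. z $ enc i)"
proof -
  obtain f where f: "z = embed_vec enc n f" using assms(2) by auto
  have "f i = z $ enc i" if "i \<in> {1..n}" for i
    unfolding f by (rule embed_nth[OF assms(1) that, symmetric])
  then have "embed_vec enc n f = embed_vec enc n (\<lambda>i. z $ enc i)"
    unfolding embed_vec_def by (intro sum.cong refl) auto
  then show ?thesis using f by simp
qed

lemma norm_embed: 
  assumes "inj_on enc {1..n}"
  shows "(norm (embed_vec enc n f))\<^sup>2 = (\<Sum>i=1..n. (f i)\<^sup>2)"
  unfolding power2_norm_eq_inner inner_embed_embed[OF assms] by (simp add: power2_eq_square)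

lemma dim_range_embed:
  "dim (range (\<lambda>j. embed_vec enc n (g j))) \<le> n"
proof -
  have "range (\<lambda>j. embed_vec enc n (g j)) \<subseteq> span ((\<lambda>i. axis (enc i) 1) ` {1..n})"
    unfolding embed_vec_def by (auto intro!: span_sum span_scale intro: span_base)
  then have "dim (range (\<lambda>j. embed_vec enc n (g j))) \<le> card ((\<lambda>i. axis (enc i) 1 :: real ^ 'a) ` {1..n})"
    by (intro dim_le_card) auto
  also have "\<dots> \<le> card {1..n}" by (rule card_image_le) simp
  finally show ?thesis by simp
qed

definition sample_col :: "(nat \<Rightarrow> 'p::finite) \<Rightarrow> nat \<Rightarrow> (nat \<Rightarrow> (real ^ 'p) \<times> real) \<Rightarrow> 'p \<Rightarrow> real ^ 'p" where
  "sample_col enc n S j = embed_vec enc n (\<lambda>i. fst (S i) $ j)"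

definition sample_resp :: "(nat \<Rightarrow> 'p::finite) \<Rightarrow> nat \<Rightarrow> (nat \<Rightarrow> (real ^ 'p) \<times> real) \<Rightarrow> real ^ 'p" where
  "sample_resp enc n S = embed_vec enc n (\<lambda>i. snd (S i))"

lemma l1_predictors_eq_lasso_min:
  assumes "inj_on enc {1..n}"
  shows "l1_predictors n S B = {b. lasso_min (sample_col enc n S) (sample_resp enc n S) UNIV B b}"
proof -
  have "train_loss n S b = (norm (sample_resp enc n S - lin_pred (sample_col enc n S) b))\<^sup>2" for b
  proof -
    have "sample_resp enc n S - lin_pred (sample_col enc n S) b
        = embed_vec enc n (\<lambda>i. snd (S i) - (\<Sum>j\<in>UNIV. b $ j * fst (S i) $ j))"
      unfolding sample_resp_def sample_col_def[abs_def] by (rule embed_combination[symmetric])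
    then show ?thesis
      unfolding train_loss_def sq_loss_def
      by (simp add: norm_embed[OF assms] inner_vec_def mult.commute)
  qed
  then show ?thesis
    by (auto simp: l1_predictors_def is_arg_min_def lasso_min_def not_less)
qed

lemma sparse_l1_predictor_exists:
  fixes S :: "nat \<Rightarrow> (real ^ 'p::finite) \<times> real"
  assumes "n \<le> CARD('p)" "0 \<le> B"
  obtains b where "b \<in> l1_predictors n S B" "card {j. b $ j \<noteq> 0} \<le> n"
proof -
  obtain enc :: "nat \<Rightarrow> 'p" where enc: "inj_on enc {1..n}"
    using card_le_inj[of "{1..n}" "UNIV :: 'p set"] assms(1) by auto
  obtain b where b: "lasso_min (sample_col enc n S) (sample_resp enc n S) UNIV B b"
    "card {j. b $ j \<noteq> 0} \<le> dim (range (sample_col enc n S))"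
    using sparse_lasso_min_exists[OF assms(2)] .
  moreover have "dim (range (sample_col enc n S)) \<le> n"
    unfolding sample_col_def[abs_def] by (rule dim_range_embed)
  ultimately show thesis
    using that[of b] by (simp add: l1_predictors_eq_lasso_min[OF enc])
qed

text \<open>A vector with at most \<open>n\<close> nonzero coordinates vanishes on at least half of \<open>A\<close>.\<close>

lemma sparse_error_lower_bound:
  fixes \<beta> b :: "real ^ 'p::finite"
  assumes "card {j. b $ j \<noteq> 0} \<le> n" "card A = 2 * n" "\<And>j. j \<in> A \<Longrightarrow> \<beta> $ j = h"
  shows "real n * h\<^sup>2 \<le> (norm (b - \<beta>))\<^sup>2"
proof -
  let ?Z = "A - {j. b $ j \<noteq> 0}"
  have "card A - card {j. b $ j \<noteq> 0} \<le> card ?Z" by (rule diff_card_le_card_Diff) simp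
  then have "n \<le> card ?Z" using assms by linarith
  then have "real n * h\<^sup>2 \<le> (\<Sum>j\<in>?Z. h\<^sup>2)" by (simp add: mult_right_mono)
  also have "\<dots> = (\<Sum>j\<in>?Z. ((b - \<beta>) $ j)\<^sup>2)"
    by (rule sum.cong) (auto simp: assms(3))
  also have "\<dots> \<le> (\<Sum>j\<in>UNIV. ((b - \<beta>) $ j)\<^sup>2)" by (rule sum_mono2) auto
  also have "\<dots> = (norm (b - \<beta>))\<^sup>2" by (simp add: norm_vec_def L2_set_def sum_nonneg)
  finally show ?thesis .
qed

lemma sum_mult_le_L2:
  fixes f g :: "'i \<Rightarrow> real"
  shows "(\<Sum>j\<in>J. f j * g j) \<le> L2_set f J * L2_set g J"
proof -
  have "(\<Sum>j\<in>J. f j * g j) \<le> (\<Sum>j\<in>J. \<bar>f j\<bar> * \<bar>g j\<bar>)"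
    by (rule sum_mono) (metis abs_ge_self abs_mult)
  then show ?thesis using L2_set_mult_ineq[of f g J] by linarith
qed

text \<open>If \<open>norm (b - \<beta>) < E\<close>, the block part of \<open>b\<close> has \<open>l1\<close>-norm at least \<open>c - sqrt m * E\<close>, and
\<open>lasso_restricted_vs_full\<close> bounds \<open>\<kappa> * (c - sqrt m * E)\<close> by the sum of \<open>b $ j * (\<zeta> \<bullet> a j)\<close>. Split \<open>b\<close> on the block into the
constant \<open>c / m\<close> and a remainder \<open>\<delta>\<close>. The constant only sees the sum of the correlations, in which the correction
reduces the contribution of the \<open>A j\<close> by the factor \<open>\<sigma> / \<rho>\<close>. For \<open>\<delta>\<close> only the Euclidean norm of the correlations
matters. There the correction subtracts \<open>\<theta> = (\<rho> + \<sigma>) / \<rho>\<close> times the projection to constant vectors, which does not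
increase the norm because \<open>0 \<le> \<theta> \<le> 2\<close>. What is left is the contribution of \<open>\<xi>\<close>, at most \<open>\<tau>\<close> in both places.\<close>

lemma lasso_error_from_correlations:
  fixes a :: "'p::finite \<Rightarrow> 'v::real_inner" and \<beta> b :: "real ^ 'p" and J :: "'p set"
  assumes b0: "lasso_min a y (-J) B b0" and b: "lasso_min a y UNIV B b" and ne: "-J \<noteq> {}" "J \<noteq> {}"
  defines "r \<equiv> y - lin_pred a b0"
  defines "\<zeta> \<equiv> sgn r"
  defines "m \<equiv> real (card J)"
  assumes r: "r \<noteq> 0" and \<beta>: "\<And>j. j \<in> J \<Longrightarrow> \<beta> $ j = c / m" 
    and par: "0 \<le> s" "0 < \<sigma>" "\<sigma> \<le> \<rho>" "s = c / sqrt m"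
    and A: "\<And>j. j \<in> J \<Longrightarrow> \<zeta> \<bullet> a j = A j - ((\<rho> + \<sigma>) / \<rho> * ((\<Sum>i\<in>J. A i) / sqrt m) - s / \<rho> * \<xi>) / sqrt m"
    and bounds: "\<bar>(\<Sum>i\<in>J. A i) / sqrt m\<bar> \<le> \<alpha>" "L2_set A J \<le> A2" "s / \<sigma> * \<bar>\<xi>\<bar> \<le> \<tau>"
    and E: "0 \<le> E"
    and contra: "s * (\<alpha> + \<tau>) + E * (A2 + \<tau>) < max_corr a (-J) \<zeta> * (c - sqrt m * E)"
  shows "E \<le> norm (b - \<beta>)"
proof (rule ccontr)
  assume "\<not> ?thesis"
  then have small: "norm (b - \<beta>) < E" by simp
  define \<kappa> where "\<kappa> = max_corr a (-J) \<zeta>"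
  define \<delta> where "\<delta> j = b $ j - c / m" for j
  define A' where "A' j = \<zeta> \<bullet> a j" for j
  define q where "q = (\<Sum>i\<in>J. A i) / sqrt m"
  have m: "0 < m" using ne by (simp add: m_def card_gt_0_iff)
  have sm: "sqrt m * sqrt m = m" "0 < sqrt m" using m by auto
  have \<rho>: "0 < \<rho>" using par by linarith
  have nr: "0 < norm r" using r by simp
  have \<zeta>: "\<zeta> = (1 / norm r) *\<^sub>R r" by (simp add: \<zeta>_def sgn_div_norm inverse_eq_divide)
  have \<kappa>0: "0 \<le> \<kappa>" unfolding \<kappa>_def by (rule max_corr_nonneg[OF ne(1)])
  have main: "\<kappa> * (\<Sum>j\<in>J. \<bar>b $ j\<bar>) \<le> (\<Sum>j\<in>J. b $ j * A' j)"
  proof -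
    have "max_corr a (-J) r * (\<Sum>j\<in>-(-J). \<bar>b $ j\<bar>) \<le> (\<Sum>j\<in>-(-J). b $ j * (r \<bullet> a j))"
      unfolding r_def by (rule lasso_restricted_vs_full[OF b0 ne(1) b])
    then have le: "max_corr a (-J) r * (\<Sum>j\<in>J. \<bar>b $ j\<bar>) \<le> (\<Sum>j\<in>J. b $ j * (r \<bullet> a j))" by simp
    have "\<kappa> = 1 / norm r * max_corr a (-J) r"
      unfolding \<kappa>_def \<zeta> by (rule max_corr_scaleR[OF ne(1)]) simp
    moreover have "(\<Sum>j\<in>J. b $ j * A' j) = 1 / norm r * (\<Sum>j\<in>J. b $ j * (r \<bullet> a j))"
      unfolding sum_distrib_left A'_def \<zeta> by (intro sum.cong) auto
    ultimately show ?thesis using mult_left_mono[OF le, of "1 / norm r"] nr by (simp add: mult.assoc)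
  qed
  have \<delta>2: "L2_set \<delta> J \<le> E"
  proof -
    have "L2_set \<delta> J = L2_set (\<lambda>j. (b - \<beta>) $ j) J"
      by (rule L2_set_cong) (auto simp: \<delta>_def \<beta>)
    also have "\<dots> \<le> L2_set (\<lambda>j. (b - \<beta>) $ j) UNIV"
      unfolding L2_set_def by (intro real_sqrt_le_mono sum_mono2) auto
    also have "\<dots> = norm (b - \<beta>)" by (simp add: norm_vec_def L2_set_def)
    finally show ?thesis using small by simp
  qed
  have lower: "c - sqrt m * E \<le> (\<Sum>j\<in>J. \<bar>b $ j\<bar>)"
  proof -
    have "(\<Sum>j\<in>J. - 1 * \<delta> j) \<le> L2_set (\<lambda>_. - 1) J * L2_set \<delta> J" by (rule sum_mult_le_L2)
    also have "L2_set (\<lambda>_. - 1 :: real) J = sqrt m" by (simp add: L2_set_def m_def)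
    also have "sqrt m * L2_set \<delta> J \<le> sqrt m * E" using \<delta>2 sm by (intro mult_left_mono) auto
    finally have "- (\<Sum>j\<in>J. \<delta> j) \<le> sqrt m * E" by (simp add: sum_negf)
    moreover have "(\<Sum>j\<in>J. \<delta> j) = (\<Sum>j\<in>J. b $ j) - c"
      using m by (simp add: \<delta>_def sum_subtractf m_def[symmetric])
    moreover have "(\<Sum>j\<in>J. b $ j) \<le> (\<Sum>j\<in>J. \<bar>b $ j\<bar>)" by (rule sum_mono) simp
    ultimately show ?thesis by linarith
  qed
  have A': "A' j = (A j - (\<rho> + \<sigma>) / \<rho> * q / sqrt m) + s / \<rho> * \<xi> / sqrt m" if "j \<in> J" for j
    using A[OF that] by (simp add: A'_def q_def diff_divide_distrib)
  have s\<rho>: "s / \<rho> * \<bar>\<xi>\<bar> \<le> \<tau>"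
  proof -
    have "s / \<rho> \<le> s / \<sigma>" using par by (intro divide_left_mono) auto
    then have "s / \<rho> * \<bar>\<xi>\<bar> \<le> s / \<sigma> * \<bar>\<xi>\<bar>" by (rule mult_right_mono) simp
    then show ?thesis using bounds(3) by linarith
  qed
  have "\<bar>s / \<rho>\<bar> = s / \<rho>" by (rule abs_of_nonneg) (rule divide_nonneg_pos[OF par(1) \<rho>])
  then have absp: "\<bar>s / \<rho> * \<xi>\<bar> \<le> \<tau>" using s\<rho> by (simp only: abs_mult)
  have msm: "m * (x / sqrt m) = sqrt m * x" for x
  proof -
    have "m / sqrt m = sqrt m" using m by (simp add: real_div_sqrt)
    then have "x * (m / sqrt m) = x * sqrt m" by simp
    then show ?thesis by (simp add: mult.commute)
  qed
  have msq: "m * (x / sqrt m)\<^sup>2 = x\<^sup>2" for x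
    using m by (simp add: power_divide)
  have sumA': "(\<Sum>j\<in>J. A' j) = sqrt m * (s / \<rho> * \<xi> - \<sigma> / \<rho> * q)"
  proof -
    have "(\<Sum>j\<in>J. A' j) = (\<Sum>j\<in>J. (A j - (\<rho> + \<sigma>) / \<rho> * q / sqrt m) + s / \<rho> * \<xi> / sqrt m)"
      by (rule sum.cong) (auto simp: A')
    also have "\<dots> = (\<Sum>j\<in>J. A j) - m * ((\<rho> + \<sigma>) / \<rho> * q / sqrt m) + m * (s / \<rho> * \<xi> / sqrt m)"
      by (simp add: sum.distrib sum_subtractf m_def)
    also have "(\<Sum>j\<in>J. A j) = sqrt m * q" using sm by (simp add: q_def)
    also have "m * ((\<rho> + \<sigma>) / \<rho> * q / sqrt m) = sqrt m * ((\<rho> + \<sigma>) / \<rho> * q)" by (rule msm)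
    also have "m * (s / \<rho> * \<xi> / sqrt m) = sqrt m * (s / \<rho> * \<xi>)" by (rule msm)
    finally have "(\<Sum>j\<in>J. A' j) = sqrt m * (q - (\<rho> + \<sigma>) / \<rho> * q + s / \<rho> * \<xi>)"
      by (simp add: algebra_simps)
    also have "q - (\<rho> + \<sigma>) / \<rho> * q + s / \<rho> * \<xi> = s / \<rho> * \<xi> - \<sigma> / \<rho> * q"
      using \<rho> by (simp add: field_simps)
    finally show ?thesis .
  qed
  have L2A': "L2_set A' J \<le> A2 + \<tau>"
  proof -
    let ?A1 = "\<lambda>j. A j - (\<rho> + \<sigma>) / \<rho> * q / sqrt m"
    have "L2_set A' J = L2_set (\<lambda>j. ?A1 j + s / \<rho> * \<xi> / sqrt m) J" by (rule L2_set_cong) (auto simp: A')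
    also have "\<dots> \<le> L2_set ?A1 J + L2_set (\<lambda>j. s / \<rho> * \<xi> / sqrt m) J" by (rule L2_set_triangle_ineq)
    also have "L2_set (\<lambda>j. s / \<rho> * \<xi> / sqrt m) J = \<bar>s / \<rho> * \<xi>\<bar>"
    proof -
      have "(\<Sum>j\<in>J. (s / \<rho> * \<xi> / sqrt m)\<^sup>2) = (s / \<rho> * \<xi>)\<^sup>2"
        by (simp only: sum_constant m_def[symmetric] msq)
      then show ?thesis by (simp only: L2_set_def real_sqrt_abs)
    qed
    also have "L2_set ?A1 J \<le> L2_set A J"
    proof -
      define \<theta> where "\<theta> = (\<rho> + \<sigma>) / \<rho>"
      have \<theta>: "0 \<le> \<theta>" "\<theta> \<le> 2" using par \<rho> by (auto simp: \<theta>_def field_simps)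
      have sumA: "(\<Sum>j\<in>J. A j) = sqrt m * q" using sm by (simp add: q_def)
      have "(\<Sum>j\<in>J. (A j - \<theta> * q / sqrt m)\<^sup>2)
          = (\<Sum>j\<in>J. (A j)\<^sup>2) - 2 * (\<theta> * q / sqrt m) * (\<Sum>j\<in>J. A j) + m * (\<theta> * q / sqrt m)\<^sup>2"
      proof -
        have "(\<Sum>j\<in>J. (A j - w)\<^sup>2) = (\<Sum>j\<in>J. (A j)\<^sup>2) - 2 * w * (\<Sum>j\<in>J. A j) + m * w\<^sup>2" for w
        proof -
          have "(A j - w)\<^sup>2 = (A j)\<^sup>2 - 2 * w * A j + w\<^sup>2" for j
            by (simp add: power2_eq_square algebra_simps)
          then show ?thesis
            by (simp only: sum.distrib sum_subtractf sum_distrib_left[symmetric] sum_constant m_def)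
        qed
        then show ?thesis .
      qed
      also have "2 * (\<theta> * q / sqrt m) * (\<Sum>j\<in>J. A j) = 2 * \<theta> * q\<^sup>2"
        using sm by (simp add: sumA power2_eq_square)
      also have "m * (\<theta> * q / sqrt m)\<^sup>2 = \<theta>\<^sup>2 * q\<^sup>2"
        by (simp only: msq power_mult_distrib)
      also have "(\<Sum>j\<in>J. (A j)\<^sup>2) - 2 * \<theta> * q\<^sup>2 + \<theta>\<^sup>2 * q\<^sup>2
          = (\<Sum>j\<in>J. (A j)\<^sup>2) - \<theta> * (2 - \<theta>) * q\<^sup>2"
        by (simp add: power2_eq_square algebra_simps)
      also have "\<dots> \<le> (\<Sum>j\<in>J. (A j)\<^sup>2)" using \<theta> by simp
      finally show ?thesis by (simp add: L2_set_def \<theta>_def)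
    qed
    finally show ?thesis using bounds(2) absp by linarith
  qed
  have upper: "(\<Sum>j\<in>J. b $ j * A' j) \<le> s * (\<alpha> + \<tau>) + E * (A2 + \<tau>)"
  proof -
    have "(\<Sum>j\<in>J. b $ j * A' j) = c / m * (\<Sum>j\<in>J. A' j) + (\<Sum>j\<in>J. \<delta> j * A' j)"
      unfolding sum_distrib_left sum.distrib[symmetric]
      by (rule sum.cong) (simp_all add: \<delta>_def algebra_simps)
    also have "c / m * (\<Sum>j\<in>J. A' j) = s * (s / \<rho> * \<xi> - \<sigma> / \<rho> * q)"
    proof -
      have "c / m * sqrt m = s" using m by (simp add: par(4) field_simps)
      then show ?thesis by (simp only: sumA' mult.assoc[symmetric])
    qed
    also have "\<dots> \<le> s * (\<alpha> + \<tau>)"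
    proof (rule mult_left_mono)
      have "\<bar>\<sigma> / \<rho> * q\<bar> \<le> 1 * \<bar>q\<bar>"
        unfolding abs_mult using par \<rho> by (intro mult_right_mono) auto
      then show "s / \<rho> * \<xi> - \<sigma> / \<rho> * q \<le> \<alpha> + \<tau>"
        using bounds(1) absp unfolding q_def[symmetric] by linarith
    qed (rule par)
    also have "(\<Sum>j\<in>J. \<delta> j * A' j) \<le> L2_set \<delta> J * L2_set A' J" by (rule sum_mult_le_L2)
    also have "\<dots> \<le> E * (A2 + \<tau>)"
      using \<delta>2 L2A' E by (intro mult_mono) auto
    finally show ?thesis by simp
  qed
  have "\<kappa> * (c - sqrt m * E) \<le> \<kappa> * (\<Sum>j\<in>J. \<bar>b $ j\<bar>)" using lower \<kappa>0 by (rule mult_left_mono)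
  then show False using main upper contra by (simp add: \<kappa>_def)
qed

section \<open>The least singular value of a Gaussian matrix\<close>

text \<open>Independent unbiased rounding of each \<open>f i\<close> to \<open>0\<close> or \<open>1\<close>, with error \<open>e i\<close>, would achieve the bound on average. Choosing
the better of the two values, one index after the other, achieves it for certain.\<close>

lemma balanced_rounding:
  fixes x :: "'i \<Rightarrow> 'v::real_inner"
  assumes "finite I" and "\<And>i. i \<in> I \<Longrightarrow> 0 \<le> f i \<and> f i \<le> 1"
  shows "\<exists>e. (\<forall>i\<in>I. e i = f i \<or> e i = f i - 1) \<and>
    (norm (\<Sum>i\<in>I. e i *\<^sub>R x i))\<^sup>2 \<le> (\<Sum>i\<in>I. (norm (x i))\<^sup>2) / 4"
  using assms
proof (induction I rule: finite_induct)
  case (insert i I)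
  then obtain e where e: "\<forall>i\<in>I. e i = f i \<or> e i = f i - 1"
    "(norm (\<Sum>i\<in>I. e i *\<^sub>R x i))\<^sup>2 \<le> (\<Sum>i\<in>I. (norm (x i))\<^sup>2) / 4" by auto
  define S where "S = (\<Sum>i\<in>I. e i *\<^sub>R x i)"
  define t where "t = f i"
  have t: "0 \<le> t" "t \<le> 1" using insert.prems by (auto simp: t_def)
  let ?a = "(norm (S + t *\<^sub>R x i))\<^sup>2" and ?b = "(norm (S + (t - 1) *\<^sub>R x i))\<^sup>2"
  have "(1 - t) * ?a + t * ?b = (norm S)\<^sup>2 + t * (1 - t) * (norm (x i))\<^sup>2"
    unfolding power2_norm_eq_inner
    by (simp add: inner_add_left inner_add_right inner_diff_left inner_diff_right inner_commute algebra_simps)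
  also have "t * (1 - t) * (norm (x i))\<^sup>2 \<le> 1 / 4 * (norm (x i))\<^sup>2"
  proof (rule mult_right_mono)
    have "0 \<le> (t - 1 / 2)\<^sup>2" by simp
    then show "t * (1 - t) \<le> 1 / 4" by (simp add: power2_eq_square algebra_simps)
  qed simp
  finally have avg: "(1 - t) * ?a + t * ?b \<le> (norm S)\<^sup>2 + (norm (x i))\<^sup>2 / 4" by simp
  have "\<exists>c. (c = t \<or> c = t - 1) \<and> (norm (S + c *\<^sub>R x i))\<^sup>2 \<le> (norm S)\<^sup>2 + (norm (x i))\<^sup>2 / 4"
  proof (rule ccontr)
    assume "\<not> ?thesis"
    then have ab: "(norm S)\<^sup>2 + (norm (x i))\<^sup>2 / 4 < ?a" "(norm S)\<^sup>2 + (norm (x i))\<^sup>2 / 4 < ?b"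
      by (metis not_le)+
    define R where "R = (norm S)\<^sup>2 + (norm (x i))\<^sup>2 / 4"
    have "R = (1 - t) * R + t * R" by (simp add: algebra_simps)
    also have "\<dots> < (1 - t) * ?a + t * ?b"
    proof (cases "t = 0")
      case False
      then have "t * R < t * ?b" using ab t by (simp add: R_def)
      moreover have "(1 - t) * R \<le> (1 - t) * ?a" using ab t by (intro mult_left_mono) (auto simp: R_def)
      ultimately show ?thesis by linarith
    qed (use ab in \<open>simp add: R_def\<close>)
    finally show False using avg by (simp add: R_def)
  qed
  then obtain c where c: "c = t \<or> c = t - 1"
    "(norm (S + c *\<^sub>R x i))\<^sup>2 \<le> (norm S)\<^sup>2 + (norm (x i))\<^sup>2 / 4" by blast
  let ?e = "e(i := c)"
  have "(\<Sum>j\<in>insert i I. ?e j *\<^sub>R x j) = S + c *\<^sub>R x i"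
  proof -
    have "(\<Sum>j\<in>I. ?e j *\<^sub>R x j) = S"
      unfolding S_def using insert.hyps by (intro sum.cong) auto
    then show ?thesis using insert.hyps by simp
  qed
  then have "(norm (\<Sum>j\<in>insert i I. ?e j *\<^sub>R x j))\<^sup>2 \<le> (\<Sum>j\<in>insert i I. (norm (x j))\<^sup>2) / 4"
    using c(2) e(2) insert.hyps by (simp only: S_def[symmetric]) (simp add: add_divide_distrib)
  moreover have "\<forall>j\<in>insert i I. ?e j = f j \<or> ?e j = f j - 1"
    using c(1) e(1) by (auto simp: t_def)
  ultimately show ?case by blast
qed simp

text \<open>Different columns use disjoint sets of variables, and each combination has unit variance.\<close>

lemma (in prob_space) std_normal_family_columns:
  assumes X: "std_normal_family X (A \<times> T)" and A: "finite A" "finite T" and z: "(\<Sum>i\<in>A. (z i)\<^sup>2) = 1"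
  shows "std_normal_family (\<lambda>j \<omega>. \<Sum>i\<in>A. z i * X (i, j) \<omega>) T"
  unfolding std_normal_family_def
proof (intro conjI ballI)
  have "indep_vars (\<lambda>j. Pi\<^sub>M (A \<times> {j}) (\<lambda>_. borel)) (\<lambda>j \<omega>. restrict (\<lambda>k. X k \<omega>) (A \<times> {j})) T"
    using X by (intro indep_vars_restrict[where I = "A \<times> T"])
      (auto simp: std_normal_family_def disjoint_family_on_def)
  then have "indep_vars (\<lambda>_. borel) (\<lambda>j \<omega>. \<Sum>i\<in>A. z i * restrict (\<lambda>k. X k \<omega>) (A \<times> {j}) (i, j)) T"
    by (rule indep_vars_compose2[where Y = "\<lambda>j f. \<Sum>i\<in>A. z i * f (i, j)"]) measurable
  then show "indep_vars (\<lambda>_. borel) (\<lambda>j \<omega>. \<Sum>i\<in>A. z i * X (i, j) \<omega>) T" by simp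
next
  fix j assume j: "j \<in> T"
  have s: "(\<Sum>k\<in>A \<times> {j}. f k) = (\<Sum>i\<in>A. f (i, j))" for f :: "_ \<Rightarrow> real"
  proof -
    have "A \<times> {j} = (\<lambda>i. (i, j)) ` A" by auto
    then show ?thesis by (simp add: sum.reindex inj_on_def)
  qed
  have "std_normal_family X (A \<times> {j})" by (rule std_normal_family_subset[OF X]) (use j in auto)
  from distr_std_normal_lincomb[OF this, of "\<lambda>k. z (fst k)"] z
  show "distr M borel (\<lambda>\<omega>. \<Sum>i\<in>A. z i * X (i, j) \<omega>) = normal_measure 0 1"
    by (simp add: s)
qed (rule A)

text \<open>The integer vectors that can arise by rounding \<open>20 * sqrt n\<close> times a unit vector: rounding moves each coordinate by at
most \<open>1\<close>, hence the vector by at most \<open>sqrt n\<close> in the Euclidean and \<open>n\<close> in the \<open>l1\<close>-norm.\<close>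

definition int_net :: "nat \<Rightarrow> (nat \<Rightarrow> int) set" where
  "int_net n = {k \<in> {1..n} \<rightarrow>\<^sub>E {- int (21 * n)..int (21 * n)}.
     (\<Sum>i=1..n. \<bar>k i\<bar>) \<le> 21 * int n \<and> 361 * int n \<le> (\<Sum>i=1..n. (k i)\<^sup>2)}"

lemma finite_int_net: "finite (int_net n)"
  unfolding int_net_def
  by (rule finite_subset[of _ "{1..n} \<rightarrow>\<^sub>E {- int (21 * n)..int (21 * n)}"]) (auto intro!: finite_PiE)

lemma sum_geometric_abs_int_le:
  fixes q :: real
  assumes "0 < q" "q < 1"
  shows "(\<Sum>k\<in>{- int L..int L}. q ^ nat \<bar>k\<bar>) \<le> 1 + 2 * (q / (1 - q))"
proof -
  have eq: "(\<Sum>k\<in>{- int L..int L}. q ^ nat \<bar>k\<bar>) = 1 + 2 * (\<Sum>k<L. q ^ Suc k)" for L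
  proof (induction L)
    case (Suc L)
    have "{- int (Suc L)..int (Suc L)} = insert (- int (Suc L)) (insert (int (Suc L)) {- int L..int L})"
      by auto
    then show ?case using Suc by (simp add: nat_add_distrib)
  qed simp
  have "(\<Sum>k<L. q ^ Suc k) = q * (\<Sum>k<L. q ^ k)" by (simp add: sum_distrib_left)
  also have "\<dots> \<le> q * (1 / (1 - q))"
  proof (rule mult_left_mono)
    have "(\<Sum>k<L. q ^ k) = (1 - q ^ L) / (1 - q)" using assms by (simp add: sum_gp_strict)
    also have "\<dots> \<le> 1 / (1 - q)" using assms by (intro divide_right_mono) auto
    finally show "(\<Sum>k<L. q ^ k) \<le> 1 / (1 - q)" .
  qed (use assms in simp)
  finally show ?thesis by (simp add: eq)
qed

text \<open>Give each integer vector \<open>k\<close> the weight \<open>exp (- s / 21)\<close>, where \<open>s\<close> is its \<open>l1\<close>-norm. Members of the net have weight at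
least \<open>exp (- n)\<close>, and the total weight is a product of one-dimensional geometric sums, each at most \<open>43\<close>.\<close>

lemma card_int_net_le: "real (card (int_net n)) \<le> (43 * exp 1) ^ n"
proof -
  define q :: real where "q = exp (- 1 / 21)"
  have q: "0 < q" "q < 1" by (auto simp: q_def)
  let ?B = "{- int (21 * n)..int (21 * n)}"
  have "q / (1 - q) \<le> 21"
  proof -
    have "1 + 1 / 21 \<le> exp (1 / 21 :: real)" by (rule exp_ge_add_one_self)
    then have "q * (1 + 1 / 21) \<le> q * exp (1 / 21)" using q by (intro mult_left_mono) auto
    also have "\<dots> = 1" by (simp add: q_def exp_add[symmetric])
    finally show ?thesis using q by (simp add: field_simps)
  qed
  then have one: "(\<Sum>k\<in>?B. q ^ nat \<bar>k\<bar>) \<le> 43"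
    using sum_geometric_abs_int_le[OF q, of "21 * n"] by linarith
  have "real (card (int_net n)) = (\<Sum>k\<in>int_net n. 1)" by simp
  also have "\<dots> \<le> (\<Sum>k\<in>int_net n. exp 1 ^ n * (\<Prod>i=1..n. q ^ nat \<bar>k i\<bar>))"
  proof (rule sum_mono)
    fix k assume "k \<in> int_net n"
    then have "(\<Sum>i=1..n. \<bar>k i\<bar>) \<le> 21 * int n" by (simp add: int_net_def)
    then have "real_of_int (\<Sum>i=1..n. \<bar>k i\<bar>) \<le> real_of_int (21 * int n)" by (rule of_int_le_iff[THEN iffD2])
    then have le: "(\<Sum>i=1..n. \<bar>real_of_int (k i)\<bar>) / 21 \<le> real n" by simp
    have qk: "q ^ nat \<bar>j\<bar> = exp (- \<bar>real_of_int j\<bar> / 21)" for j :: int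
      by (simp add: q_def exp_of_nat_mult[symmetric])
    have "(\<Prod>i=1..n. q ^ nat \<bar>k i\<bar>) = exp (\<Sum>i=1..n. - \<bar>real_of_int (k i)\<bar> / 21)"
      by (simp add: qk exp_sum)
    also have "(\<Sum>i=1..n. - \<bar>real_of_int (k i)\<bar> / 21) = - ((\<Sum>i=1..n. \<bar>real_of_int (k i)\<bar>) / 21)"
      by (simp add: sum_divide_distrib sum_negf)
    finally have P: "(\<Prod>i=1..n. q ^ nat \<bar>k i\<bar>) = exp (- ((\<Sum>i=1..n. \<bar>real_of_int (k i)\<bar>) / 21))" .
    have E: "exp 1 ^ n = exp (real n)" by (simp add: exp_of_nat_mult[symmetric])
    have "exp 1 ^ n * (\<Prod>i=1..n. q ^ nat \<bar>k i\<bar>) = exp (real n - (\<Sum>i=1..n. \<bar>real_of_int (k i)\<bar>) / 21)"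
      unfolding P E exp_add[symmetric] by simp
    then show "1 \<le> exp 1 ^ n * (\<Prod>i=1..n. q ^ nat \<bar>k i\<bar>)" using le by simp
  qed
  also have "\<dots> \<le> (\<Sum>k\<in>{1..n} \<rightarrow>\<^sub>E ?B. exp 1 ^ n * (\<Prod>i=1..n. q ^ nat \<bar>k i\<bar>))"
    by (rule sum_mono2) (use q in \<open>auto simp: int_net_def intro!: finite_PiE prod_nonneg mult_nonneg_nonneg\<close>)
  also have "\<dots> = exp 1 ^ n * (\<Prod>i=1..n. \<Sum>k\<in>?B. q ^ nat \<bar>k\<bar>)"
    by (subst prod_sum_PiE) (simp_all add: sum_distrib_left)
  also have "\<dots> \<le> exp 1 ^ n * 43 ^ n"
    using one q by (intro mult_left_mono) (auto intro!: power_mono sum_nonneg)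
  finally show ?thesis by (simp add: power_mult_distrib mult.commute)
qed

text \<open>Round \<open>20 * sqrt n\<close> times \<open>z\<close> to a member of the net by \<open>balanced_rounding\<close>. If there are \<open>N\<close> columns, the combination with
the rounded coefficients has norm at least \<open>1.9 * sqrt (n * N)\<close>, and the rounding error is at most half the Frobenius
norm, \<open>0.55 * sqrt (n * N)\<close>; balanced rounding puts the Frobenius norm
in the place of the operator norm. The difference \<open>1.35 * sqrt (n * N)\<close>, divided by \<open>20 * sqrt n\<close>, exceeds \<open>sqrt N / 16\<close>.\<close>

lemma least_singular_value_of_net:
  fixes x :: "nat \<Rightarrow> 't::finite \<Rightarrow> real"
  assumes n: "1 \<le> n"
    and net: "\<And>k. k \<in> int_net n \<Longrightarrow>
      real (card T) / 100 * (\<Sum>i=1..n. (real_of_int (k i))\<^sup>2) \<le> (\<Sum>j\<in>T. (\<Sum>i=1..n. k i * x i j)\<^sup>2)"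
    and frob: "(\<Sum>i=1..n. \<Sum>j\<in>T. (x i j)\<^sup>2) \<le> 121 / 100 * (real n * card T)"
    and z: "(\<Sum>i=1..n. (z i)\<^sup>2) = 1"
  shows "real (card T) / 256 \<le> (\<Sum>j\<in>T. (\<Sum>i=1..n. z i * x i j)\<^sup>2)"
proof -
  define w where "w i = 20 * sqrt n * z i" for i
  define row where "row i = (\<chi> j. if j \<in> T then x i j else 0)" for i
  define comb where "comb f = (\<Sum>i=1..n. f i *\<^sub>R row i)" for f :: "nat \<Rightarrow> real"
  have nrm: "(norm (\<chi> j. if j \<in> T then f j else 0))\<^sup>2 = (\<Sum>j\<in>T. (f j)\<^sup>2)" for f :: "'t \<Rightarrow> real"
    by (simp add: norm_vec_def L2_set_def sum_nonneg if_distrib[of "\<lambda>x. x\<^sup>2"] sum.If_cases cong: if_cong)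
  have comb: "(norm (comb f))\<^sup>2 = (\<Sum>j\<in>T. (\<Sum>i=1..n. f i * x i j)\<^sup>2)" for f
  proof -
    have "comb f = (\<chi> j. if j \<in> T then \<Sum>i=1..n. f i * x i j else 0)"
      by (simp add: comb_def row_def vec_eq_iff)
    then show ?thesis by (simp only: nrm)
  qed
  have w2: "(\<Sum>i=1..n. (w i)\<^sup>2) = 400 * real n"
    using z by (simp add: w_def power_mult_distrib sum_distrib_left[symmetric])
  obtain e where e: "\<forall>i\<in>{1..n}. e i = frac (w i) \<or> e i = frac (w i) - 1"
    "(norm (\<Sum>i=1..n. e i *\<^sub>R row i))\<^sup>2 \<le> (\<Sum>i=1..n. (norm (row i))\<^sup>2) / 4"
    using balanced_rounding[of "{1..n}" "\<lambda>i. frac (w i)" row] by (auto simp: frac_ge_0 less_imp_le[OF frac_lt_1])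
  have e1: "\<bar>e i\<bar> \<le> 1" if "i \<in> {1..n}" for i
    using e(1) that frac_ge_0[of "w i"] frac_lt_1[of "w i"] by fastforce
  define k where "k = (\<lambda>i\<in>{1..n}. \<lfloor>w i - e i\<rfloor>)"
  have k: "real_of_int (k i) = w i - e i" if "i \<in> {1..n}" for i
  proof -
    have "w i - e i = of_int \<lfloor>w i\<rfloor> \<or> w i - e i = of_int (\<lfloor>w i\<rfloor> + 1)"
    proof -
      have "e i = frac (w i) \<or> e i = frac (w i) - 1" using e(1) that by blast
      then show ?thesis by (auto simp: frac_def)
    qed
    then obtain j where "w i - e i = of_int j" by blast
    then show ?thesis using that by (simp add: k_def)
  qed
  have l2w: "L2_set w {1..n} = 20 * sqrt n"
  proof -
    have "sqrt (20\<^sup>2 * real n) = 20 * sqrt n" by (simp only: real_sqrt_mult real_sqrt_abs abs_numeral)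
    then show ?thesis unfolding L2_set_def w2 by simp
  qed
  have l2e: "L2_set e {1..n} \<le> sqrt n"
  proof -
    have "(\<Sum>i=1..n. (e i)\<^sup>2) \<le> (\<Sum>i=1..n. 1)"
      by (rule sum_mono) (use e1 in \<open>auto simp: abs_square_le_1\<close>)
    then show ?thesis by (simp add: L2_set_def)
  qed
  have l2k: "19 * sqrt n \<le> L2_set k {1..n}"
  proof -
    have "L2_set w {1..n} = L2_set (\<lambda>i. k i + e i) {1..n}"
      by (rule L2_set_cong) (auto simp: k)
    also have "\<dots> \<le> L2_set k {1..n} + L2_set e {1..n}" by (rule L2_set_triangle_ineq)
    finally show ?thesis using l2w l2e by simp
  qed
  have k2: "361 * real n \<le> (\<Sum>i=1..n. (real_of_int (k i))\<^sup>2)"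
  proof -
    have "(19 * sqrt n)\<^sup>2 \<le> (L2_set k {1..n})\<^sup>2" by (rule power_mono[OF l2k]) simp
    then show ?thesis by (simp add: L2_set_def sum_nonneg power_mult_distrib)
  qed
  have k1: "(\<Sum>i=1..n. \<bar>real_of_int (k i)\<bar>) \<le> 21 * real n"
  proof -
    have "(\<Sum>i=1..n. \<bar>w i\<bar> * \<bar>1\<bar>) \<le> L2_set w {1..n} * L2_set (\<lambda>_. 1) {1..n}"
      by (rule L2_set_mult_ineq)
    also have "L2_set (\<lambda>_. 1) {1..n} = sqrt n" by (simp add: L2_set_def)
    also have "L2_set w {1..n} * sqrt n = 20 * real n" unfolding l2w by simp
    finally have "(\<Sum>i=1..n. \<bar>w i\<bar>) \<le> 20 * real n" by simp
    moreover have "(\<Sum>i=1..n. \<bar>real_of_int (k i)\<bar>) \<le> (\<Sum>i=1..n. \<bar>w i\<bar> + 1)"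
      by (rule sum_mono) (use e1 k in \<open>force simp: abs_le_iff\<close>)
    ultimately show ?thesis by (simp add: sum.distrib)
  qed
  have "k \<in> int_net n"
  proof -
    have i1: "(\<Sum>i=1..n. \<bar>k i\<bar>) \<le> 21 * int n"
    proof -
      have "real_of_int (\<Sum>i=1..n. \<bar>k i\<bar>) \<le> real_of_int (21 * int n)" using k1 by simp
      then show ?thesis by (simp only: of_int_le_iff)
    qed
    have i2: "361 * int n \<le> (\<Sum>i=1..n. (k i)\<^sup>2)"
    proof -
      have "real_of_int (361 * int n) \<le> real_of_int (\<Sum>i=1..n. (k i)\<^sup>2)" using k2 by simp
      then show ?thesis by (simp only: of_int_le_iff)
    qed
    have "\<bar>k i\<bar> \<le> 21 * int n" if "i \<in> {1..n}" for i
      using member_le_sum[of i "{1..n}" "\<lambda>i. \<bar>k i\<bar>"] that i1 by auto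
    then show ?thesis
      using i1 i2 by (force simp: int_net_def PiE_def k_def abs_le_iff)
  qed
  define N where "N = real (card T)"
  have low: "19 / 10 * sqrt (n * N) \<le> norm (comb k)"
  proof (rule power2_le_imp_le)
    have "(19 / 10 * sqrt (n * N))\<^sup>2 = N / 100 * (361 * real n)"
      by (simp add: power_mult_distrib power_divide N_def)
    also have "\<dots> \<le> N / 100 * (\<Sum>i=1..n. (real_of_int (k i))\<^sup>2)"
      by (rule mult_left_mono[OF k2]) (simp add: N_def)
    also have "\<dots> \<le> (norm (comb k))\<^sup>2"
      using net[OF \<open>k \<in> int_net n\<close>] by (simp add: comb N_def)
    finally show "(19 / 10 * sqrt (n * N))\<^sup>2 \<le> (norm (comb k))\<^sup>2" .
  qed simp
  have err: "norm (comb e) \<le> 11 / 20 * sqrt (n * N)"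
  proof (rule power2_le_imp_le)
    have "(norm (comb e))\<^sup>2 \<le> (\<Sum>i=1..n. (norm (row i))\<^sup>2) / 4" using e(2) by (simp add: comb_def)
    also have "\<dots> \<le> 121 / 100 * (real n * N) / 4"
      using frob by (simp add: row_def nrm N_def)
    also have "\<dots> = (11 / 20 * sqrt (n * N))\<^sup>2"
      by (simp add: power_mult_distrib power_divide N_def)
    finally show "(norm (comb e))\<^sup>2 \<le> (11 / 20 * sqrt (n * N))\<^sup>2" .
  qed (simp add: N_def)
  have "comb w = comb k + comb e"
    unfolding comb_def sum.distrib[symmetric]
    by (intro sum.cong) (auto simp: k scaleR_left_distrib[symmetric])
  then have "norm (comb k) \<le> norm (comb w) + norm (comb e)"
    by (metis add_diff_cancel_right' norm_triangle_ineq4)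
  then have "135 / 100 * sqrt (n * N) \<le> norm (comb w)" using low err by linarith
  also have "comb w = (20 * sqrt n) *\<^sub>R comb z"
    by (simp add: comb_def w_def scaleR_sum_right)
  finally have "sqrt n * (135 / 100 * sqrt N) \<le> sqrt n * (20 * norm (comb z))"
    by (simp add: real_sqrt_mult algebra_simps)
  then have "135 / 100 * sqrt N \<le> 20 * norm (comb z)" using n by simp
  then have "sqrt N / 16 \<le> norm (comb z)"
  proof -
    have "0 \<le> sqrt N" by (simp add: N_def)
    then show ?thesis using \<open>135 / 100 * sqrt N \<le> 20 * norm (comb z)\<close> by linarith
  qed
  then have "(sqrt N / 16)\<^sup>2 \<le> (norm (comb z))\<^sup>2" by (rule power_mono) (simp add: N_def)
  then show ?thesis by (simp add: comb power_divide N_def)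
qed

text \<open>In the cube of the left side, each unit of \<open>n\<close> accounts for a factor of at most
\<open>(43 * exp 1) ^ 3 * (exp 1 / 101) ^ 4 \<le> 9 / 10\<close>.\<close>

lemma net_probability_bound:
  assumes "132 * 9 \<le> n" "8 * n \<le> 3 * N"
  shows "(43 * exp 1) ^ n * sqrt (exp 1 / 101) ^ N \<le> 1 / 5"
proof -
  define q where "q = sqrt (exp 1 / 101 :: real)"
  define x where "x = (43 * exp 1) ^ n * q ^ N"
  have e: "exp 1 < (272 / 100 :: real)" using e_less_272 by simp
  have q: "0 \<le> q" "q \<le> 1" using e by (auto simp: q_def)
  \<comment> \<open>cubing turns the hypothesis on \<open>N\<close> into the integer exponent \<open>8 * n\<close>\<close>
  have "x ^ 3 = ((43 * exp 1) ^ 3) ^ n * q ^ (3 * N)"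
    by (simp only: x_def power_mult_distrib power_mult[symmetric] mult.commute)
  also have "\<dots> \<le> ((43 * exp 1) ^ 3) ^ n * q ^ (8 * n)"
    using q assms(2) by (intro mult_left_mono power_decreasing) auto
  also have "\<dots> = ((43 * exp 1) ^ 3 * (q\<^sup>2) ^ 4) ^ n"
    by (simp only: power_mult_distrib power_mult[symmetric]) simp
  also have "q\<^sup>2 = exp 1 / 101" by (simp add: q_def)
  also have "((43 * exp 1) ^ 3 * (exp 1 / 101) ^ 4) ^ n \<le> (9 / 10 :: real) ^ n"
  proof (rule power_mono)
    have "(43 * exp 1) ^ 3 * (exp 1 / 101) ^ 4 \<le> (43 * (272 / 100)) ^ 3 * ((272 / 100) / 101 :: real) ^ 4"
      using e by (intro mult_mono power_mono divide_right_mono mult_left_mono) auto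
    also have "\<dots> \<le> 9 / 10" by (simp add: power_divide)
    finally show "(43 * exp 1) ^ 3 * (exp 1 / 101) ^ 4 \<le> (9 / 10 :: real)" .
  qed simp
  also have "\<dots> \<le> 1 / (1 + real n / 9)"
  proof -
    have "1 + real n * (1 / 9) \<le> (1 + 1 / 9) ^ n" by (rule Bernoulli_inequality) simp
    then have "(9 / 10 :: real) ^ n * (1 + real n / 9) \<le> (9 / 10) ^ n * (10 / 9) ^ n"
      by (intro mult_left_mono) auto
    also have "\<dots> = 1" by (simp add: power_mult_distrib[symmetric])
    finally show ?thesis by (simp add: field_simps)
  qed
  also have "\<dots> \<le> (1 / 5) ^ 3" using assms(1) by (simp add: field_simps)
  finally have "x ^ 3 \<le> (1 / 5) ^ 3" .
  then show ?thesis
    using power_mono_iff[of x "1 / 5" 3] q by (simp add: x_def q_def)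
qed

text \<open>Union bound over the net with the lower chi-square tail; the combinations are normalized by the length of \<open>k\<close>.\<close>

lemma (in prob_space) least_singular_value_prob:
  fixes X :: "nat \<times> 't \<Rightarrow> 'a \<Rightarrow> real"
  assumes X: "std_normal_family X ({1..n} \<times> T)" and T: "finite T"
    and n: "132 * 9 \<le> n" and N: "8 * n \<le> 3 * card T"
  shows "prob {\<omega> \<in> space M. \<exists>k\<in>int_net n.
      (\<Sum>j\<in>T. (\<Sum>i=1..n. k i * X (i, j) \<omega>)\<^sup>2) < real (card T) / 100 * (\<Sum>i=1..n. (real_of_int (k i))\<^sup>2)}
    \<le> 1 / 5"
proof -
  let ?E = "\<lambda>k. {\<omega> \<in> space M. (\<Sum>j\<in>T. (\<Sum>i=1..n. k i * X (i, j) \<omega>)\<^sup>2)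
      < real (card T) / 100 * (\<Sum>i=1..n. (real_of_int (k i))\<^sup>2)}"
  have [measurable]: "X (i, j) \<in> borel_measurable M" if "i \<in> {1..n}" "j \<in> T" for i j
    using std_normal_family_measurable[OF X] that by simp
  have one: "prob (?E k) \<le> sqrt (exp 1 / 101) ^ card T" if k: "k \<in> int_net n" for k
  proof -
    define s where "s = (\<Sum>i=1..n. (real_of_int (k i))\<^sup>2)"
    have s: "0 < s"
    proof -
      have "361 * int n \<le> (\<Sum>i=1..n. (k i)\<^sup>2)" using k by (simp add: int_net_def)
      then have "real_of_int (361 * int n) \<le> real_of_int (\<Sum>i=1..n. (k i)\<^sup>2)" by (simp only: of_int_le_iff)
      then show ?thesis using n by (simp add: s_def)
    qed
    define z where "z i = k i / sqrt s" for i
    have z: "(\<Sum>i=1..n. (z i)\<^sup>2) = 1"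
      using s by (simp add: z_def power_divide sum_divide_distrib[symmetric]) (simp add: s_def)
    have F: "std_normal_family (\<lambda>j \<omega>. \<Sum>i=1..n. z i * X (i, j) \<omega>) T"
      by (rule std_normal_family_columns[OF X _ T z]) simp
    have eq: "(\<Sum>j\<in>T. (\<Sum>i=1..n. z i * X (i, j) \<omega>)\<^sup>2) = (\<Sum>j\<in>T. (\<Sum>i=1..n. k i * X (i, j) \<omega>)\<^sup>2) / s" for \<omega>
      using s by (simp add: z_def sum_divide_distrib[symmetric] power_divide)
    have "prob (?E k) \<le> prob {\<omega> \<in> space M. (\<Sum>j\<in>T. (\<Sum>i=1..n. z i * X (i, j) \<omega>)\<^sup>2) \<le> card T / 100}"
      unfolding eq s_def[symmetric]
    proof (rule finite_measure_mono)
      have "f / s \<le> card T / 100" if "f < real (card T) / 100 * s" for f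
        using s that by (simp add: field_simps)
      then show "{\<omega> \<in> space M. (\<Sum>j\<in>T. (\<Sum>i=1..n. k i * X (i, j) \<omega>)\<^sup>2) < real (card T) / 100 * s}
          \<subseteq> {\<omega> \<in> space M. (\<Sum>j\<in>T. (\<Sum>i=1..n. k i * X (i, j) \<omega>)\<^sup>2) / s \<le> card T / 100}"
        by blast
    qed (use T in measurable)
    also have "\<dots> \<le> sqrt (exp 1 / 101) ^ card T" by (rule prob_sum_sq_le[OF F])
    finally show ?thesis .
  qed
  have "prob {\<omega> \<in> space M. \<exists>k\<in>int_net n. (\<Sum>j\<in>T. (\<Sum>i=1..n. k i * X (i, j) \<omega>)\<^sup>2)
      < real (card T) / 100 * (\<Sum>i=1..n. (real_of_int (k i))\<^sup>2)} = prob (\<Union>k\<in>int_net n. ?E k)"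
    by (intro arg_cong[where f = prob]) auto
  also have "\<dots> \<le> (\<Sum>k\<in>int_net n. prob (?E k))"
    using T by (intro finite_measure_subadditive_finite finite_int_net) auto
  also have "\<dots> \<le> (\<Sum>k\<in>int_net n. sqrt (exp 1 / 101) ^ card T)" by (rule sum_mono[OF one])
  also have "\<dots> = real (card (int_net n)) * sqrt (exp 1 / 101) ^ card T" by simp
  also have "\<dots> \<le> (43 * exp 1) ^ n * sqrt (exp 1 / 101) ^ card T"
    by (rule mult_right_mono[OF card_int_net_le]) simp
  also have "\<dots> \<le> 1 / 5" by (rule net_probability_bound[OF n N])
  finally show ?thesis .
qed

section \<open>Numerical estimates for the planted block\<close>

lemma le_ln_if_power_le:
  assumes "(272 / 100) ^ k \<le> x"
  shows "real k \<le> ln x"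
proof -
  have "exp (real k) = exp 1 ^ k" by (simp add: exp_of_nat_mult[symmetric])
  also have "\<dots> \<le> (272 / 100) ^ k" using e_less_272 by (intro power_mono) auto
  finally have "exp (real k) \<le> x" using assms by linarith
  then show ?thesis using ln_ge_iff[of x "real k"] exp_gt_zero[of "real k"] by linarith
qed

text \<open>Bootstrapping: \<open>n > 25600 * l\<^sup>2\<close> for \<open>l = ln (3 * n)\<close>, and each lower bound on \<open>l\<close> improves the one on \<open>n\<close>. From \<open>l \<ge> 4\<close>
follows \<open>n > 409600\<close>, hence \<open>l \<ge> 13\<close>, hence \<open>n > 4326400\<close>, hence \<open>l \<ge> 16\<close>.\<close>

lemma block_regime_size:
  assumes n: "30 \<le> n" and K: "100 \<le> K" and reg: "256 * K * (ln (3 * real n))\<^sup>2 < n"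
  shows "16 \<le> ln (3 * real n)" "4000000 \<le> n"
proof -
  define l where "l = ln (3 * real n)"
  have step: "25600 * x\<^sup>2 < real n" if "0 \<le> x" "x \<le> l" for x
  proof -
    have "x\<^sup>2 \<le> l\<^sup>2" using that by (intro power_mono)
    then have "100 * x\<^sup>2 \<le> K * l\<^sup>2" using K by (intro mult_mono) auto
    then show ?thesis using reg by (simp add: l_def)
  qed
  have "real 4 \<le> l" unfolding l_def by (rule le_ln_if_power_le) (use n in \<open>simp add: power_divide\<close>)
  then have "409600 < real n" using step[of 4] by simp
  then have "real 13 \<le> l" unfolding l_def by (intro le_ln_if_power_le) (simp add: power_divide)
  then have n13: "4326400 < real n" using step[of 13] by simp
  then show "4000000 \<le> n" by linarith
  have "real 16 \<le> l" unfolding l_def using n13 by (intro le_ln_if_power_le) (simp add: power_divide)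
  then show "16 \<le> ln (3 * real n)" by (simp add: l_def)
qed

text \<open>Here \<open>k = sqrt K\<close>, \<open>w = sqrt m\<close> is nearly \<open>3 * l * k\<close>, and \<open>t = sqrt n\<close>. In the first case \<open>s * \<alpha>\<close> is at most
\<open>0.0111\<close>, \<open>E * A2\<close> at most \<open>0.0104\<close> and the two terms with \<open>\<tau>\<close> at most \<open>0.0001\<close> each, while the right side exceeds
\<open>0.0244\<close>. In the second case the left side is of order \<open>t\<close> and the right side of order \<open>t\<^sup>2\<close>.\<close>

lemma correlation_budget:
  fixes k l w t \<kappa> \<alpha> A2 :: real
  assumes k: "10 \<le> k" and l: "16 \<le> l" and w: "298 / 100 * (l * k) \<le> w" "w \<le> 3 * (l * k)"
    and t: "2000 \<le> t"
    and cases: "(1 / 16 \<le> \<kappa> \<and> \<alpha> \<le> 8 / 10 * l + 3 / 10 \<and> A2 \<le> 11 / 10 * w + 3 / 10) \<or>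
       (t\<^sup>2 / 32 \<le> \<kappa> \<and> \<alpha> \<le> 11 / 10 * (w * t) \<and> A2 \<le> 11 / 10 * (w * t))"
  defines "s \<equiv> (2 / 5) / w" and "E \<equiv> 1 / (320 * (k * l))"
  defines "\<tau> \<equiv> 11 / 10 * (s * k\<^sup>2)"
  shows "s * (\<alpha> + \<tau>) + E * (A2 + \<tau>) < \<kappa> * (2 / 5 - w * E)"
proof -
  have lk: "160 \<le> l * k" using mult_mono[of 16 l 10 k] k l by simp
  have w0: "0 < w" using w lk by linarith
  have s0: "0 < s" using w0 by (simp add: s_def)
  have E0: "0 < E" using k l by (simp add: E_def)
  have wE: "w * E \<le> 3 / 320"
  proof -
    have "w * E \<le> 3 * (l * k) * E" using w(2) E0 by (intro mult_right_mono) auto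
    also have "\<dots> = 3 / 320" using k l by (simp add: E_def)
    finally show ?thesis .
  qed
  have kw: "k / w \<le> 1 / (298 / 100 * l)"
  proof -
    have "k * (298 / 100 * l) \<le> w" using w(1) by (simp add: mult_ac)
    then show ?thesis using w0 l by (simp add: field_simps)
  qed
  have kw': "k / w \<le> 1 / 47"
  proof -
    have "1 / (298 / 100 * l) \<le> 1 / 47" using l by (intro divide_left_mono) auto
    then show ?thesis using kw by linarith
  qed
  have s\<tau>: "s * \<tau> \<le> 1 / 10000"
  proof -
    have "s * \<tau> = 176 / 1000 * (k / w)\<^sup>2"
      by (simp add: s_def \<tau>_def power2_eq_square)
    also have "\<dots> \<le> 176 / 1000 * (1 / 47)\<^sup>2"
      using kw' w0 k by (intro mult_left_mono power_mono) auto
    finally show ?thesis by (simp add: power_divide)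
  qed
  have E\<tau>: "E * \<tau> \<le> 1 / 10000"
  proof -
    have "E * \<tau> = 44 / 32000 * (k / w) * (1 / l)"
      using k by (simp add: s_def \<tau>_def E_def power2_eq_square)
    also have "\<dots> \<le> 44 / 32000 * (1 / 47) * 1"
      using kw' w0 k l by (intro mult_mono) auto
    finally show ?thesis by simp
  qed
  have c: "39 / 100 \<le> 2 / 5 - w * E" using wE by simp
  from cases show ?thesis
  proof
    assume a: "1 / 16 \<le> \<kappa> \<and> \<alpha> \<le> 8 / 10 * l + 3 / 10 \<and> A2 \<le> 11 / 10 * w + 3 / 10"
    have "s * \<alpha> \<le> s * (82 / 100 * l)" using a l s0 by (intro mult_left_mono) auto
    also have "\<dots> = 328 / 1000 * (l / w)" by (simp add: s_def)
    also have "\<dots> \<le> 328 / 1000 * (10 / 298)"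
    proof (rule mult_left_mono)
      have "l * 10 \<le> l * k" using k l by (intro mult_left_mono) auto
      then have "298 / 10 * l \<le> w" using w(1) by linarith
      then show "l / w \<le> 10 / 298" using w0 by (simp add: field_simps)
    qed simp
    finally have 1: "s * \<alpha> \<le> 111 / 10000" by simp
    have "E * A2 \<le> E * (11 / 10 * w + 3 / 10)" using a E0 by (intro mult_left_mono) auto
    also have "\<dots> = 11 / 10 * (w * E) + 3 / 10 * E" by (simp add: algebra_simps)
    finally have "E * A2 \<le> 11 / 10 * (w * E) + 3 / 10 * E" .
    moreover have "E \<le> 1 / 10000" using lk by (simp add: E_def field_simps)
    ultimately have 2: "E * A2 \<le> 104 / 10000" using wE by linarith
    have "1 / 16 * (2 / 5 - 3 / 320) \<le> \<kappa> * (2 / 5 - w * E)"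
      using a wE by (intro mult_mono) auto
    then have 3: "244 / 10000 < \<kappa> * (2 / 5 - w * E)" by simp
    show ?thesis using 1 2 3 s\<tau> E\<tau> unfolding distrib_left by linarith
  next
    assume a: "t\<^sup>2 / 32 \<le> \<kappa> \<and> \<alpha> \<le> 11 / 10 * (w * t) \<and> A2 \<le> 11 / 10 * (w * t)"
    have "s * \<alpha> \<le> s * (11 / 10 * (w * t))" using a s0 by (intro mult_left_mono) auto
    also have "\<dots> = 44 / 100 * t" using w0 by (simp add: s_def)
    finally have 1: "s * \<alpha> \<le> 44 / 100 * t" .
    have "E * A2 \<le> E * (11 / 10 * (w * t))" using a E0 by (intro mult_left_mono) auto
    also have "\<dots> = (w * E) * (11 / 10 * t)" by (simp add: algebra_simps)
    also have "\<dots> \<le> 3 / 320 * (11 / 10 * t)" using wE t by (intro mult_right_mono) auto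
    finally have 2: "E * A2 \<le> 2 / 100 * t" using t by simp
    have "t\<^sup>2 / 32 * (39 / 100) \<le> \<kappa> * (2 / 5 - w * E)"
    proof (rule mult_mono)
      show "0 \<le> \<kappa>" using a zero_le_power2[of t] by linarith
    qed (use a c in auto)
    moreover have "2000 * t \<le> t\<^sup>2" using t by (simp add: power2_eq_square mult_right_mono)
    ultimately have 3: "20 * t \<le> \<kappa> * (2 / 5 - w * E)" using t by simp
    show ?thesis using 1 2 3 s\<tau> E\<tau> t unfolding distrib_left by linarith
  qed
qed

lemma exp_neg_le_inverse: "0 \<le> (x::real) \<Longrightarrow> exp (- x) \<le> 1 / (1 + x)"
  using exp_ge_add_one_self[of x] by (simp add: exp_minus field_simps)

lemma (in prob_space) prob_inter_ge:
  assumes "A \<in> events" "B \<in> events" "1 - a \<le> prob A" "1 - b \<le> prob B"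
  shows "1 - (a + b) \<le> prob (A \<inter> B)"
proof -
  have "prob (A \<union> B) + prob (A \<inter> B) = prob A + prob B"
    using assms(1,2) by (simp add: finite_measure_Union' measure_Un3 finite_measure_eq_sum_singleton fmeasurable_eq_sets)
  then show ?thesis using assms(3,4) prob_le_1[of "A \<union> B"] by linarith
qed

section \<open>A finite net of residual directions and the good events\<close>

text \<open>The directions along the whole regularization path, for all budgets at once.\<close>

definition residual_dirs :: "('p::finite \<Rightarrow> 'v::real_inner) \<Rightarrow> 'v \<Rightarrow> 'p set \<Rightarrow> 'v set" where
  "residual_dirs a y F = {sgn (y - lin_pred a b) | b B. lasso_min a y F B b \<and> y - lin_pred a b \<noteq> 0}"

lemma norm_residual_dirs: "\<zeta> \<in> residual_dirs a y F \<Longrightarrow> norm \<zeta> = 1"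
  by (auto simp: residual_dirs_def norm_sgn)

text \<open>Cut the range from \<open>1 / 16\<close> to \<open>n / 32\<close> of the maximal correlation into cells of width \<open>1 / (32 * n\<^sup>2)\<close>, at most \<open>n ^ 3\<close>
in number, and keep one direction from each occupied cell. Within a cell the ratio of two correlations is at least
\<open>1 - 1 / (2 * n\<^sup>2)\<close>, so that \<open>residual_directions_close\<close> gives distance at most \<open>1 / n\<close>.\<close>

lemma residual_dirs_net:
  fixes a :: "'p::finite \<Rightarrow> 'v::real_inner"
  assumes F: "F \<noteq> {}" and n: "1 \<le> n"
    and low: "\<And>\<zeta>. \<zeta> \<in> residual_dirs a y F \<Longrightarrow> 1 / 16 \<le> max_corr a F \<zeta>"
  obtains R where "R \<subseteq> residual_dirs a y F" "finite R" "card R \<le> n ^ 3"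
    "\<And>\<zeta>. \<zeta> \<in> residual_dirs a y F \<Longrightarrow> max_corr a F \<zeta> < real n / 32 \<Longrightarrow>
       \<exists>\<zeta>'\<in>R. norm (\<zeta> - \<zeta>') \<le> 1 / n"
proof -
  let ?D = "residual_dirs a y F" and ?\<kappa> = "max_corr a F"
  \<comment> \<open>the number of the cell of width \<open>1 / (32 * n\<^sup>2)\<close> that contains the correlation\<close>
  define cell where "cell \<zeta> = nat \<lfloor>32 * (real n)\<^sup>2 * ?\<kappa> \<zeta>\<rfloor>" for \<zeta>
  define rep where "rep q = (SOME \<zeta>. \<zeta> \<in> ?D \<and> cell \<zeta> = q)" for q
  define Q where "Q = cell ` {\<zeta> \<in> ?D. ?\<kappa> \<zeta> < real n / 32}"
  have rep: "rep (cell \<zeta>) \<in> ?D \<and> cell (rep (cell \<zeta>)) = cell \<zeta>" if "\<zeta> \<in> ?D" for \<zeta>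
    unfolding rep_def by (rule someI[of "\<lambda>\<zeta>'. \<zeta>' \<in> ?D \<and> cell \<zeta>' = cell \<zeta>" \<zeta>]) (use that in simp)
  have Qsub: "Q \<subseteq> {..<n ^ 3}"
  proof
    fix q assume "q \<in> Q"
    then obtain \<zeta> where \<zeta>: "\<zeta> \<in> ?D" "?\<kappa> \<zeta> < real n / 32" "q = cell \<zeta>" by (auto simp: Q_def)
    have "32 * (real n)\<^sup>2 * ?\<kappa> \<zeta> < 32 * (real n)\<^sup>2 * (real n / 32)"
      using \<zeta>(2) n by (intro mult_strict_left_mono) auto
    also have "\<dots> = real_of_int (int (n ^ 3))" by (simp add: power2_eq_square power3_eq_cube)
    finally have "\<lfloor>32 * (real n)\<^sup>2 * ?\<kappa> \<zeta>\<rfloor> < int (n ^ 3)" by (simp only: floor_less_iff)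
    moreover have "0 < n ^ 3" using n by simp
    ultimately have "nat \<lfloor>32 * (real n)\<^sup>2 * ?\<kappa> \<zeta>\<rfloor> < n ^ 3" by linarith
    then show "q \<in> {..<n ^ 3}" by (simp only: \<zeta>(3) cell_def lessThan_iff)
  qed
  then have fin: "finite Q" by (rule finite_subset) simp
  show thesis
  proof (rule that[of "rep ` Q"])
    show "rep ` Q \<subseteq> ?D" using rep by (auto simp: Q_def)
    show "finite (rep ` Q)" using fin by simp
    have "card (rep ` Q) \<le> card Q" using fin by (rule card_image_le)
    also have "\<dots> \<le> card {..<n ^ 3}" by (rule card_mono[OF _ Qsub]) simp
    finally show "card (rep ` Q) \<le> n ^ 3" by simp
  next
    fix \<zeta> assume \<zeta>: "\<zeta> \<in> ?D" "?\<kappa> \<zeta> < real n / 32"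
    define \<zeta>' where "\<zeta>' = rep (cell \<zeta>)"
    have \<zeta>': "\<zeta>' \<in> ?D" "cell \<zeta>' = cell \<zeta>" using rep[OF \<zeta>(1)] by (auto simp: \<zeta>'_def)
    have k: "1 / 16 \<le> ?\<kappa> \<zeta>" "1 / 16 \<le> ?\<kappa> \<zeta>'" using low \<zeta>(1) \<zeta>'(1) by auto
    define h where "h = 32 * (real n)\<^sup>2"
    have h: "0 < h" using n by (simp add: h_def)
    have "\<lfloor>h * ?\<kappa> \<zeta>'\<rfloor> = \<lfloor>h * ?\<kappa> \<zeta>\<rfloor>"
      using \<zeta>'(2) k h by (simp add: cell_def h_def[symmetric] nat_eq_iff)
    then have "\<bar>h * ?\<kappa> \<zeta> - h * ?\<kappa> \<zeta>'\<bar> \<le> 1" by linarith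
    then have "h * \<bar>?\<kappa> \<zeta> - ?\<kappa> \<zeta>'\<bar> \<le> 1"
      using h by (simp add: right_diff_distrib[symmetric] abs_mult)
    then have diff: "16 * \<bar>?\<kappa> \<zeta> - ?\<kappa> \<zeta>'\<bar> \<le> 1 / (2 * (real n)\<^sup>2)"
      using n by (simp add: h_def field_simps)
    have ratio: "1 - 1 / (2 * (real n)\<^sup>2) \<le> x / y" if "1 / 16 \<le> y" "16 * \<bar>x - y\<bar> \<le> 1 / (2 * (real n)\<^sup>2)" for x y :: real
    proof -
      have "y - x \<le> 16 * y * \<bar>x - y\<bar>"
      proof -
        have "1 * \<bar>x - y\<bar> \<le> (16 * y) * \<bar>x - y\<bar>" using that(1) by (intro mult_right_mono) auto
        moreover have "y - x \<le> 1 * \<bar>x - y\<bar>" by simp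
        ultimately show ?thesis by (rule order_trans[rotated])
      qed
      also have "\<dots> = y * (16 * \<bar>x - y\<bar>)" by simp
      also have "\<dots> \<le> y * (1 / (2 * (real n)\<^sup>2))" using that by (intro mult_left_mono) auto
      finally have "y * (1 - 1 / (2 * (real n)\<^sup>2)) \<le> x" by (simp add: right_diff_distrib)
      moreover have "0 < y" using that(1) by linarith
      ultimately show ?thesis by (simp add: pos_le_divide_eq mult.commute)
    qed
    obtain b B where b: "lasso_min a y F B b" "y - lin_pred a b \<noteq> 0" "\<zeta> = sgn (y - lin_pred a b)"
      using \<zeta>(1) by (auto simp: residual_dirs_def)
    obtain b' B' where b': "lasso_min a y F B' b'" "y - lin_pred a b' \<noteq> 0" "\<zeta>' = sgn (y - lin_pred a b')"
      using \<zeta>'(1) by (auto simp: residual_dirs_def)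
    have "min (?\<kappa> \<zeta> / ?\<kappa> \<zeta>') (?\<kappa> \<zeta>' / ?\<kappa> \<zeta>) \<le> \<zeta> \<bullet> \<zeta>'"
      unfolding b(3) b'(3)
      by (rule residual_directions_close[OF b(1) b'(1) F b(2) b'(2)]) (use k b(3) b'(3) in auto)
    moreover have "1 - 1 / (2 * (real n)\<^sup>2) \<le> ?\<kappa> \<zeta> / ?\<kappa> \<zeta>'" "1 - 1 / (2 * (real n)\<^sup>2) \<le> ?\<kappa> \<zeta>' / ?\<kappa> \<zeta>"
      using ratio[of "?\<kappa> \<zeta>'" "?\<kappa> \<zeta>"] ratio[of "?\<kappa> \<zeta>" "?\<kappa> \<zeta>'"] k diff by (auto simp: abs_minus_commute)
    ultimately have ip: "1 - 1 / (2 * (real n)\<^sup>2) \<le> \<zeta> \<bullet> \<zeta>'" by linarith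
    have "(norm (\<zeta> - \<zeta>'))\<^sup>2 = (norm \<zeta>)\<^sup>2 + (norm \<zeta>')\<^sup>2 - 2 * (\<zeta> \<bullet> \<zeta>')"
      by (simp add: power2_norm_eq_inner inner_diff_left inner_diff_right inner_commute)
    also have "\<dots> = 2 - 2 * (\<zeta> \<bullet> \<zeta>')"
      using norm_residual_dirs[OF \<zeta>(1)] norm_residual_dirs[OF \<zeta>'(1)] by simp
    also have "\<dots> \<le> (1 / n)\<^sup>2" using ip by (simp add: power_divide)
    finally have "norm (\<zeta> - \<zeta>') \<le> 1 / n" by (rule power2_le_imp_le) simp
    moreover have "\<zeta>' \<in> rep ` Q" using \<zeta> by (auto simp: \<zeta>'_def Q_def)
    ultimately show "\<exists>\<zeta>'\<in>rep ` Q. norm (\<zeta> - \<zeta>') \<le> 1 / n" by blast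
  qed
qed

text \<open>What is needed from the coordinates outside the block: the hypotheses of \<open>least_singular_value_of_net\<close> for the columns
in \<open>T\<close>, and a norm bound for the noise column \<open>z\<close>.\<close>

definition rest_good :: "nat \<Rightarrow> 't set \<Rightarrow> 't \<Rightarrow> (nat \<times> 't \<Rightarrow> real) \<Rightarrow> bool" where
  "rest_good n T z \<omega> \<longleftrightarrow>
     (\<forall>k\<in>int_net n. real (card T) / 100 * (\<Sum>i=1..n. (real_of_int (k i))\<^sup>2)
        \<le> (\<Sum>j\<in>T. (\<Sum>i=1..n. real_of_int (k i) * \<omega> (i, j))\<^sup>2)) \<and>
     (\<Sum>i=1..n. \<Sum>j\<in>T. (\<omega> (i, j))\<^sup>2) \<le> 121 / 100 * (real n * card T) \<and>
     (\<Sum>i=1..n. (\<omega> (i, z))\<^sup>2) \<le> 121 / 100 * real n"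

text \<open>What is needed from the block \<open>T\<close>, where \<open>R\<close> is a finite set of unit vectors that depends on the other coordinates only.
The first condition serves the directions that \<open>R\<close> does not approximate, and the passage from \<open>R\<close> to its neighbours.\<close>

definition block_good :: "nat \<Rightarrow> 't set \<Rightarrow> real \<Rightarrow> (nat \<Rightarrow> real) set \<Rightarrow> (nat \<times> 't \<Rightarrow> real) \<Rightarrow> bool" where
  "block_good n T l R \<omega> \<longleftrightarrow>
     (\<Sum>i=1..n. \<Sum>j\<in>T. (\<omega> (i, j))\<^sup>2) \<le> 121 / 100 * (real n * card T) \<and>
     (\<forall>f\<in>R. (\<Sum>j\<in>T. (\<Sum>i=1..n. f i * \<omega> (i, j))\<^sup>2) \<le> 121 / 100 * card T \<and>
        \<bar>\<Sum>j\<in>T. \<Sum>i=1..n. f i * \<omega> (i, j)\<bar> / sqrt (card T) \<le> 8 / 10 * l)"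

lemma (in prob_space) prob_sum_sq_le_ge:
  assumes X: "std_normal_family X I" and le: "exp (- 9 / 1000 * card I) \<le> e"
  shows "1 - e \<le> prob {\<omega> \<in> space M. (\<Sum>i\<in>I. (X i \<omega>)\<^sup>2) \<le> 121 / 100 * card I}"
proof -
  have ms: "(\<lambda>\<omega>. \<Sum>i\<in>I. (X i \<omega>)\<^sup>2) \<in> borel_measurable M"
    by (intro borel_measurable_sum borel_measurable_power std_normal_family_measurable[OF X])
  have ev: "{\<omega> \<in> space M. (\<Sum>i\<in>I. (X i \<omega>)\<^sup>2) \<le> 121 / 100 * card I} \<in> events"
    by (rule borel_measurable_le[OF ms borel_measurable_const])
  have "1 - prob {\<omega> \<in> space M. (\<Sum>i\<in>I. (X i \<omega>)\<^sup>2) \<le> 121 / 100 * card I}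
      = prob {\<omega> \<in> space M. \<not> (\<Sum>i\<in>I. (X i \<omega>)\<^sup>2) \<le> 121 / 100 * card I}"
    by (rule prob_neg[OF ev, symmetric])
  also have "\<dots> \<le> prob {\<omega> \<in> space M. 121 / 100 * card I \<le> (\<Sum>i\<in>I. (X i \<omega>)\<^sup>2)}"
  proof (rule finite_measure_mono)
    show "{\<omega> \<in> space M. 121 / 100 * card I \<le> (\<Sum>i\<in>I. (X i \<omega>)\<^sup>2)} \<in> events"
      by (rule borel_measurable_le[OF borel_measurable_const ms])
  qed auto
  also have "\<dots> \<le> e" using prob_sum_sq_ge[OF X] le by linarith
  finally show ?thesis by linarith
qed

lemma sum_times_atLeastAtMost:
  fixes f :: "nat \<times> 't \<Rightarrow> real"
  shows "(\<Sum>p\<in>{1..n} \<times> T. f p) = (\<Sum>i=1..n. \<Sum>j\<in>T. f (i, j))"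
  by (simp add: sum.cartesian_product)

text \<open>The failure probabilities are at most \<open>1 / 5\<close> for the net and \<open>1 / 30\<close> for each of the norm bounds.\<close>

lemma rest_good_prob:
  fixes T :: "'t set"
  assumes I: "finite I" "{1..n} \<times> insert z T \<subseteq> I" and n: "4000000 \<le> n" and T: "finite T" "8 * n \<le> 3 * card T"
  shows "{\<omega> \<in> space (gauss_array I). rest_good n T z \<omega>} \<in> sets (gauss_array I)"
    and "7 / 10 \<le> measure (gauss_array I) {\<omega> \<in> space (gauss_array I). rest_good n T z \<omega>}"
proof -
  interpret prob_space "gauss_array I" by (rule prob_space_gauss_array)
  have F: "std_normal_family (\<lambda>p \<omega>. \<omega> p) I" by (rule std_normal_family_gauss_array[OF I(1)])
  have FT: "std_normal_family (\<lambda>p \<omega>. \<omega> p) ({1..n} \<times> T)"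
    by (rule std_normal_family_subset[OF F]) (use I in auto)
  have Fz: "std_normal_family (\<lambda>p \<omega>. \<omega> p) ({1..n} \<times> {z})"
    by (rule std_normal_family_subset[OF F]) (use I in auto)
  have [measurable]: "(\<lambda>\<omega>. \<omega> (i, j)) \<in> borel_measurable (gauss_array I)" if "i \<in> {1..n}" "j \<in> insert z T" for i j
  proof (rule std_normal_family_measurable[OF F])
    have "(i, j) \<in> {1..n} \<times> insert z T" using that by (rule SigmaI)
    then show "(i, j) \<in> I" by (rule subsetD[OF I(2)])
  qed
  let ?A = "{\<omega> \<in> space (gauss_array I). \<forall>k\<in>int_net n. real (card T) / 100 * (\<Sum>i=1..n. (real_of_int (k i))\<^sup>2)
        \<le> (\<Sum>j\<in>T. (\<Sum>i=1..n. real_of_int (k i) * \<omega> (i, j))\<^sup>2)}"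
  let ?B = "{\<omega> \<in> space (gauss_array I). (\<Sum>p\<in>{1..n} \<times> T. (\<omega> p)\<^sup>2) \<le> 121 / 100 * card ({1..n} \<times> T)}"
  let ?C = "{\<omega> \<in> space (gauss_array I). (\<Sum>p\<in>{1..n} \<times> {z}. (\<omega> p)\<^sup>2) \<le> 121 / 100 * card ({1..n} \<times> {z})}"
  have mA: "?A \<in> events" using T finite_int_net by measurable
  have mB: "?B \<in> events"
    by (intro borel_measurable_le borel_measurable_sum borel_measurable_power borel_measurable_const
      std_normal_family_measurable[OF FT])
  have mC: "?C \<in> events"
    by (intro borel_measurable_le borel_measurable_sum borel_measurable_power borel_measurable_const
      std_normal_family_measurable[OF Fz])
  have eq: "{\<omega> \<in> space (gauss_array I). rest_good n T z \<omega>} = (?A \<inter> ?B) \<inter> ?C"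
    unfolding rest_good_def sum_times_atLeastAtMost by (auto simp: card_cartesian_product)
  show "{\<omega> \<in> space (gauss_array I). rest_good n T z \<omega>} \<in> sets (gauss_array I)"
    unfolding eq using mA mB mC by blast
  have small: "exp (- 9 / 1000 * real N) \<le> 1 / 30" if "n \<le> N" for N
  proof -
    have "exp (- (9 / 1000 * real N)) \<le> 1 / (1 + 9 / 1000 * real N)" by (rule exp_neg_le_inverse) simp
    also have "\<dots> \<le> 1 / 30" using that n by (intro divide_left_mono) auto
    finally show ?thesis by simp
  qed
  have pA: "1 - 1 / 5 \<le> prob ?A"
  proof -
    have "1 - prob ?A = prob {\<omega> \<in> space (gauss_array I). \<not> (\<forall>k\<in>int_net n. real (card T) / 100 * (\<Sum>i=1..n. (real_of_int (k i))\<^sup>2)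
        \<le> (\<Sum>j\<in>T. (\<Sum>i=1..n. real_of_int (k i) * \<omega> (i, j))\<^sup>2))}"
      by (rule prob_neg[OF mA, symmetric])
    also have "\<dots> \<le> 1 / 5"
      using least_singular_value_prob[OF FT T(1) _ T(2)] n by (simp add: not_le)
    finally show ?thesis by linarith
  qed
  have pB: "1 - 1 / 30 \<le> prob ?B"
  proof (rule prob_sum_sq_le_ge[OF FT])
    have "n * 1 \<le> n * card T" using T n by (intro mult_left_mono) auto
    then show "exp (- 9 / 1000 * real (card ({1..n} \<times> T))) \<le> 1 / 30"
      by (intro small) (simp add: card_cartesian_product)
  qed
  have pC: "1 - 1 / 30 \<le> prob ?C"
    by (rule prob_sum_sq_le_ge[OF Fz]) (rule small, simp add: card_cartesian_product)
  have "1 - (1 / 5 + 1 / 30) \<le> prob (?A \<inter> ?B)" by (rule prob_inter_ge[OF mA mB pA pB])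
  from prob_inter_ge[OF _ mC this pC] mA mB
  have "1 - (1 / 5 + 1 / 30 + 1 / 30) \<le> prob ((?A \<inter> ?B) \<inter> ?C)" by blast
  then show "7 / 10 \<le> measure (gauss_array I) {\<omega> \<in> space (gauss_array I). rest_good n T z \<omega>}"
    unfolding eq by simp
qed

text \<open>For one direction the two bounds fail with total probability at most \<open>3 * exp (- 0.24 * l\<^sup>2)\<close>, where
\<open>888 * l\<^sup>2 \<le> m\<close> makes the chi-square tail as small as the normal one. Since \<open>0.24 * l\<^sup>2 \<ge> 3 * l + 13\<close> and
\<open>exp (3 * l) = 27 * n ^ 3\<close>, the union over \<open>n ^ 3\<close> directions costs less than \<open>1 / 20\<close>.\<close>

lemma block_good_prob:
  fixes T :: "'t set"
  assumes T: "finite T" and n: "4000000 \<le> n" and l: "l = ln (3 * real n)" "16 \<le> l"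
    and m: "888 * l\<^sup>2 \<le> real (card T)"
    and R: "finite R" "card R \<le> n ^ 3" "\<And>f. f \<in> R \<Longrightarrow> (\<Sum>i=1..n. (f i)\<^sup>2) = 1"
  shows "{\<omega> \<in> space (gauss_array ({1..n} \<times> T)). block_good n T l R \<omega>} \<in> sets (gauss_array ({1..n} \<times> T))"
    and "9 / 10 \<le> measure (gauss_array ({1..n} \<times> T)) {\<omega> \<in> space (gauss_array ({1..n} \<times> T)). block_good n T l R \<omega>}"
proof -
  let ?P = "gauss_array ({1..n} \<times> T)"
  interpret prob_space ?P by (rule prob_space_gauss_array)
  have F: "std_normal_family (\<lambda>p \<omega>. \<omega> p) ({1..n} \<times> T)"
    by (rule std_normal_family_gauss_array) (use T in simp)
  have [measurable]: "(\<lambda>\<omega>. \<omega> (i, j)) \<in> borel_measurable ?P" if "i \<in> {1..n}" "j \<in> T" for i j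
    by (rule std_normal_family_measurable[OF F]) (rule SigmaI[OF that])
  define M where "M = real (card T)"
  have "256 \<le> l\<^sup>2" using power_mono[OF l(2), of 2] by simp
  then have M: "0 < M" "888 * l\<^sup>2 \<le> M" "1 \<le> M" using m by (auto simp: M_def)
  define \<epsilon> where "\<epsilon> = exp (- 24 / 100 * l\<^sup>2)"
  have tail: "exp (- 9 / 1000 * M) \<le> \<epsilon>" using M(2) \<open>256 \<le> l\<^sup>2\<close> by (simp add: \<epsilon>_def)
  let ?A = "{\<omega> \<in> space ?P. (\<Sum>p\<in>{1..n} \<times> T. (\<omega> p)\<^sup>2) \<le> 121 / 100 * card ({1..n} \<times> T)}"
  let ?B1 = "\<lambda>f. {\<omega> \<in> space ?P. \<not> (\<Sum>j\<in>T. (\<Sum>i=1..n. f i * \<omega> (i, j))\<^sup>2) \<le> 121 / 100 * card T}"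
  let ?B2 = "\<lambda>f. {\<omega> \<in> space ?P. \<not> \<bar>\<Sum>j\<in>T. \<Sum>i=1..n. f i * \<omega> (i, j)\<bar> / sqrt (card T) \<le> 8 / 10 * l}"
  let ?U = "\<Union>f\<in>R. ?B1 f \<union> ?B2 f"
  have mA: "?A \<in> events"
    by (intro borel_measurable_le borel_measurable_sum borel_measurable_power borel_measurable_const
      std_normal_family_measurable[OF F])
  have mB1: "?B1 f \<in> events" for f using T by measurable
  have mB2: "?B2 f \<in> events" for f using T by measurable
  have mU: "?U \<in> events" using R(1) mB1 mB2 by blast
  have eq: "{\<omega> \<in> space ?P. block_good n T l R \<omega>} = ?A \<inter> (space ?P - ?U)"
    unfolding block_good_def sum_times_atLeastAtMost by (auto simp: card_cartesian_product)
  show "{\<omega> \<in> space ?P. block_good n T l R \<omega>} \<in> sets ?P"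
    unfolding eq using mA mU by blast
  have pA: "1 - 1 / 20 \<le> prob ?A"
  proof (rule prob_sum_sq_le_ge[OF F])
    have "real n * 1 \<le> real n * M" using M by (intro mult_left_mono) auto
    then have "4000000 \<le> real n * M" using n by linarith
    then have nM: "4000000 \<le> real (card ({1..n} \<times> T))" by (simp add: card_cartesian_product M_def)
    have "exp (- (9 / 1000 * real (card ({1..n} \<times> T)))) \<le> 1 / (1 + 9 / 1000 * real (card ({1..n} \<times> T)))"
      by (rule exp_neg_le_inverse) simp
    also have "\<dots> \<le> 1 / 20" using nM by (intro divide_left_mono) auto
    finally show "exp (- 9 / 1000 * real (card ({1..n} \<times> T))) \<le> 1 / 20" by simp
  qed
  have p1: "prob (?B1 f) \<le> \<epsilon>" if f: "f \<in> R" for f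
  proof -
    have "std_normal_family (\<lambda>j \<omega>. \<Sum>i=1..n. f i * \<omega> (i, j)) T"
      by (rule std_normal_family_columns[OF F _ T R(3)[OF f]]) simp
    from prob_sum_sq_ge[OF this]
    have "prob {\<omega> \<in> space ?P. 121 / 100 * card T \<le> (\<Sum>j\<in>T. (\<Sum>i=1..n. f i * \<omega> (i, j))\<^sup>2)} \<le> \<epsilon>"
      using tail by (simp add: M_def)
    moreover have "prob (?B1 f) \<le> prob {\<omega> \<in> space ?P. 121 / 100 * card T \<le> (\<Sum>j\<in>T. (\<Sum>i=1..n. f i * \<omega> (i, j))\<^sup>2)}"
      using T by (intro finite_measure_mono) auto
    ultimately show ?thesis by linarith
  qed
  have p2: "prob (?B2 f) \<le> 2 * \<epsilon>" if f: "f \<in> R" for f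
  proof -
    define c where "c = (\<lambda>p :: nat \<times> 't. f (fst p) / sqrt M)"
    have "(\<Sum>p\<in>{1..n} \<times> T. (c p)\<^sup>2) = (\<Sum>i=1..n. (f i)\<^sup>2)"
      unfolding sum_times_atLeastAtMost using M by (simp add: c_def power_divide M_def[symmetric])
    then have c1: "(\<Sum>p\<in>{1..n} \<times> T. (c p)\<^sup>2) = 1" using R(3)[OF f] by simp
    have lc: "(\<Sum>p\<in>{1..n} \<times> T. c p * \<omega> p) = (\<Sum>j\<in>T. \<Sum>i=1..n. f i * \<omega> (i, j)) / sqrt M" for \<omega>
      unfolding sum_times_atLeastAtMost by (subst sum.swap) (simp add: c_def sum_divide_distrib)
    have ml: "(\<lambda>\<omega>. \<Sum>p\<in>{1..n} \<times> T. c p * \<omega> p) \<in> borel_measurable ?P"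
      unfolding lc using T by measurable
    have "prob (?B2 f) \<le> prob {\<omega> \<in> space ?P. 8 / 10 * l \<le> \<bar>\<Sum>p\<in>{1..n} \<times> T. c p * \<omega> p\<bar>}"
      unfolding lc using T M by (intro finite_measure_mono) (auto simp: abs_divide M_def)
    also have "\<dots> \<le> 2 * exp (- 3 / 8 * (8 / 10 * l)\<^sup>2)"
      by (rule prob_abs_std_normal_ge[OF ml distr_std_normal_lincomb[OF F c1]]) (use l in simp)
    also have "\<dots> = 2 * \<epsilon>" by (simp add: \<epsilon>_def power_mult_distrib power_divide)
    finally show ?thesis .
  qed
  have "prob ?U \<le> (\<Sum>f\<in>R. prob (?B1 f \<union> ?B2 f))"
    using mB1 mB2 by (intro finite_measure_subadditive_finite R(1)) auto
  also have "\<dots> \<le> (\<Sum>f\<in>R. 3 * \<epsilon>)"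
  proof (rule sum_mono)
    fix f assume f: "f \<in> R"
    have "prob (?B1 f \<union> ?B2 f) \<le> prob (?B1 f) + prob (?B2 f)"
      by (rule measure_Un_le[OF mB1 mB2])
    then show "prob (?B1 f \<union> ?B2 f) \<le> 3 * \<epsilon>" using p1[OF f] p2[OF f] by linarith
  qed
  also have "\<dots> = real (card R) * (3 * \<epsilon>)" by simp
  also have "\<dots> \<le> real (n ^ 3) * (3 * \<epsilon>)"
    using R(2) by (intro mult_right_mono) (auto simp: \<epsilon>_def)
  also have "\<dots> \<le> 1 / 20"
  proof -
    have "16 * l \<le> l\<^sup>2" using l(2) by (simp add: power2_eq_square mult_right_mono)
    then have "\<epsilon> \<le> exp (- (3 * l) + - 13)" using l(2) by (simp add: \<epsilon>_def)
    also have "\<dots> = exp (- (3 * l)) * exp (- 13)" by (rule exp_add)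
    also have "exp (- (3 * l)) = 1 / (27 * real (n ^ 3))"
    proof -
      have "exp (3 * l) = exp l ^ 3" by (simp add: exp_of_nat_mult[symmetric])
      also have "exp l = 3 * real n" using n by (simp add: l(1))
      finally show ?thesis by (simp add: exp_minus power_mult_distrib inverse_eq_divide)
    qed
    also have "1 / (27 * real (n ^ 3)) * exp (- 13) \<le> 1 / (27 * real (n ^ 3)) * (1 / (1 + 13))"
      by (intro mult_left_mono exp_neg_le_inverse) auto
    finally have "\<epsilon> \<le> 1 / (27 * real (n ^ 3)) * (1 / (1 + 13))" .
    then have "real (n ^ 3) * (3 * \<epsilon>) \<le> real (n ^ 3) * (3 * (1 / (27 * real (n ^ 3)) * (1 / (1 + 13))))"
      by (intro mult_left_mono) auto
    also have "\<dots> \<le> 1 / 20" using n by simp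
    finally show ?thesis .
  qed
  finally have "1 - 1 / 20 \<le> prob (space ?P - ?U)" using prob_compl[OF mU] by linarith
  from prob_inter_ge[OF mA _ pA this] mU
  have "1 - (1 / 20 + 1 / 20) \<le> prob (?A \<inter> (space ?P - ?U))" by blast
  then show "9 / 10 \<le> prob {\<omega> \<in> space ?P. block_good n T l R \<omega>}" unfolding eq by simp
qed

text \<open>Conditioning by Fubini. The event \<open>H\<close> may depend on the coordinates in \<open>I\<close> in an arbitrary way, since only the sections
of \<open>E\<close> are measured.\<close>

lemma gauss_array_product_lower_bound:
  fixes I J :: "'i set"
  assumes fin: "finite I" "finite J" "I \<inter> J = {}"
    and E: "E \<in> sets (gauss_array (I \<union> J))" and G: "G \<in> sets (gauss_array I)" "p \<le> measure (gauss_array I) G"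
    and q: "0 \<le> q" and H: "\<And>\<omega>. \<omega> \<in> G \<Longrightarrow> \<exists>H\<in>sets (gauss_array J). q \<le> measure (gauss_array J) H \<and>
      (\<forall>\<omega>'\<in>H. merge I J (\<omega>, \<omega>') \<in> E)"
  shows "q * p \<le> measure (gauss_array (I \<union> J)) E"
proof -
  interpret PI: prob_space "gauss_array I" by (rule prob_space_gauss_array)
  interpret PJ: prob_space "gauss_array J" by (rule prob_space_gauss_array)
  interpret PU: prob_space "gauss_array (I \<union> J)" by (rule prob_space_gauss_array)
  interpret N: product_sigma_finite "\<lambda>_ :: 'i. normal_measure 0 1"
    by (simp add: product_sigma_finite_def prob_space_normal_measure prob_space_imp_sigma_finite)
  let ?PP = "gauss_array I \<Otimes>\<^sub>M gauss_array J"
  have mm: "merge I J \<in> ?PP \<rightarrow>\<^sub>M gauss_array (I \<union> J)"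
    unfolding gauss_array_def by (rule measurable_merge)
  let ?X = "merge I J -` E \<inter> space ?PP"
  have X: "?X \<in> sets ?PP" using mm E by (rule measurable_sets)
  have "emeasure (gauss_array (I \<union> J)) E = emeasure (distr ?PP (gauss_array (I \<union> J)) (merge I J)) E"
    unfolding gauss_array_def by (simp only: N.distr_merge[OF fin(3,1,2)])
  also have "\<dots> = emeasure ?PP ?X" by (rule emeasure_distr[OF mm E])
  also have "\<dots> = (\<integral>\<^sup>+\<omega>. emeasure (gauss_array J) (Pair \<omega> -` ?X) \<partial>gauss_array I)"
    by (rule PJ.emeasure_pair_measure_alt[OF X])
  also have "\<dots> \<ge> (\<integral>\<^sup>+\<omega>. ennreal q * indicator G \<omega> \<partial>gauss_array I)"
  proof (rule nn_integral_mono)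
    fix \<omega> assume \<omega>: "\<omega> \<in> space (gauss_array I)"
    show "ennreal q * indicator G \<omega> \<le> emeasure (gauss_array J) (Pair \<omega> -` ?X)"
    proof (cases "\<omega> \<in> G")
      case True
      then obtain H where H: "H \<in> sets (gauss_array J)" "q \<le> measure (gauss_array J) H"
        "\<forall>\<omega>'\<in>H. merge I J (\<omega>, \<omega>') \<in> E" using H by blast
      have "H \<subseteq> Pair \<omega> -` ?X"
        using H(3) sets.sets_into_space[OF H(1)] \<omega> by (auto simp: space_pair_measure)
      then have "emeasure (gauss_array J) H \<le> emeasure (gauss_array J) (Pair \<omega> -` ?X)"
        by (rule emeasure_mono) (rule sets_Pair1[OF X])
      moreover have "ennreal q \<le> emeasure (gauss_array J) H"
        using H(2) by (simp add: PJ.emeasure_eq_measure ennreal_leI)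
      ultimately show ?thesis using True by simp
    qed simp
  qed
  also have "(\<integral>\<^sup>+\<omega>. ennreal q * indicator G \<omega> \<partial>gauss_array I) = ennreal q * emeasure (gauss_array I) G"
    by (rule nn_integral_cmult_indicator[OF G(1)])
  finally have "ennreal (q * measure (gauss_array I) G) \<le> ennreal (measure (gauss_array (I \<union> J)) E)"
    using q by (simp add: PI.emeasure_eq_measure PU.emeasure_eq_measure ennreal_mult)
  then have "q * measure (gauss_array I) G \<le> measure (gauss_array (I \<union> J)) E" by simp
  then show ?thesis using mult_left_mono[OF G(2) q] by linarith
qed

section \<open>Predictors on good samples\<close>

lemma lin_pred_cong:
  assumes "\<And>j. j \<in> F \<Longrightarrow> a j = a' j" "\<And>j. j \<notin> F \<Longrightarrow> b $ j = 0"
  shows "lin_pred a b = lin_pred a' b"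
  unfolding lin_pred_def
proof (rule sum.cong)
  fix j show "b $ j *\<^sub>R a j = b $ j *\<^sub>R a' j" by (cases "j \<in> F") (simp_all add: assms)
qed simp

lemma lasso_min_cong:
  assumes "\<And>j. j \<in> F \<Longrightarrow> a j = a' j"
  shows "lasso_min a y F B b \<longleftrightarrow> lasso_min a' y F B b"
  unfolding lasso_min_def using lin_pred_cong[of F a a'] assms by (metis (no_types, lifting))

lemma max_corr_cong:
  "(\<And>j. j \<in> F \<Longrightarrow> a j = a' j) \<Longrightarrow> max_corr a F z = max_corr a' F z"
  unfolding max_corr_def by (metis (mono_tags, lifting) image_cong)

text \<open>The block columns are set to zero, which makes the family a function of the coordinates outside the block; solutions
supported outside \<open>J\<close> do not see the difference.\<close>

definition rest_col :: "(nat \<Rightarrow> 'p::finite) \<Rightarrow> nat \<Rightarrow> 'p set \<Rightarrow> (nat \<times> 'p option \<Rightarrow> real) \<Rightarrow> 'p \<Rightarrow> real ^ 'p" where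
  "rest_col enc n J \<omega> j = (if j \<in> J then 0 else embed_vec enc n (\<lambda>i. \<omega> (i, Some j)))"

definition rest_resp :: "(nat \<Rightarrow> 'p::finite) \<Rightarrow> nat \<Rightarrow> 'p set \<Rightarrow> real ^ 'p \<Rightarrow> real \<Rightarrow> (nat \<times> 'p option \<Rightarrow> real) \<Rightarrow> real ^ 'p" where
  "rest_resp enc n J \<beta> \<rho> \<omega> = embed_vec enc n (\<lambda>i. \<rho> * \<omega> (i, None) + (\<Sum>j\<in>-J. \<beta> $ j * \<omega> (i, Some j)))"

text \<open>Residuals lie in the image of \<open>embed_vec\<close>, so that the \<open>n\<close> encoded coordinates carry the full norm.\<close>

lemma residual_dirs_rest:
  assumes enc: "inj_on enc {1..n}" and \<zeta>: "\<zeta> \<in> residual_dirs (rest_col enc n J \<omega>) (rest_resp enc n J \<beta> \<rho> \<omega>) F"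
  shows "(\<Sum>i=1..n. (\<zeta> $ enc i)\<^sup>2) = 1"
proof -
  obtain b where b: "\<zeta> = sgn (rest_resp enc n J \<beta> \<rho> \<omega> - lin_pred (rest_col enc n J \<omega>) b)"
    using \<zeta> by (auto simp: residual_dirs_def)
  have sub: "subspace (range (embed_vec enc n))"
    unfolding subspace_def
  proof (intro conjI ballI allI)
    show "0 \<in> range (embed_vec enc n)"
      by (rule range_eqI[of _ _ "\<lambda>_. 0"]) (simp add: embed_vec_def)
  next
    fix u v assume "u \<in> range (embed_vec enc n)" "v \<in> range (embed_vec enc n)"
    then obtain f g where fg: "u = embed_vec enc n f" "v = embed_vec enc n g" by auto
    show "u + v \<in> range (embed_vec enc n)"
      by (rule range_eqI[of _ _ "\<lambda>i. f i + g i"]) (simp add: fg embed_vec_def scaleR_left_distrib sum.distrib)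
  next
    fix c u assume "u \<in> range (embed_vec enc n)"
    then obtain f where f: "u = embed_vec enc n f" by auto
    show "c *\<^sub>R u \<in> range (embed_vec enc n)"
      by (rule range_eqI[of _ _ "\<lambda>i. c * f i"]) (simp add: f embed_vec_def scaleR_sum_right)
  qed
  have "rest_col enc n J \<omega> j \<in> range (embed_vec enc n)" for j
    using subspace_0[OF sub] by (simp add: rest_col_def)
  then have "lin_pred (rest_col enc n J \<omega>) b \<in> range (embed_vec enc n)"
    unfolding lin_pred_def by (intro subspace_sum[OF sub] subspace_scale[OF sub])
  then have "\<zeta> \<in> range (embed_vec enc n)"
    unfolding b sgn_div_norm
    by (intro subspace_scale[OF sub] subspace_diff[OF sub]) (auto simp: rest_resp_def)
  then have "\<zeta> = embed_vec enc n (\<lambda>i. \<zeta> $ enc i)" by (rule embed_of_range[OF enc])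
  then have "(norm \<zeta>)\<^sup>2 = (\<Sum>i=1..n. (\<zeta> $ enc i)\<^sup>2)" using norm_embed[OF enc] by metis
  then show ?thesis using norm_residual_dirs[OF \<zeta>] by simp
qed

text \<open>The largest correlation is at least the root mean square of the correlations with \<open>Q\<close>, which the least singular value
bounds from below.\<close>

lemma max_corr_rest_ge:
  fixes Q :: "'p::finite set"
  assumes enc: "inj_on enc {1..n}" and n: "1 \<le> n" and Q: "Q \<noteq> {}" "Q \<subseteq> -J"
    and good: "rest_good n (Some ` Q) z \<omega>"
    and \<zeta>: "\<zeta> \<in> residual_dirs (rest_col enc n J \<omega>) (rest_resp enc n J \<beta> \<rho> \<omega>) (-J)"
  shows "1 / 16 \<le> max_corr (rest_col enc n J \<omega>) (-J) \<zeta>"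
proof -
  let ?\<kappa> = "max_corr (rest_col enc n J \<omega>) (-J) \<zeta>"
  have "real (card (Some ` Q)) / 256 \<le> (\<Sum>j\<in>Some ` Q. (\<Sum>i=1..n. \<zeta> $ enc i * \<omega> (i, j))\<^sup>2)"
    by (rule least_singular_value_of_net[OF n, where x = "\<lambda>i j. \<omega> (i, j)"])
       (use good residual_dirs_rest[OF enc \<zeta>] in \<open>auto simp: rest_good_def\<close>)
  then have "real (card Q) / 256 \<le> (\<Sum>j\<in>Q. (\<Sum>i=1..n. \<zeta> $ enc i * \<omega> (i, Some j))\<^sup>2)"
    by (simp add: card_image sum.reindex)
  also have "\<dots> \<le> (\<Sum>j\<in>Q. ?\<kappa>\<^sup>2)"
  proof (rule sum_mono)
    fix j assume j: "j \<in> Q"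
    have "\<bar>\<zeta> \<bullet> rest_col enc n J \<omega> j\<bar> \<le> ?\<kappa>" by (rule max_corr_ge) (use j Q in auto)
    moreover have "\<zeta> \<bullet> rest_col enc n J \<omega> j = (\<Sum>i=1..n. \<zeta> $ enc i * \<omega> (i, Some j))"
      using j Q by (auto simp: rest_col_def inner_embed)
    ultimately have "\<bar>\<Sum>i=1..n. \<zeta> $ enc i * \<omega> (i, Some j)\<bar> \<le> ?\<kappa>" by simp
    then have "\<bar>\<Sum>i=1..n. \<zeta> $ enc i * \<omega> (i, Some j)\<bar>\<^sup>2 \<le> ?\<kappa>\<^sup>2" by (rule power_mono) simp
    then show "(\<Sum>i=1..n. \<zeta> $ enc i * \<omega> (i, Some j))\<^sup>2 \<le> ?\<kappa>\<^sup>2" by (simp only: power2_abs)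
  qed
  also have "\<dots> = real (card Q) * ?\<kappa>\<^sup>2" by simp
  finally have "real (card Q) * (1 / 256) \<le> real (card Q) * ?\<kappa>\<^sup>2" by simp
  then have "(1 / 16)\<^sup>2 \<le> ?\<kappa>\<^sup>2" using Q(1) by (simp add: card_gt_0_iff power_divide)
  moreover have "0 \<le> ?\<kappa>" by (rule max_corr_nonneg) (use Q in auto)
  ultimately show ?thesis by (rule power2_le_imp_le)
qed

text \<open>The deterministic conclusion for a good sample. Replacing \<open>\<zeta>\<close> by its neighbour in \<open>R\<close> changes the vector of correlations
with the Gaussian block columns by at most \<open>1 / n\<close> times their Frobenius norm, which is less than \<open>0.3\<close> as
\<open>28 * m \<le> n\<close>.\<close>

lemma predictor_far_of_good:
  fixes \<beta> :: "real ^ 'p::finite" and \<omega> :: "nat \<times> 'p option \<Rightarrow> real" and J Q :: "'p set"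
  assumes enc: "inj_on enc {1..n}" and n: "4000000 \<le> n" and Q: "Q \<noteq> {}" "Q \<subseteq> -J" and J: "J \<noteq> {}"
  defines "m \<equiv> real (card J)"
  assumes k: "10 \<le> k" and l: "16 \<le> l" and w: "298 / 100 * (l * k) \<le> sqrt m" "sqrt m \<le> 3 * (l * k)"
    and mn: "28 * m \<le> n" and \<sigma>: "0 < \<sigma>" "sqrt n = \<sigma> * k\<^sup>2"
    and \<beta>: "\<And>j. j \<in> J \<Longrightarrow> \<beta> $ j = (2 / 5) / m"
  defines "s \<equiv> (2 / 5) / sqrt m"
  defines "\<rho> \<equiv> sqrt (s\<^sup>2 + \<sigma>\<^sup>2)"
  assumes out: "\<And>i j. i \<in> {1..n} \<Longrightarrow> j \<notin> J \<Longrightarrow> fst (S i) $ j = \<omega> (i, Some j)"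
    and blk: "\<And>i j. i \<in> {1..n} \<Longrightarrow> j \<in> J \<Longrightarrow> fst (S i) $ j = \<omega> (i, Some j)
       - ((\<rho> + \<sigma>) / \<rho> * ((\<Sum>j'\<in>J. \<omega> (i, Some j')) / sqrt m) - s / \<rho> * \<omega> (i, None)) / sqrt m"
    and resp: "\<And>i. i \<in> {1..n} \<Longrightarrow> snd (S i) = \<rho> * \<omega> (i, None) + (\<Sum>j\<in>-J. \<beta> $ j * \<omega> (i, Some j))"
    and rg: "rest_good n (Some ` Q) None \<omega>"
  defines "D \<equiv> residual_dirs (rest_col enc n J \<omega>) (rest_resp enc n J \<beta> \<rho> \<omega>) (-J)"
  assumes R: "R \<subseteq> D"
      "\<And>\<zeta>. \<zeta> \<in> D \<Longrightarrow> max_corr (rest_col enc n J \<omega>) (-J) \<zeta> < real n / 32 \<Longrightarrow> \<exists>\<zeta>'\<in>R. norm (\<zeta> - \<zeta>') \<le> 1 / n"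
    and bg: "block_good n (Some ` J) l ((\<lambda>\<zeta> i. \<zeta> $ enc i) ` R) \<omega>"
    and B: "0 \<le> B"
  shows "\<exists>b\<in>l1_predictors n S B. 1 / (320 * (k * l)) \<le> norm (b - \<beta>)"
proof -
  define E where "E = 1 / (320 * (k * l))"
  define a where "a = sample_col enc n S"
  define y where "y = sample_resp enc n S"
  define a0 where "a0 = rest_col enc n J \<omega>"
  define y0 where "y0 = rest_resp enc n J \<beta> \<rho> \<omega>"
  define x where "x j = embed_vec enc n (\<lambda>i. \<omega> (i, Some j))" for j
  define z where "z = embed_vec enc n (\<lambda>i. \<omega> (i, None))"
  have cJ: "0 < card J" using J by (simp add: card_gt_0_iff)
  have m: "0 < m" using cJ by (simp add: m_def)
  have lk: "160 \<le> l * k" using mult_mono[of 16 l 10 k] k l by simp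
  have sm: "0 < sqrt m" using m by simp
  have s0: "0 < s" using m by (simp add: s_def)
  have \<rho>s: "\<sigma> \<le> \<rho>"
    using \<sigma> by (auto simp: \<rho>_def intro!: real_le_rsqrt)
  have E0: "0 < E" using k l by (simp add: E_def)
  have aeq: "a j = a0 j" if "j \<in> -J" for j
  proof -
    have "a j = embed_vec enc n (\<lambda>i. \<omega> (i, Some j))"
      unfolding a_def sample_col_def embed_vec_def using that by (intro sum.cong) (auto simp: out)
    then show ?thesis using that by (simp add: a0_def rest_col_def)
  qed
  have yeq: "y = y0"
    unfolding y_def y0_def sample_resp_def rest_resp_def embed_vec_def by (intro sum.cong) (auto simp: resp)
  have pred: "b \<in> l1_predictors n S B \<longleftrightarrow> lasso_min a y UNIV B b" for b
    by (simp add: l1_predictors_eq_lasso_min[OF enc] a_def y_def)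
  obtain b0 where b0: "lasso_min a y (-J) B b0" using lasso_min_exists[OF B] .
  have b0': "lasso_min a0 y0 (-J) B b0"
    using b0 lasso_min_cong[of "-J" a a0 y B b0, OF aeq] unfolding yeq by blast
  have b0J: "j \<in> J \<Longrightarrow> b0 $ j = 0" for j using b0 by (simp add: lasso_min_def)
  have leq: "lin_pred a b0 = lin_pred a0 b0" by (rule lin_pred_cong[of "-J" a a0 b0, OF aeq]) (use b0J in auto)
  show ?thesis
  proof (cases "y - lin_pred a b0 = 0")
    \<comment> \<open>an exact fit without the block is an unrestricted minimizer that misses the whole block\<close>
    case True
    have "lasso_min a y UNIV B b0" using b0 True by (simp add: lasso_min_def)
    moreover have "E \<le> norm (b0 - \<beta>)"
    proof -
      have "s\<^sup>2 = (\<Sum>j\<in>J. ((b0 - \<beta>) $ j)\<^sup>2)"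
      proof -
        have "(\<Sum>j\<in>J. ((b0 - \<beta>) $ j)\<^sup>2) = (\<Sum>j\<in>J. ((2 / 5) / m)\<^sup>2)"
          by (rule sum.cong) (simp_all add: b0J \<beta>)
        also have "\<dots> = m * ((2 / 5) / m)\<^sup>2" by (simp add: m_def)
        also have "\<dots> = s\<^sup>2" using m by (simp add: s_def power_divide power2_eq_square)
        finally show ?thesis ..
      qed
      also have "\<dots> \<le> (\<Sum>j\<in>UNIV. ((b0 - \<beta>) $ j)\<^sup>2)" by (rule sum_mono2) auto
      also have "\<dots> = (norm (b0 - \<beta>))\<^sup>2" by (simp add: norm_vec_def L2_set_def sum_nonneg)
      finally have "s \<le> norm (b0 - \<beta>)" by (rule power2_le_imp_le) simp
      moreover have "E \<le> s"
      proof -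
        have "(2 / 5) / (3 * (l * k)) \<le> s" unfolding s_def using w(2) sm k l by (intro divide_left_mono mult_pos_pos) auto
        moreover have "E \<le> (2 / 5) / (3 * (l * k))" using lk by (simp add: E_def field_simps)
        ultimately show ?thesis by linarith
      qed
      ultimately show ?thesis by linarith
    qed
    ultimately show ?thesis using pred by (auto simp: E_def)
  next
    case nz: False
    obtain b where b: "lasso_min a y UNIV B b" using lasso_min_exists[OF B] .
    define \<zeta> where "\<zeta> = sgn (y - lin_pred a b0)"
    have \<zeta>D: "\<zeta> \<in> D"
      unfolding D_def residual_dirs_def a0_def[symmetric] y0_def[symmetric]
      using b0' nz by (auto simp: \<zeta>_def yeq leq)
    have n\<zeta>: "norm \<zeta> = 1" using nz by (simp add: \<zeta>_def norm_sgn)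
    define \<kappa> where "\<kappa> = max_corr a (-J) \<zeta>"
    have \<kappa>eq: "\<kappa> = max_corr (rest_col enc n J \<omega>) (-J) \<zeta>"
      unfolding \<kappa>_def a0_def[symmetric] by (rule max_corr_cong[of "-J" a a0 \<zeta>, OF aeq])
    have n1: "1 \<le> n" using n by simp
    have \<kappa>: "1 / 16 \<le> \<kappa>"
      unfolding \<kappa>eq by (rule max_corr_rest_ge[OF enc n1 Q rg]) (use \<zeta>D in \<open>simp add: D_def\<close>)
    define A where "A j = \<zeta> \<bullet> x j" for j
    define \<xi> where "\<xi> = \<zeta> \<bullet> z"
    have frob: "(\<Sum>j\<in>J. (norm (x j))\<^sup>2) \<le> 121 / 100 * (n * m)"
    proof -
      have "(\<Sum>j\<in>J. (norm (x j))\<^sup>2) = (\<Sum>j\<in>J. \<Sum>i=1..n. (\<omega> (i, Some j))\<^sup>2)"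
        by (simp only: x_def norm_embed[OF enc])
      also have "\<dots> = (\<Sum>i=1..n. \<Sum>j\<in>J. (\<omega> (i, Some j))\<^sup>2)" by (rule sum.swap)
      also have "\<dots> \<le> 121 / 100 * (n * m)"
        using bg by (simp add: block_good_def sum.reindex card_image m_def)
      finally show ?thesis .
    qed
    \<comment> \<open>bounds the error of replacing a direction by its neighbour in the net, and large correlations directly\<close>
    have L2diff: "L2_set (\<lambda>j. h \<bullet> x j) J \<le> norm h * (11 / 10 * (sqrt m * sqrt n))" for h
    proof -
      have "L2_set (\<lambda>j. h \<bullet> x j) J \<le> L2_set (\<lambda>j. norm h * norm (x j)) J"
        unfolding L2_set_def
      proof (intro real_sqrt_le_mono sum_mono)
        fix j
        have "\<bar>h \<bullet> x j\<bar>\<^sup>2 \<le> (norm h * norm (x j))\<^sup>2"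
          by (rule power_mono[OF Cauchy_Schwarz_ineq2]) simp
        then show "(h \<bullet> x j)\<^sup>2 \<le> (norm h * norm (x j))\<^sup>2" by (simp only: power2_abs)
      qed
      also have "\<dots> = norm h * sqrt (\<Sum>j\<in>J. (norm (x j))\<^sup>2)"
        by (simp add: L2_set_def power_mult_distrib sum_distrib_left[symmetric] real_sqrt_mult)
      also have "\<dots> \<le> norm h * (11 / 10 * (sqrt m * sqrt n))"
      proof (rule mult_left_mono)
        have "sqrt (\<Sum>j\<in>J. (norm (x j))\<^sup>2) \<le> sqrt ((11 / 10)\<^sup>2 * (m * n))"
          using frob by (intro real_sqrt_le_mono) (simp add: power_divide mult.commute)
        then show "sqrt (\<Sum>j\<in>J. (norm (x j))\<^sup>2) \<le> 11 / 10 * (sqrt m * sqrt n)"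
          by (simp only: real_sqrt_mult real_sqrt_abs abs_divide abs_numeral)
      qed simp
      finally show ?thesis .
    qed
    have sumle: "\<bar>\<Sum>j\<in>J. f j\<bar> / sqrt m \<le> L2_set f J" for f :: "'p \<Rightarrow> real"
    proof -
      have "L2_set (\<lambda>_. 1 :: real) J = sqrt m" by (simp add: L2_set_def m_def)
      then have "(\<Sum>j\<in>J. f j) \<le> L2_set f J * sqrt m" "(\<Sum>j\<in>J. - f j) \<le> L2_set f J * sqrt m"
        using sum_mult_le_L2[of f "\<lambda>_. 1" J] sum_mult_le_L2[of "\<lambda>j. - f j" "\<lambda>_. 1" J]
        by (simp_all add: L2_set_def)
      then have "\<bar>\<Sum>j\<in>J. f j\<bar> \<le> L2_set f J * sqrt m" by (simp add: sum_negf abs_le_iff)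
      then show ?thesis using sm by (simp add: pos_divide_le_eq)
    qed
    define \<alpha> where "\<alpha> = \<bar>\<Sum>j\<in>J. A j\<bar> / sqrt m"
    define A2 where "A2 = L2_set A J"
    have cases: "(1 / 16 \<le> \<kappa> \<and> \<alpha> \<le> 8 / 10 * l + 3 / 10 \<and> A2 \<le> 11 / 10 * sqrt m + 3 / 10) \<or>
       ((sqrt n)\<^sup>2 / 32 \<le> \<kappa> \<and> \<alpha> \<le> 11 / 10 * (sqrt m * sqrt n) \<and> A2 \<le> 11 / 10 * (sqrt m * sqrt n))"
    proof (cases "\<kappa> < real n / 32")
      case True
      then obtain \<zeta>' where \<zeta>': "\<zeta>' \<in> R" "norm (\<zeta> - \<zeta>') \<le> 1 / n"
        using R(2)[OF \<zeta>D] \<kappa>eq by auto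
      define h where "h = \<zeta> - \<zeta>'"
      have inn: "\<zeta>' \<bullet> x j = (\<Sum>i=1..n. \<zeta>' $ enc i * \<omega> (i, Some j))" for j
        by (simp add: x_def inner_embed)
      have "(\<Sum>j\<in>Some ` J. (\<Sum>i=1..n. \<zeta>' $ enc i * \<omega> (i, j))\<^sup>2) \<le> 121 / 100 * card (Some ` J) \<and>
        \<bar>\<Sum>j\<in>Some ` J. \<Sum>i=1..n. \<zeta>' $ enc i * \<omega> (i, j)\<bar> / sqrt (card (Some ` J)) \<le> 8 / 10 * l"
      proof -
        have "\<forall>f\<in>(\<lambda>\<zeta> i. \<zeta> $ enc i) ` R. (\<Sum>j\<in>Some ` J. (\<Sum>i=1..n. f i * \<omega> (i, j))\<^sup>2) \<le> 121 / 100 * card (Some ` J) \<and>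
          \<bar>\<Sum>j\<in>Some ` J. \<Sum>i=1..n. f i * \<omega> (i, j)\<bar> / sqrt (card (Some ` J)) \<le> 8 / 10 * l"
          using bg unfolding block_good_def by (rule conjunct2)
        from bspec[OF this imageI[OF \<zeta>'(1)]] show ?thesis .
      qed
      then have rep: "(\<Sum>j\<in>J. (\<zeta>' \<bullet> x j)\<^sup>2) \<le> 121 / 100 * m" "\<bar>\<Sum>j\<in>J. \<zeta>' \<bullet> x j\<bar> / sqrt m \<le> 8 / 10 * l"
        by (simp_all add: inn sum.reindex card_image m_def)
      have small: "L2_set (\<lambda>j. h \<bullet> x j) J \<le> 3 / 10"
      proof -
        have "norm h * (11 / 10 * (sqrt m * sqrt n)) \<le> 1 / n * (11 / 10 * (sqrt m * sqrt n))"
          using \<zeta>'(2) m by (intro mult_right_mono) (auto simp: h_def)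
        also have "\<dots> \<le> 3 / 10"
        proof (rule power2_le_imp_le)
          have "(1 / n * (11 / 10 * (sqrt m * sqrt n)))\<^sup>2 = (1 / n)\<^sup>2 * ((11 / 10)\<^sup>2 * ((sqrt m)\<^sup>2 * (sqrt n)\<^sup>2))"
            by (simp only: power_mult_distrib)
          also have "\<dots> = (1 / n)\<^sup>2 * (121 / 100 * (m * n))" using m by (simp add: power_divide)
          also have "\<dots> = 121 / 100 * (m / n)" using n by (simp add: power2_eq_square)
          also have "\<dots> \<le> 121 / 100 * (1 / 28)"
            using mn n by (intro mult_left_mono) (auto simp: field_simps)
          also have "\<dots> \<le> (3 / 10)\<^sup>2" by (simp add: power_divide)
          finally show "(1 / n * (11 / 10 * (sqrt m * sqrt n)))\<^sup>2 \<le> (3 / 10)\<^sup>2" .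
        qed simp
        finally show ?thesis using L2diff[of h] by linarith
      qed
      have Ah: "A j = \<zeta>' \<bullet> x j + h \<bullet> x j" for j
        by (simp add: A_def h_def inner_diff_left)
      have "A2 \<le> L2_set (\<lambda>j. \<zeta>' \<bullet> x j) J + L2_set (\<lambda>j. h \<bullet> x j) J"
        unfolding A2_def Ah by (rule L2_set_triangle_ineq)
      moreover have "L2_set (\<lambda>j. \<zeta>' \<bullet> x j) J \<le> 11 / 10 * sqrt m"
      proof -
        have "L2_set (\<lambda>j. \<zeta>' \<bullet> x j) J \<le> sqrt ((11 / 10)\<^sup>2 * m)"
          unfolding L2_set_def using rep(1) by (intro real_sqrt_le_mono) (simp add: power_divide)
        then show ?thesis by (simp only: real_sqrt_mult real_sqrt_abs abs_divide abs_numeral)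
      qed
      moreover have "\<alpha> \<le> \<bar>\<Sum>j\<in>J. \<zeta>' \<bullet> x j\<bar> / sqrt m + \<bar>\<Sum>j\<in>J. h \<bullet> x j\<bar> / sqrt m"
        unfolding \<alpha>_def Ah sum.distrib add_divide_distrib[symmetric]
        using sm by (intro divide_right_mono abs_triangle_ineq) auto
      moreover have "\<bar>\<Sum>j\<in>J. h \<bullet> x j\<bar> / sqrt m \<le> L2_set (\<lambda>j. h \<bullet> x j) J" by (rule sumle)
      ultimately show ?thesis using small rep(2) \<kappa> by linarith
    next
      case False
      have "A2 \<le> 11 / 10 * (sqrt m * sqrt n)"
        using L2diff[of \<zeta>] n\<zeta> by (simp add: A2_def A_def[abs_def])
      moreover have "\<alpha> \<le> A2" unfolding \<alpha>_def A2_def by (rule sumle)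
      ultimately show ?thesis using False by simp
    qed
    have t: "2000 \<le> sqrt n" by (rule real_le_rsqrt) (use n in simp)
    \<comment> \<open>the noise column has norm at most \<open>11 / 10 * sqrt n\<close>, and \<open>sqrt n / \<sigma> = k\<^sup>2\<close>\<close>
    define \<tau> where "\<tau> = 11 / 10 * (s * k\<^sup>2)"
    have contra: "s * (\<alpha> + \<tau>) + E * (A2 + \<tau>) < \<kappa> * (2 / 5 - sqrt m * E)"
      unfolding s_def \<tau>_def E_def by (rule correlation_budget[OF k l w t cases])
    have \<xi>: "s / \<sigma> * \<bar>\<xi>\<bar> \<le> \<tau>"
    proof -
      have "(norm z)\<^sup>2 \<le> (11 / 10 * sqrt n)\<^sup>2"
        using rg unfolding z_def norm_embed[OF enc]
        by (simp add: rest_good_def power_mult_distrib power_divide)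
      then have "norm z \<le> 11 / 10 * sqrt n" by (rule power2_le_imp_le) simp
      moreover have "\<bar>\<xi>\<bar> \<le> norm z" using Cauchy_Schwarz_ineq2[of \<zeta> z] n\<zeta> by (simp add: \<xi>_def)
      ultimately have "\<bar>\<xi>\<bar> \<le> 11 / 10 * (\<sigma> * k\<^sup>2)" using \<sigma>(2) by simp
      then have "s / \<sigma> * \<bar>\<xi>\<bar> \<le> s / \<sigma> * (11 / 10 * (\<sigma> * k\<^sup>2))" using s0 \<sigma>(1) by (intro mult_left_mono) auto
      also have "\<dots> = \<tau>" using \<sigma>(1) by (simp add: \<tau>_def)
      finally show ?thesis .
    qed
    have acol: "\<zeta> \<bullet> a j = A j - ((\<rho> + \<sigma>) / \<rho> * ((\<Sum>i\<in>J. A i) / sqrt m) - s / \<rho> * \<xi>) / sqrt m"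
      if j: "j \<in> J" for j
    proof -
      have "\<zeta> \<bullet> a j = (\<Sum>i=1..n. \<zeta> $ enc i * (\<omega> (i, Some j)
          - ((\<rho> + \<sigma>) / \<rho> * ((\<Sum>j'\<in>J. \<omega> (i, Some j')) / sqrt m) - s / \<rho> * \<omega> (i, None)) / sqrt m))"
        unfolding a_def sample_col_def inner_embed using j by (intro sum.cong) (auto simp: blk)
      also have "\<dots> = (\<Sum>i=1..n. \<zeta> $ enc i * \<omega> (i, Some j)
          - ((\<rho> + \<sigma>) / \<rho> / sqrt m / sqrt m) * (\<Sum>j'\<in>J. \<zeta> $ enc i * \<omega> (i, Some j'))
          + (s / \<rho> / sqrt m) * (\<zeta> $ enc i * \<omega> (i, None)))"
        by (rule sum.cong) (simp_all add: sum_distrib_left[symmetric] diff_divide_distrib algebra_simps)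
      also have "\<dots> = (\<Sum>i=1..n. \<zeta> $ enc i * \<omega> (i, Some j))
          - ((\<rho> + \<sigma>) / \<rho> / sqrt m / sqrt m) * (\<Sum>i=1..n. \<Sum>j'\<in>J. \<zeta> $ enc i * \<omega> (i, Some j'))
          + (s / \<rho> / sqrt m) * (\<Sum>i=1..n. \<zeta> $ enc i * \<omega> (i, None))"
        by (simp only: sum.distrib sum_subtractf sum_distrib_left[symmetric])
      also have "(\<Sum>i=1..n. \<Sum>j'\<in>J. \<zeta> $ enc i * \<omega> (i, Some j')) = (\<Sum>j'\<in>J. A j')"
        unfolding A_def x_def inner_embed by (rule sum.swap)
      also have "(\<Sum>i=1..n. \<zeta> $ enc i * \<omega> (i, Some j)) = A j" by (simp add: A_def x_def inner_embed)
      also have "(\<Sum>i=1..n. \<zeta> $ enc i * \<omega> (i, None)) = \<xi>" by (simp add: \<xi>_def z_def inner_embed)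
      finally show ?thesis by (simp add: diff_divide_distrib)
    qed
    have "E \<le> norm (b - \<beta>)"
    proof (rule lasso_error_from_correlations[OF b0 b _ J, of \<beta> "2 / 5" s \<sigma> \<rho> A \<xi> \<alpha> A2 \<tau>])
      show "- J \<noteq> {}" using Q by auto
      show "\<bar>sum A J / sqrt (real (card J))\<bar> \<le> \<alpha>" by (simp add: \<alpha>_def m_def)
      show "s = 2 / 5 / sqrt (real (card J))" by (simp add: s_def m_def)
    qed (use nz \<beta> s0 \<rho>s \<sigma> acol \<xi> E0 contra in \<open>simp_all add: m_def[symmetric] s_def[symmetric] \<zeta>_def[symmetric] \<kappa>_def[symmetric] A2_def less_imp_le\<close>)
    then show ?thesis using b pred by (auto simp: E_def)
  qed
qed

section \<open>The lower bound\<close>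

lemma rest_good_cong:
  assumes "\<And>i j. i \<in> {1..n} \<Longrightarrow> j \<in> insert z T \<Longrightarrow> \<omega> (i, j) = \<omega>' (i, j)"
  shows "rest_good n T z \<omega> \<longleftrightarrow> rest_good n T z \<omega>'"
proof -
  have 1: "(\<Sum>i=1..n. c i * \<omega> (i, j)) = (\<Sum>i=1..n. c i * \<omega>' (i, j))" if "j \<in> T" for c j
    using assms that by (intro sum.cong) auto
  have 2: "(\<Sum>j\<in>T. (\<Sum>i=1..n. c i * \<omega> (i, j))\<^sup>2) = (\<Sum>j\<in>T. (\<Sum>i=1..n. c i * \<omega>' (i, j))\<^sup>2)" for c
    by (rule sum.cong) (simp_all only: 1)
  have 3: "(\<Sum>i=1..n. \<Sum>j\<in>T. (\<omega> (i, j))\<^sup>2) = (\<Sum>i=1..n. \<Sum>j\<in>T. (\<omega>' (i, j))\<^sup>2)"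
    using assms by (intro sum.cong) auto
  have 4: "(\<Sum>i=1..n. (\<omega> (i, z))\<^sup>2) = (\<Sum>i=1..n. (\<omega>' (i, z))\<^sup>2)"
    using assms by (intro sum.cong) auto
  show ?thesis unfolding rest_good_def 2 3 4 ..
qed

lemma block_good_cong:
  assumes "\<And>i j. i \<in> {1..n} \<Longrightarrow> j \<in> T \<Longrightarrow> \<omega> (i, j) = \<omega>' (i, j)"
  shows "block_good n T l R \<omega> \<longleftrightarrow> block_good n T l R \<omega>'"
proof -
  have 1: "(\<Sum>i=1..n. c i * \<omega> (i, j)) = (\<Sum>i=1..n. c i * \<omega>' (i, j))" if "j \<in> T" for c j
    using assms that by (intro sum.cong) auto
  have 2: "(\<Sum>j\<in>T. (\<Sum>i=1..n. c i * \<omega> (i, j))\<^sup>2) = (\<Sum>j\<in>T. (\<Sum>i=1..n. c i * \<omega>' (i, j))\<^sup>2)" for c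
    by (rule sum.cong) (simp_all only: 1)
  have 3: "(\<Sum>j\<in>T. \<Sum>i=1..n. c i * \<omega> (i, j)) = (\<Sum>j\<in>T. \<Sum>i=1..n. c i * \<omega>' (i, j))" for c
    by (rule sum.cong) (simp_all only: 1)
  have 4: "(\<Sum>i=1..n. \<Sum>j\<in>T. (\<omega> (i, j))\<^sup>2) = (\<Sum>i=1..n. \<Sum>j\<in>T. (\<omega>' (i, j))\<^sup>2)"
    using assms by (intro sum.cong) auto
  show ?thesis unfolding block_good_def 2 3 4 ..
qed

text \<open>Everything is compared with \<open>x = l\<^sup>2 * K\<close>, which is so large that the rounding of \<open>9 * x\<close> hardly matters.\<close>

lemma block_regime_numerics:
  fixes K l :: real
  assumes K: "100 \<le> K" and l: "16 \<le> l" and n: "256 * K * l\<^sup>2 < real n"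
  defines "m \<equiv> real (nat \<lfloor>9 * l\<^sup>2 * K\<rfloor>)"
  shows "298 / 100 * (l * sqrt K) \<le> sqrt m" "sqrt m \<le> 3 * (l * sqrt K)" "28 * m \<le> n" "888 * l\<^sup>2 \<le> m"
proof -
  define x where "x = l\<^sup>2 * K"
  have l2: "256 \<le> l\<^sup>2" using power_mono[OF l, of 2] by simp
  have x: "100 * l\<^sup>2 \<le> x" "256 * x < real n"
    using mult_right_mono[OF K, of "l\<^sup>2"] n by (simp_all add: x_def mult_ac)
  have m: "m \<le> 9 * x" "9 * x - 1 < m"
  proof -
    have "0 \<le> \<lfloor>9 * x\<rfloor>" using x l2 by simp
    then have "m = real_of_int \<lfloor>9 * x\<rfloor>" by (simp add: m_def x_def mult.assoc)
    then show "m \<le> 9 * x" "9 * x - 1 < m" by linarith+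
  qed
  show "28 * m \<le> n" "888 * l\<^sup>2 \<le> m" using m x l2 by linarith+
  have sx: "l * sqrt K = sqrt x" using l by (simp add: x_def real_sqrt_mult)
  have "298 / 100 * sqrt x = sqrt ((298 / 100)\<^sup>2 * x)" "3 * sqrt x = sqrt (3\<^sup>2 * x)"
    by (simp_all only: real_sqrt_mult real_sqrt_abs abs_divide abs_numeral)
  moreover have "(298 / 100)\<^sup>2 * x \<le> m" "m \<le> 3\<^sup>2 * x"
    using m x l2 by (auto simp: power_divide)
  ultimately show "298 / 100 * (l * sqrt K) \<le> sqrt m" "sqrt m \<le> 3 * (l * sqrt K)"
    unfolding sx by (simp_all only: real_sqrt_le_iff)
qed

lemma closed_far: "closed {b :: real ^ 'p::finite. E \<le> norm (b - \<beta>)}"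
  by (intro closed_Collect_le continuous_intros)

text \<open>The quantifier over \<open>B\<close> is uncountable, so measurability is obtained from closedness.\<close>

lemma far_event_measurable:
  fixes \<beta> :: "real ^ 'p::finite"
  shows "{S \<in> space (sample_distr n \<beta> \<sigma>). \<forall>B\<ge>0. \<exists>b\<in>l1_predictors n S B. E \<le> norm (b - \<beta>)}
    \<in> sets (sample_distr n \<beta> \<sigma>)"
proof -
  have "closed (\<Inter>B\<in>{0..}. {S. \<exists>b\<in>l1_predictors n S B. b \<in> {b. E \<le> norm (b - \<beta>)}})"
    by (intro closed_INT ballI closed_exists_l1_predictor closed_far)
  from closed_in_sets_sample_distr[OF this, of n \<beta> \<sigma>] show ?thesis
    by (rule back_subst[of "\<lambda>X. X \<in> _"]) auto
qed

text \<open>Represent the sample by a Gaussian array through the reflection and condition on the coordinates outside the block. They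
determine the restricted residuals for all \<open>B\<close> and a net of their directions, while the block remains a standard
Gaussian array, which with high probability is nearly uncorrelated with every direction in the net.\<close>

lemma block_regime_probability:
  fixes \<beta> :: "real ^ 'p::finite" and J :: "'p set"
  assumes n: "30 \<le> n" and p: "3 * n \<le> CARD('p)" and \<sigma>: "0 < \<sigma>"
  defines "K \<equiv> sqrt n / \<sigma>" and "l \<equiv> ln (3 * real n)"
  assumes K: "100 \<le> K" and reg: "256 * K * l\<^sup>2 < n"
    and J: "card J = nat \<lfloor>9 * l\<^sup>2 * K\<rfloor>" and \<beta>: "\<And>j. j \<in> J \<Longrightarrow> \<beta> $ j = (2 / 5) / real (card J)"
  shows "1 / 2 \<le> measure (sample_distr n \<beta> \<sigma>)
    {S \<in> space (sample_distr n \<beta> \<sigma>). \<forall>B\<ge>0. \<exists>b\<in>l1_predictors n S B. 1 / (320 * (sqrt K * l)) \<le> norm (b - \<beta>)}"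
proof -
  define E where "E = 1 / (320 * (sqrt K * l))"
  define m where "m = real (card J)"
  have l16: "16 \<le> l" and n4: "4000000 \<le> n"
    unfolding l_def by (rule block_regime_size[OF n K reg[unfolded l_def]])+
  have num: "298 / 100 * (l * sqrt K) \<le> sqrt m" "sqrt m \<le> 3 * (l * sqrt K)" "28 * m \<le> n" "888 * l\<^sup>2 \<le> m"
    unfolding m_def J by (rule block_regime_numerics[OF K l16 reg])+
  have k10: "10 \<le> sqrt K" by (rule real_le_rsqrt) (use K in simp)
  have l2: "256 \<le> l\<^sup>2" using power_mono[OF l16, of 2] by simp
  have m0: "0 < m" using num(4) l2 by linarith
  have Jne: "J \<noteq> {}" using m0 by (auto simp: m_def)
  have \<sigma>K: "sqrt n = \<sigma> * (sqrt K)\<^sup>2" using \<sigma> K by (simp add: K_def)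
  have "28 * card J \<le> n" using num(3) unfolding m_def by linarith
  moreover have "card (-J) = CARD('p) - card J" by (simp add: Compl_eq_Diff_UNIV card_Diff_subset)
  ultimately have Q8: "8 * n \<le> 3 * card (-J)" using p by linarith
  have Qne: "-J \<noteq> {}" using Q8 n by (metis card.empty mult_0_right mult_is_0 le_zero_eq not_numeral_le_zero zero_neq_numeral)
  obtain enc :: "nat \<Rightarrow> 'p" where enc: "inj_on enc {1..n}"
    using card_le_inj[of "{1..n}" "UNIV :: 'p set"] p by auto
  define s where "s = (2 / 5) / sqrt m"
  define \<rho> where "\<rho> = sqrt (s\<^sup>2 + \<sigma>\<^sup>2)"
  obtain U where U: "orthogonal_transformation U"
    "\<And>v j. j \<notin> J \<Longrightarrow> U v $ Some j = v $ Some j"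
    "\<And>v j. j \<in> J \<Longrightarrow> U v $ Some j = v $ Some j
       - ((\<rho> + \<sigma>) / \<rho> * ((\<Sum>i\<in>J. v $ Some i) / sqrt m) - s / \<rho> * v $ None) / sqrt m"
    "\<And>v. U v \<bullet> aug_coeff \<beta> \<sigma> = \<rho> * v $ None + (\<Sum>j\<in>-J. \<beta> $ j * v $ Some j)"
    using planted_block_reflection[OF Jne _ \<sigma> \<beta>] unfolding \<rho>_def s_def m_def by auto
  \<comment> \<open>one observation as a function of the reflected Gaussian vector\<close>
  define \<Phi> where "\<Phi> v = (features (U v), U v \<bullet> aug_coeff \<beta> \<sigma>)" for v
  have Um: "U \<in> borel_measurable borel"
    using orthogonal_transformation_linear[OF U(1)]
    by (intro borel_measurable_continuous_onI linear_continuous_on) (simp add: linear_conv_bounded_linear)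
  have \<Phi>m: "\<Phi> \<in> borel_measurable borel"
    unfolding \<Phi>_def[abs_def] by (rule measurable_compose[OF Um borel_measurable_data_map])
  have Dlaw: "data_distr \<beta> \<sigma> = distr std_normal_vec borel \<Phi>"
  proof -
    have Um': "U \<in> std_normal_vec \<rightarrow>\<^sub>M borel"
      using Um by (simp only: measurable_cong_sets[OF sets_std_normal_vec refl])
    have "data_distr \<beta> \<sigma> = distr (distr std_normal_vec borel U) borel (\<lambda>v. (features v, v \<bullet> aug_coeff \<beta> \<sigma>))"
      unfolding distr_std_normal_vec_orthogonal[OF U(1)] by (rule data_distr_eq_distr) (use \<sigma> in simp)
    also have "\<dots> = distr std_normal_vec borel \<Phi>"
      by (subst distr_distr[OF borel_measurable_data_map Um']) (simp add: comp_def \<Phi>_def[abs_def])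
    finally show ?thesis .
  qed
  let ?I = "{1..n} \<times> (UNIV :: 'p option set)"
  let ?I1 = "{1..n} \<times> (- Some ` J)" and ?I2 = "{1..n} \<times> (Some ` J)"
  have I12: "?I1 \<union> ?I2 = ?I" "?I1 \<inter> ?I2 = {}" by auto
  define smp where "smp \<omega> = (\<lambda>i\<in>{1..n}. \<Phi> (\<chi> k. \<omega> (i, k)))" for \<omega> :: "nat \<times> 'p option \<Rightarrow> real"
  have law: "sample_distr n \<beta> \<sigma> = distr (gauss_array ?I) (Pi\<^sub>M {1..n} (\<lambda>_. borel)) smp"
    unfolding smp_def[abs_def] by (rule sample_distr_eq_distr_gauss_array[OF _ \<Phi>m Dlaw]) (use n in simp)
  have smpm: "smp \<in> gauss_array ?I \<rightarrow>\<^sub>M Pi\<^sub>M {1..n} (\<lambda>_. borel)"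
    unfolding smp_def[abs_def]
  proof (rule measurable_restrict)
    fix i assume i: "i \<in> {1..n}"
    have "(\<lambda>\<omega>. \<lambda>k. \<omega> (i, k)) \<in> gauss_array ?I \<rightarrow>\<^sub>M Pi\<^sub>M (UNIV :: 'p option set) (\<lambda>_. borel :: real measure)"
      by (rule measurable_PiM_single') (use i in \<open>auto intro!: measurable_gauss_array_component\<close>)
    from measurable_compose[OF this measurable_vec_lambda_PiM]
    have "(\<lambda>\<omega>. \<chi> k. \<omega> (i, k)) \<in> borel_measurable (gauss_array ?I)" .
    then show "(\<lambda>\<omega>. \<Phi> (\<chi> k. \<omega> (i, k))) \<in> borel_measurable (gauss_array ?I)"
      by (rule measurable_compose[OF _ \<Phi>m])
  qed
  let ?Ev = "{S \<in> space (sample_distr n \<beta> \<sigma>). \<forall>B\<ge>0. \<exists>b\<in>l1_predictors n S B. E \<le> norm (b - \<beta>)}"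
  have EvM: "?Ev \<in> sets (Pi\<^sub>M {1..n} (\<lambda>_. borel))"
    using far_event_measurable[of n \<beta> \<sigma> E] unfolding sets_sample_distr .
  let ?F = "smp -` ?Ev \<inter> space (gauss_array ?I)"
  have FM: "?F \<in> sets (gauss_array ?I)" by (rule measurable_sets[OF smpm EvM])
  have meas: "measure (sample_distr n \<beta> \<sigma>) ?Ev = measure (gauss_array ?I) ?F"
    by (subst (1) law) (rule measure_distr[OF smpm EvM])
  let ?G = "{\<omega> \<in> space (gauss_array ?I1). rest_good n (Some ` (-J)) None \<omega>}"
  have G: "?G \<in> sets (gauss_array ?I1)" "7 / 10 \<le> measure (gauss_array ?I1) ?G"
    by (rule rest_good_prob; use n4 Q8 in \<open>auto simp: card_image\<close>)+
  have "9 / 10 * (7 / 10) \<le> measure (gauss_array (?I1 \<union> ?I2)) ?F"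
  proof (rule gauss_array_product_lower_bound[OF _ _ I12(2) _ G])
    show "?F \<in> sets (gauss_array (?I1 \<union> ?I2))" unfolding I12(1) by (rule FM)
  next
    fix \<omega> assume \<omega>: "\<omega> \<in> ?G"
    define D where "D = residual_dirs (rest_col enc n J \<omega>) (rest_resp enc n J \<beta> \<rho> \<omega>) (-J)"
    have n1: "1 \<le> n" using n by simp
    have good: "rest_good n (Some ` (-J)) None \<omega>" using \<omega> by simp
    obtain R where R: "R \<subseteq> D" "finite R" "card R \<le> n ^ 3"
      "\<And>\<zeta>. \<zeta> \<in> D \<Longrightarrow> max_corr (rest_col enc n J \<omega>) (-J) \<zeta> < real n / 32 \<Longrightarrow> \<exists>\<zeta>'\<in>R. norm (\<zeta> - \<zeta>') \<le> 1 / n"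
      using residual_dirs_net[OF Qne n1, of "rest_col enc n J \<omega>" "rest_resp enc n J \<beta> \<rho> \<omega>"]
        max_corr_rest_ge[OF enc n1 Qne order_refl good] unfolding D_def by blast
    define Rf where "Rf = (\<lambda>\<zeta> i. \<zeta> $ enc i) ` R"
    \<comment> \<open>the net depends on the outer coordinates only, so for the block it is a fixed finite set\<close>
    let ?H = "{\<omega>' \<in> space (gauss_array ?I2). block_good n (Some ` J) l Rf \<omega>'}"
    have H: "?H \<in> sets (gauss_array ?I2)" "9 / 10 \<le> measure (gauss_array ?I2) ?H"
    proof -
      have Rf1: "(\<Sum>i=1..n. (f i)\<^sup>2) = 1" if "f \<in> Rf" for f
        using that R(1) residual_dirs_rest[OF enc] by (auto simp: Rf_def D_def)
      have Rfc: "finite Rf" "card Rf \<le> n ^ 3"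
        using R(2,3) card_image_le[OF R(2)] unfolding Rf_def by (auto intro: order_trans)
      have cm: "888 * l\<^sup>2 \<le> real (card (Some ` J))" using num(4) by (simp add: card_image m_def)
      show "?H \<in> sets (gauss_array ?I2)" "9 / 10 \<le> measure (gauss_array ?I2) ?H"
        by (rule block_good_prob[OF _ n4 l_def[THEN meta_eq_to_obj_eq] l16 cm Rfc Rf1]; simp)+
    qed
    show "\<exists>H\<in>sets (gauss_array ?I2). 9 / 10 \<le> measure (gauss_array ?I2) H \<and>
      (\<forall>\<omega>'\<in>H. merge ?I1 ?I2 (\<omega>, \<omega>') \<in> ?F)"
    proof (intro bexI[of _ ?H] conjI H ballI)
      fix \<omega>' assume \<omega>': "\<omega>' \<in> ?H"
      define \<eta> where "\<eta> = merge ?I1 ?I2 (\<omega>, \<omega>')"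
      have \<eta>1: "\<eta> (i, k) = \<omega> (i, k)" if "i \<in> {1..n}" "k \<notin> Some ` J" for i k
        using that by (simp add: \<eta>_def merge_def)
      have \<eta>2: "\<eta> (i, k) = \<omega>' (i, k)" if "i \<in> {1..n}" "k \<in> Some ` J" for i k
        using that by (auto simp: \<eta>_def merge_def)
      have \<eta>S: "\<eta> (i, Some j) = \<omega> (i, Some j)" if "i \<in> {1..n}" "j \<notin> J" for i j
        by (rule \<eta>1[OF that(1)]) (use that(2) in auto)
      have \<eta>N: "\<eta> (i, None) = \<omega> (i, None)" if "i \<in> {1..n}" for i
        by (rule \<eta>1[OF that]) auto
      have \<eta>sp: "\<eta> \<in> space (gauss_array ?I)"
      proof -
        have "merge ?I1 ?I2 \<in> gauss_array ?I1 \<Otimes>\<^sub>M gauss_array ?I2 \<rightarrow>\<^sub>M gauss_array (?I1 \<union> ?I2)"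
          unfolding gauss_array_def by (rule measurable_merge)
        moreover have "(\<omega>, \<omega>') \<in> space (gauss_array ?I1 \<Otimes>\<^sub>M gauss_array ?I2)"
          using \<omega> \<omega>' by (simp add: space_pair_measure)
        ultimately show ?thesis unfolding I12(1) \<eta>_def by (rule measurable_space)
      qed
      have col: "rest_col enc n J \<eta> = rest_col enc n J \<omega>"
        unfolding rest_col_def embed_vec_def
        by (intro ext if_cong refl sum.cong) (simp_all add: \<eta>S)
      have resp: "rest_resp enc n J \<beta> \<rho> \<eta> = rest_resp enc n J \<beta> \<rho> \<omega>"
        unfolding rest_resp_def embed_vec_def
        by (intro sum.cong refl arg_cong2[where f = "(*\<^sub>R)"] arg_cong2[where f = "(+)"]) (simp_all add: \<eta>S \<eta>N)
      have rg: "rest_good n (Some ` (-J)) None \<eta>"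
      proof -
        have "\<eta> (i, k) = \<omega> (i, k)" if "i \<in> {1..n}" "k \<in> insert None (Some ` (-J))" for i k
          by (rule \<eta>1[OF that(1)]) (use that(2) in auto)
        then have "rest_good n (Some ` (-J)) None \<eta> \<longleftrightarrow> rest_good n (Some ` (-J)) None \<omega>"
          by (rule rest_good_cong)
        then show ?thesis using good by blast
      qed
      have bg: "block_good n (Some ` J) l Rf \<eta>"
      proof -
        have "block_good n (Some ` J) l Rf \<eta> \<longleftrightarrow> block_good n (Some ` J) l Rf \<omega>'"
          by (rule block_good_cong) (rule \<eta>2)
        then show ?thesis using \<omega>' by blast
      qed
      have \<rho>_eq: "sqrt ((2 / 5 / sqrt (real (card J)))\<^sup>2 + \<sigma>\<^sup>2) = \<rho>"
        by (simp add: \<rho>_def s_def m_def)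
      have "\<exists>b\<in>l1_predictors n (smp \<eta>) B. 1 / (320 * (sqrt K * l)) \<le> norm (b - \<beta>)" if B: "0 \<le> B" for B
      proof (rule predictor_far_of_good[OF enc n4 Qne order_refl Jne k10 l16 num(1,2)[unfolded m_def] num(3)[unfolded m_def]
            \<sigma> \<sigma>K \<beta> _ _ _ rg _ _ _ B, where R = R])
        fix i assume i: "i \<in> {1..n}"
        show "fst (smp \<eta> i) $ j = \<eta> (i, Some j)" if "j \<notin> J" for j
          using i that by (simp add: smp_def \<Phi>_def U(2))
        show "fst (smp \<eta> i) $ j = \<eta> (i, Some j) - ((sqrt ((2 / 5 / sqrt (real (card J)))\<^sup>2 + \<sigma>\<^sup>2) + \<sigma>) /
            sqrt ((2 / 5 / sqrt (real (card J)))\<^sup>2 + \<sigma>\<^sup>2) * ((\<Sum>j'\<in>J. \<eta> (i, Some j')) / sqrt (real (card J))) -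
            2 / 5 / sqrt (real (card J)) / sqrt ((2 / 5 / sqrt (real (card J)))\<^sup>2 + \<sigma>\<^sup>2) * \<eta> (i, None)) / sqrt (real (card J))"
          if "j \<in> J" for j
          using i that by (simp add: smp_def \<Phi>_def U(3) \<rho>_def s_def m_def)
        show "snd (smp \<eta> i) = sqrt ((2 / 5 / sqrt (real (card J)))\<^sup>2 + \<sigma>\<^sup>2) * \<eta> (i, None) + (\<Sum>j\<in>- J. \<beta> $ j * \<eta> (i, Some j))"
          using i by (simp add: smp_def \<Phi>_def U(4) \<rho>_def s_def m_def)
      qed (simp_all only: \<rho>_eq col resp D_def[symmetric] Rf_def[symmetric] R(1,4) bg)
      then have "smp \<eta> \<in> ?Ev"
        using measurable_space[OF smpm \<eta>sp] sets_eq_imp_space_eq[OF sets_sample_distr[of n \<beta> \<sigma>]]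
        by (simp add: E_def)
      then show "merge ?I1 ?I2 (\<omega>, \<omega>') \<in> ?F" using \<eta>sp by (simp add: \<eta>_def)
    qed
  qed auto
  then show ?thesis unfolding E_def[symmetric] meas I12(1) by linarith
qed

theorem theorem1:
  fixes n :: nat and \<sigma> :: real
  assumes "n \<ge> 30" and "CARD('p::finite) \<ge> 3 * n" and "\<sigma> \<ge> 0"
  shows "\<exists>\<beta> :: real ^ 'p.
    1 / 2 \<le> norm \<beta> \<and> norm \<beta> \<le> l1_norm \<beta> \<and> l1_norm \<beta> \<le> 1 \<and>
    (\<forall>S \<in> space (sample_distr n \<beta> \<sigma>). \<forall>B \<ge> 0. \<exists>b \<in> l1_predictors n S B.
       test_error \<beta> \<sigma> b \<ge> \<sigma>\<^sup>2 + 1 / (32 * real n * (ln (3 * real n))\<^sup>2)) \<and>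
    (\<sigma> > 0 \<and> 100 \<le> sqrt (real n) / \<sigma> \<and> sqrt (real n) / \<sigma> \<le> real CARD('p) \<longrightarrow>
       measure (sample_distr n \<beta> \<sigma>)
         {S \<in> space (sample_distr n \<beta> \<sigma>). \<forall>B \<ge> 0. \<exists>b \<in> l1_predictors n S B.
            test_error \<beta> \<sigma> b \<ge> \<sigma>\<^sup>2 + \<sigma> / (102400 * sqrt (real n) *
              (ln (max (3 * real n) (real_of_int \<lceil>sqrt (real n) / \<sigma>\<rceil>)))\<^sup>2)} \<ge> 1 / 2)"
proof -
  define K where "K = sqrt n / \<sigma>"
  define l where "l = ln (3 * real n)"
  \<comment> \<open>outside this regime the sparsity bound \<open>1 / (400 * n)\<close> is at least \<open>1 / (102400 * K * l\<^sup>2)\<close>, as \<open>102400 = 400 * 256\<close>\<close>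
  define reg where "reg \<longleftrightarrow> \<sigma> > 0 \<and> 100 \<le> K \<and> 256 * K * l\<^sup>2 < n"
  define m where "m = (if reg then nat \<lfloor>9 * l\<^sup>2 * K\<rfloor> else 0)"
  have l4: "4 \<le> l"
    using le_ln_if_power_le[of 4 "3 * real n"] assms(1) by (simp add: l_def power_divide)
  then have l16: "16 \<le> l\<^sup>2" using power_mono[of 4 l 2] by simp
  have mn: "28 * m \<le> n"
  proof (cases reg)
    case True
    then have r: "\<sigma> > 0" "100 \<le> K" "256 * K * l\<^sup>2 < n" by (auto simp: reg_def)
    have "16 \<le> l" unfolding l_def by (rule block_regime_size(1)[OF assms(1) r(2)]) (use r(3) in \<open>simp add: l_def\<close>)
    from block_regime_numerics(3)[OF r(2) this r(3)] have "real (28 * m) \<le> real n" using True by (simp add: m_def)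
    then show ?thesis by (simp only: of_nat_le_iff)
  qed (simp add: m_def)
  have "m + 2 * n + 1 \<le> CARD('p)" using mn assms by linarith
  then obtain J :: "'p set" where J: "card J = m"
    using obtain_subset_with_card_n[of m "UNIV :: 'p set"] by (metis add_leD1 add.assoc)
  have "2 * n + 1 \<le> card (-J)" using J \<open>m + 2 * n + 1 \<le> CARD('p)\<close> by (simp add: Compl_eq_Diff_UNIV card_Diff_subset)
  then obtain A where A: "A \<subseteq> -J" "card A = 2 * n"
    using obtain_subset_with_card_n[of "2 * n" "-J"] by auto
  have "card (J \<union> A) = m + 2 * n" using A J by (subst card_Un_disjoint) auto
  then have "J \<union> A \<noteq> UNIV" using \<open>m + 2 * n + 1 \<le> CARD('p)\<close> by auto
  then obtain j0 where j0: "j0 \<notin> J" "j0 \<notin> A" by auto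
  \<comment> \<open>the masses are \<open>2 / 5\<close>, \<open>1 / 10\<close> and \<open>1 / 2\<close>; for \<open>m = 0\<close> the block is empty\<close>
  define \<beta> :: "real ^ 'p" where
    "\<beta> = (\<chi> j. if j \<in> J then (2 / 5) / m else if j \<in> A then 1 / (20 * real n) else if j = j0 then 1 / 2 else 0)"
  have \<beta>J: "\<beta> $ j = (2 / 5) / real (card J)" if "j \<in> J" for j using that by (simp add: \<beta>_def J)
  have \<beta>A: "\<beta> $ j = 1 / (20 * real n)" if "j \<in> A" for j using that A by (auto simp: \<beta>_def)
  have l1: "l1_norm \<beta> \<le> 1"
  proof -
    have "l1_norm \<beta> = (\<Sum>j\<in>UNIV. (if j \<in> J then (2 / 5) / m else 0) + (if j \<in> A then 1 / (20 * real n) else 0)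
        + (if j = j0 then 1 / 2 else 0))"
      unfolding l1_norm_def by (rule sum.cong) (use A j0 in \<open>auto simp: \<beta>_def\<close>)
    also have "\<dots> = real m * ((2 / 5) / m) + real (2 * n) * (1 / (20 * real n)) + 1 / 2"
      by (simp add: sum.distrib sum.If_cases J A(2))
    also have "\<dots> \<le> 1" using assms(1) by simp
    finally show ?thesis .
  qed
  have half: "1 / 2 \<le> norm \<beta>"
    using component_le_norm_cart[of \<beta> j0] j0 by (simp add: \<beta>_def)
  have l1n: "norm \<beta> \<le> l1_norm \<beta>" unfolding l1_norm_def by (rule norm_le_l1_cart)
  have sparse: "\<exists>b\<in>l1_predictors n S B. test_error \<beta> \<sigma> b \<ge> \<sigma>\<^sup>2 + 1 / (400 * real n)" if "0 \<le> B" for S B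
  proof -
    have "n \<le> CARD('p)" using assms by simp
    note ex = sparse_l1_predictor_exists[OF this that, of S]
    obtain b where b: "b \<in> l1_predictors n S B" "card {j. b $ j \<noteq> 0} \<le> n" using ex .
    have "real n * (1 / (20 * real n))\<^sup>2 \<le> (norm (b - \<beta>))\<^sup>2"
      by (rule sparse_error_lower_bound[OF b(2) A(2) \<beta>A])
    moreover have "real n * (1 / (20 * real n))\<^sup>2 = 1 / (400 * real n)"
      using assms(1) by (simp add: power2_eq_square)
    ultimately show ?thesis using b(1) by (auto simp: test_error_eq[OF assms(3)])
  qed
  have a: "\<forall>S \<in> space (sample_distr n \<beta> \<sigma>). \<forall>B \<ge> 0. \<exists>b \<in> l1_predictors n S B.
       test_error \<beta> \<sigma> b \<ge> \<sigma>\<^sup>2 + 1 / (32 * real n * (ln (3 * real n))\<^sup>2)"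
  proof -
    have "400 * real n \<le> 32 * real n * l\<^sup>2" using l16 assms(1) by simp
    then have "1 / (32 * real n * l\<^sup>2) \<le> 1 / (400 * real n)"
      using assms(1) l4 by (intro divide_left_mono mult_pos_pos) auto
    then show ?thesis unfolding l_def[symmetric] using sparse by (meson add_left_mono order_trans)
  qed
  have b: "1 / 2 \<le> measure (sample_distr n \<beta> \<sigma>)
         {S \<in> space (sample_distr n \<beta> \<sigma>). \<forall>B \<ge> 0. \<exists>b \<in> l1_predictors n S B.
            test_error \<beta> \<sigma> b \<ge> \<sigma>\<^sup>2 + \<sigma> / (102400 * sqrt (real n) *
              (ln (max (3 * real n) (real_of_int \<lceil>sqrt (real n) / \<sigma>\<rceil>)))\<^sup>2)}"
    if h: "\<sigma> > 0" "100 \<le> sqrt (real n) / \<sigma>"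
  proof -
    interpret prob_space "sample_distr n \<beta> \<sigma>" by (rule prob_space_sample_distr) (rule assms)
    define L where "L = ln (max (3 * real n) (real_of_int \<lceil>sqrt (real n) / \<sigma>\<rceil>))"
    define e where "e = \<sigma> / (102400 * sqrt n * L\<^sup>2)"
    have K: "100 \<le> K" using h by (simp add: K_def)
    have "l \<le> L" unfolding l_def L_def using assms(1) by (subst ln_le_cancel_iff) auto
    then have "l\<^sup>2 \<le> L\<^sup>2" using l4 by (intro power_mono) auto
    have "e = 1 / (102400 * K * L\<^sup>2)" using h(1) by (simp add: e_def K_def)
    also have "\<dots> \<le> 1 / (102400 * K * l\<^sup>2)"
      using \<open>l\<^sup>2 \<le> L\<^sup>2\<close> K l16 by (intro divide_left_mono mult_left_mono mult_pos_pos) auto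
    finally have e: "e \<le> 1 / (102400 * K * l\<^sup>2)" .
    let ?W = "{S \<in> space (sample_distr n \<beta> \<sigma>). \<forall>B \<ge> 0. \<exists>b \<in> l1_predictors n S B. test_error \<beta> \<sigma> b \<ge> \<sigma>\<^sup>2 + e}"
    have "1 / 2 \<le> prob ?W"
    proof (cases reg)
      case False
      then have "real n \<le> 256 * K * l\<^sup>2" using h K by (auto simp: reg_def)
      then have "400 * real n \<le> 102400 * K * l\<^sup>2" by simp
      then have "1 / (102400 * K * l\<^sup>2) \<le> 1 / (400 * real n)"
        using assms(1) K l16 by (intro divide_left_mono mult_pos_pos) auto
      then have "e \<le> 1 / (400 * real n)" using e by linarith
      then have "\<exists>b\<in>l1_predictors n S B. \<sigma>\<^sup>2 + e \<le> test_error \<beta> \<sigma> b" if "0 \<le> B" for S B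
        using sparse[OF that] by (meson add_left_mono order_trans)
      then have "?W = space (sample_distr n \<beta> \<sigma>)" by blast
      then show ?thesis using prob_space by simp
    next
      case True
      then have r: "256 * K * l\<^sup>2 < n" by (simp add: reg_def)
      let ?V = "{S \<in> space (sample_distr n \<beta> \<sigma>). \<forall>B\<ge>0. \<exists>b\<in>l1_predictors n S B. 1 / (320 * (sqrt K * l)) \<le> norm (b - \<beta>)}"
      have V: "1 / 2 \<le> prob ?V"
        unfolding K_def l_def
        by (rule block_regime_probability[OF assms(1,2) h(1,2) _ _ \<beta>J])
           (use r J True in \<open>simp_all add: K_def l_def m_def\<close>)
      have imp: "\<sigma>\<^sup>2 + e \<le> test_error \<beta> \<sigma> b" if "1 / (320 * (sqrt K * l)) \<le> norm (b - \<beta>)" for b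
      proof -
        have "(1 / (320 * (sqrt K * l)))\<^sup>2 \<le> (norm (b - \<beta>))\<^sup>2"
          using that l4 K by (intro power_mono) auto
        moreover have "(1 / (320 * (sqrt K * l)))\<^sup>2 = 1 / (102400 * K * l\<^sup>2)"
          using K by (simp add: power_divide power_mult_distrib)
        ultimately show ?thesis using e by (simp add: test_error_eq[OF assms(3)])
      qed
      \<comment> \<open>puts the event into the form whose measurability is known\<close>
      have iff: "\<sigma>\<^sup>2 + e \<le> test_error \<beta> \<sigma> b \<longleftrightarrow> sqrt e \<le> norm (b - \<beta>)" for b
        unfolding test_error_eq[OF assms(3)] by (auto intro: real_le_lsqrt dest: sqrt_le_D)
      have "?W \<in> events"
        unfolding iff by (rule far_event_measurable)
      then have "prob ?V \<le> prob ?W"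
        by (intro finite_measure_mono) (use imp in blast)
      then show ?thesis using V by linarith
    qed
    then show ?thesis by (simp only: e_def L_def)
  qed
  show ?thesis
    by (intro exI[of _ \<beta>] conjI half l1n l1 a impI b) auto
qed

end
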